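(* Let $K$ be an algebraically closed field of characteristic zero. Then the poset $\operatorname{Var}(K)$ is elementarily equivalent to the poset $\operatorname{Var}(\mathbb C)$ if and only if $K$ has infinite transcendence degree (over $\mathbb Q$).
   Context: For a field $F$, $\operatorname{Var}(F)$ is the poset, ordered by inclusion, of all irreducible Zariski closed proper subsets of the projective plane $\mathbb P^2(F)$ (points and irreducible curves), viewed as a first-order structure in the language of partial orders. *)

theory Defs
  imports
    "HOL-Analysis.Finite_Cartesian_Product"
    "HOL-Library.Poly_Mapping"
    "HOL-Library.Numeral_Type"
    "HOL-Computational_Algebra.Fundamental_Theorem_Algebra"
begin

section \<open>Multivariate polynomials\<close>

text \<open>
  Polynomials over \<open>'a\<close> in variables indexed by \<open>'i\<close>: finitely supported coefficient functions on
  the exponent vectors \<open>'i \<Rightarrow>\<^sub>0 nat\<close>.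
\<close>

type_synonym ('i, 'a) mpoly = "('i \<Rightarrow>\<^sub>0 nat) \<Rightarrow>\<^sub>0 'a"

definition mpoly_eval :: "('i, 'a::comm_ring_1) mpoly \<Rightarrow> ('i \<Rightarrow> 'a) \<Rightarrow> 'a" where
  "mpoly_eval p x =
     (\<Sum>m\<in>Poly_Mapping.keys p. Poly_Mapping.lookup p m *
        (\<Prod>i\<in>Poly_Mapping.keys m. x i ^ Poly_Mapping.lookup m i))"

definition mpoly_homogeneous :: "('i, 'a::comm_ring_1) mpoly \<Rightarrow> bool" where
  "mpoly_homogeneous p \<longleftrightarrow>
     (\<exists>d. \<forall>m\<in>Poly_Mapping.keys p.
        (\<Sum>i\<in>Poly_Mapping.keys m. Poly_Mapping.lookup m i) = d)"

section \<open>The projective plane and its Zariski topology\<close>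

definition proportional :: "(('a::field ^ 3) \<times> ('a ^ 3)) set" where
  "proportional = {(x, y). x \<noteq> 0 \<and> (\<exists>c. c \<noteq> 0 \<and> y = c *s x)}"

definition proj_plane :: "('a::field ^ 3) set set" where
  "proj_plane = (UNIV - {0}) // proportional"

definition proj_zeros :: "(3, 'a::field) mpoly set \<Rightarrow> ('a ^ 3) set set" where
  "proj_zeros S = {P \<in> proj_plane. \<forall>p\<in>S. \<forall>x\<in>P. mpoly_eval p (\<lambda>i. x $ i) = 0}"

definition zariski_closed :: "('a::field ^ 3) set set \<Rightarrow> bool" where
  "zariski_closed Z \<longleftrightarrow> (\<exists>S. (\<forall>p\<in>S. mpoly_homogeneous p) \<and> Z = proj_zeros S)"

text \<open>
  For closed \<open>Z\<close>, the sets closed in the subspace topology of \<open>Z\<close> are exactly the closed subsets of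
  the plane contained in \<open>Z\<close>, so irreducibility of the subspace \<open>Z\<close> can be expressed as follows.
\<close>

definition zariski_irreducible_closed :: "('a::field ^ 3) set set \<Rightarrow> bool" where
  "zariski_irreducible_closed Z \<longleftrightarrow>
     zariski_closed Z \<and> Z \<noteq> {} \<and>
     (\<forall>A B. zariski_closed A \<and> zariski_closed B \<and> Z = A \<union> B \<longrightarrow> Z = A \<or> Z = B)"

definition Var :: "('a::field ^ 3) set set set" where
  "Var = {Z. zariski_irreducible_closed Z \<and> Z \<noteq> proj_plane}"

section \<open>First-order logic in the language of partial orders\<close>

datatype po_formula =
    Eq nat nat
  | Le nat nat
  | Neg po_formula
  | Conj po_formula po_formula
  | Exi nat po_formula

primrec free_vars :: "po_formula \<Rightarrow> nat set" where
  "free_vars (Eq i j) = {i, j}"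
| "free_vars (Le i j) = {i, j}"
| "free_vars (Neg \<phi>) = free_vars \<phi>"
| "free_vars (Conj \<phi> \<psi>) = free_vars \<phi> \<union> free_vars \<psi>"
| "free_vars (Exi i \<phi>) = free_vars \<phi> - {i}"

definition sentence :: "po_formula \<Rightarrow> bool" where
  "sentence \<phi> \<longleftrightarrow> free_vars \<phi> = {}"

primrec satisfies ::
  "'s set \<Rightarrow> ('s \<Rightarrow> 's \<Rightarrow> bool) \<Rightarrow> (nat \<Rightarrow> 's) \<Rightarrow> po_formula \<Rightarrow> bool" where
  "satisfies D le e (Eq i j) \<longleftrightarrow> e i = e j"
| "satisfies D le e (Le i j) \<longleftrightarrow> le (e i) (e j)"
| "satisfies D le e (Neg \<phi>) \<longleftrightarrow> \<not> satisfies D le e \<phi>"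
| "satisfies D le e (Conj \<phi> \<psi>) \<longleftrightarrow> satisfies D le e \<phi> \<and> satisfies D le e \<psi>"
| "satisfies D le e (Exi i \<phi>) \<longleftrightarrow> (\<exists>a\<in>D. satisfies D le (e(i := a)) \<phi>)"

definition models :: "'s set \<Rightarrow> ('s \<Rightarrow> 's \<Rightarrow> bool) \<Rightarrow> po_formula \<Rightarrow> bool" where
  "models D le \<phi> \<longleftrightarrow> (\<forall>e. (\<forall>n. e n \<in> D) \<longrightarrow> satisfies D le e \<phi>)"

definition elementarily_equivalent ::
  "'s set \<Rightarrow> ('s \<Rightarrow> 's \<Rightarrow> bool) \<Rightarrow> 't set \<Rightarrow> ('t \<Rightarrow> 't \<Rightarrow> bool) \<Rightarrow> bool" where
  "elementarily_equivalent D le D' le' \<longleftrightarrow>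
     (\<forall>\<phi>. sentence \<phi> \<longrightarrow> (models D le \<phi> \<longleftrightarrow> models D' le' \<phi>))"

section \<open>Transcendence degree over the rationals\<close>

text \<open>
  The polynomials relating elements of \<open>B\<close> use the elements of \<open>B\<close> themselves as names of the
  variables, hence the evaluation at the identity.
\<close>

definition alg_independent :: "'a::field_char_0 set \<Rightarrow> bool" where
  "alg_independent B \<longleftrightarrow>
     (\<forall>p :: ('a, 'a) mpoly.
        (\<forall>m\<in>Poly_Mapping.keys p. Poly_Mapping.keys m \<subseteq> B) \<and>
        (\<forall>m. Poly_Mapping.lookup p m \<in> \<rat>) \<and>
        mpoly_eval p (\<lambda>b. b) = 0 \<longrightarrow> p = 0)"

definition transcendence_basis :: "'a::field_char_0 set \<Rightarrow> bool" where
  "transcendence_basis B \<longleftrightarrow>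
     alg_independent B \<and> (\<forall>C. alg_independent C \<and> B \<subseteq> C \<longrightarrow> C = B)"

text \<open>
  A cardinal in the sense of \<^const>\<open>card_of\<close>. A transcendence basis exists by Zorn's lemma,
  and any two of them are equipotent.
\<close>

definition transcendence_degree :: "'a::field_char_0 rel" where
  "transcendence_degree = card_of (SOME B. transcendence_basis B)"

end

theory Submission
  imports Defs "HOL-Analysis.Cartesian_Space" "HOL-Analysis.Continuum_Not_Denumerable"
begin

text \<open>
  If the transcendence degree is infinite, every isomorphism between finitely generated subfields of \<open>K\<close>
  and \<open>\<complex>\<close> extends to any further element on either side. A subvariety is a point or the zero set of
  a form, hence is determined by finitely many coefficients, and such isomorphisms give a winning strategy
  in the Ehrenfeucht-Fraisse game.

  If the transcendence degree is finite, some sentence separates the two posets. A curve meeting each of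
  three concurrent lines in one point only meets them in collinear points; this recovers
  addition and multiplication on the line at infinity from incidence. Finite sets of points on that line
  are its intersections with curves, so one can quantify over finite sets and express, through Horner schemes,
  that every element is algebraic over finitely many given ones. In \<open>Var(\<complex>)\<close> the elements algebraic over
  finitely many ones, with respect to any operations so defined, form a countable set,
  whereas the line is uncountable.
\<close>

section \<open>Evaluation of multivariate polynomials\<close>

text \<open>The separating sentence has no definition of "line" at its disposal: a curve that merely
  looks like a line from three fixed lines has to do, and characteristic zero enters when its second
  coefficients are divided by its degree. The reference figure and the generators of the field are
  free variables, quantified existentially at the end. The sentence does not say that the figure is
  in standard position; it lists the axioms that the counting argument uses (a ring without zero
  divisors, codes for finite sets). So over the complex numbers every choice of parameters is
  refuted, and coordinates are computed only for one choice over \<open>K\<close>. The first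
  generator is always 2: Horner's scheme with digits 0, 1, -1 at 2 produces the integers. A
  nontrivial equation for x is written c + x h(x) = 0 with c nonzero, which makes nontriviality
  expressible. For the converse, that a variety is given by finitely many coefficients needs a
  classification of irreducible closed sets, obtained from pseudo-division and Gauss's lemma in an
  affine chart. Statements about all points of a variety are transferred one point at a time, each
  after enlarging the isomorphism by its coordinates.\<close>

definition mon_eval :: "('i \<Rightarrow>\<^sub>0 nat) \<Rightarrow> ('i \<Rightarrow> 'a::comm_ring_1) \<Rightarrow> 'a" where
  "mon_eval m x = (\<Prod>i\<in>Poly_Mapping.keys m. x i ^ Poly_Mapping.lookup m i)"

lemma mon_eval_superset:
  assumes "finite I" "Poly_Mapping.keys m \<subseteq> I"
  shows "mon_eval m x = (\<Prod>i\<in>I. x i ^ Poly_Mapping.lookup m i)"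
  unfolding mon_eval_def using assms
  by (intro prod.mono_neutral_left) (auto simp: in_keys_iff)

lemma mon_eval_add: "mon_eval (m + n) x = mon_eval m x * mon_eval n x"
proof -
  let ?I = "Poly_Mapping.keys m \<union> Poly_Mapping.keys n"
  have "mon_eval (m + n) x = (\<Prod>i\<in>?I. x i ^ Poly_Mapping.lookup (m + n) i)"
    by (rule mon_eval_superset) (auto simp: keys_add)
  also have "\<dots> = (\<Prod>i\<in>?I. x i ^ Poly_Mapping.lookup m i) * (\<Prod>i\<in>?I. x i ^ Poly_Mapping.lookup n i)"
    by (simp add: lookup_add power_add prod.distrib)
  also have "\<dots> = mon_eval m x * mon_eval n x"
    by (simp add: mon_eval_superset[of ?I])
  finally show ?thesis .
qed

lemma mon_eval_0 [simp]: "mon_eval 0 x = 1"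
  by (simp add: mon_eval_def)

lemma mon_eval_single: "mon_eval (Poly_Mapping.single i n) x = x i ^ n"
  by (cases "n = 0") (simp_all add: mon_eval_def)

lemma mpoly_eval_superset:
  assumes "finite M" "Poly_Mapping.keys p \<subseteq> M"
  shows "mpoly_eval p x = (\<Sum>m\<in>M. Poly_Mapping.lookup p m * mon_eval m x)"
  unfolding mpoly_eval_def mon_eval_def[symmetric] using assms
  by (intro sum.mono_neutral_left) (auto simp: in_keys_iff)

lemma mpoly_eval_0 [simp]: "mpoly_eval 0 x = 0"
  by (simp add: mpoly_eval_def)

lemma mpoly_eval_add: "mpoly_eval (p + q) x = mpoly_eval p x + mpoly_eval q x"
proof -
  let ?M = "Poly_Mapping.keys p \<union> Poly_Mapping.keys q"
  have "mpoly_eval (p + q) x = (\<Sum>m\<in>?M. Poly_Mapping.lookup (p + q) m * mon_eval m x)"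
    by (rule mpoly_eval_superset) (auto simp: Poly_Mapping.keys_add)
  also have "\<dots> = mpoly_eval p x + mpoly_eval q x"
    by (simp add: lookup_add distrib_right sum.distrib mpoly_eval_superset[of ?M])
  finally show ?thesis .
qed

lemma mpoly_eval_sum: "mpoly_eval (\<Sum>a\<in>A. f a) x = (\<Sum>a\<in>A. mpoly_eval (f a) x)"
  by (induction A rule: infinite_finite_induct) (auto simp: mpoly_eval_add)

lemma mpoly_eval_single: "mpoly_eval (Poly_Mapping.single m c) x = c * mon_eval m x"
  by (cases "c = 0") (simp_all add: mpoly_eval_def mon_eval_def)

lemma poly_mapping_sum_singles:
  "p = (\<Sum>m\<in>Poly_Mapping.keys p. Poly_Mapping.single m (Poly_Mapping.lookup p m))"
  by (rule poly_mapping_eqI)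
    (simp add: lookup_sum lookup_single when_def sum.delta in_keys_iff)

lemma mpoly_mult_expand:
  "p * q = (\<Sum>m\<in>Poly_Mapping.keys p. \<Sum>n\<in>Poly_Mapping.keys q.
      Poly_Mapping.single (m + n) (Poly_Mapping.lookup p m * Poly_Mapping.lookup q n))"
  by (subst (1) poly_mapping_sum_singles[of p], subst (1) poly_mapping_sum_singles[of q])
    (simp add: sum_product mult_single)

lemma mpoly_eval_mult: "mpoly_eval (p * q) x = mpoly_eval p x * mpoly_eval q x"
proof -
  have "mpoly_eval (p * q) x = (\<Sum>m\<in>Poly_Mapping.keys p. \<Sum>n\<in>Poly_Mapping.keys q.
      (Poly_Mapping.lookup p m * mon_eval m x) * (Poly_Mapping.lookup q n * mon_eval n x))"
    unfolding mpoly_mult_expand[of p q]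
    by (simp add: mpoly_eval_sum mpoly_eval_single mon_eval_add algebra_simps)
  thus ?thesis
    by (simp add: sum_product mpoly_eval_superset[of "Poly_Mapping.keys p" p]
        mpoly_eval_superset[of "Poly_Mapping.keys q" q])
qed

section \<open>Forms in three variables and closed sets\<close>

text \<open>Forms are kept as functions, so that equality is extensional. The degree is part of the
  predicate, and the zero function is a form of every degree.\<close>

definition is_form :: "nat \<Rightarrow> ('a::field ^ 3 \<Rightarrow> 'a) \<Rightarrow> bool" where
  "is_form d F \<longleftrightarrow> (\<exists>p. (\<forall>m\<in>Poly_Mapping.keys p. (\<Sum>i\<in>Poly_Mapping.keys m. Poly_Mapping.lookup m i) = d) \<and>
     F = (\<lambda>v. mpoly_eval p (\<lambda>i. v $ i)))"

definition tri :: "nat \<Rightarrow> (nat \<times> nat) set" where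
  "tri d = {(a, b). a + b \<le> d}"

lemma finite_tri [simp]: "finite (tri d)"
  by (rule finite_subset[of _ "{..d} \<times> {..d}"]) (auto simp: tri_def)

lemma tri_iff [simp]: "(a, b) \<in> tri d \<longleftrightarrow> a + b \<le> d"
  by (simp add: tri_def)

text \<open>\<open>i, j, k\<close> are meant to be the three coordinates in some order.\<close>

definition form3 :: "3 \<Rightarrow> 3 \<Rightarrow> 3 \<Rightarrow> nat \<Rightarrow> (nat \<Rightarrow> nat \<Rightarrow> 'a::field) \<Rightarrow> 'a ^ 3 \<Rightarrow> 'a" where
  "form3 i j k d c v = (\<Sum>(a, b)\<in>tri d. c a b * (v $ i ^ a * v $ j ^ b * v $ k ^ (d - a - b)))"

definition distinct3 :: "3 \<Rightarrow> 3 \<Rightarrow> 3 \<Rightarrow> bool" where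
  "distinct3 i j k \<longleftrightarrow> i \<noteq> j \<and> i \<noteq> k \<and> j \<noteq> k"

lemma distinct3_UNIV:
  assumes "distinct3 i j k" shows "UNIV = {i, j, k}"
proof -
  have "card {i, j, k} = CARD(3)" using assms by (auto simp: distinct3_def)
  thus ?thesis by (metis card_subset_eq finite subset_UNIV)
qed

lemma is_form_monom:
  assumes "distinct3 i j k"
  shows "is_form (a + b + e) (\<lambda>v. c * (v $ i ^ a * v $ j ^ b * v $ k ^ e))"
  unfolding is_form_def
proof (intro exI conjI ballI)
  let ?m = "Poly_Mapping.single i a + Poly_Mapping.single j b + Poly_Mapping.single k e"
  let ?p = "Poly_Mapping.single ?m c"
  fix m assume "m \<in> Poly_Mapping.keys ?p"
  hence m: "m = ?m" by (auto split: if_splits)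
  have "(\<Sum>l\<in>Poly_Mapping.keys m. Poly_Mapping.lookup m l) = (\<Sum>l\<in>UNIV. Poly_Mapping.lookup m l)"
    by (rule sum.mono_neutral_left) (auto simp: in_keys_iff)
  also have "\<dots> = a + b + e"
    using assms unfolding distinct3_UNIV[OF assms] m
    by (auto simp: distinct3_def lookup_add lookup_single when_def)
  finally show "(\<Sum>l\<in>Poly_Mapping.keys m. Poly_Mapping.lookup m l) = a + b + e" .
next
  show "(\<lambda>v. c * (v $ i ^ a * v $ j ^ b * v $ k ^ e)) =
    (\<lambda>v. mpoly_eval (Poly_Mapping.single (Poly_Mapping.single i a + Poly_Mapping.single j b
       + Poly_Mapping.single k e) c) (\<lambda>i. v $ i))"
    by (simp add: mpoly_eval_single mon_eval_add mon_eval_single)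
qed

lemma is_form_0: "is_form d (\<lambda>v. 0)"
  unfolding is_form_def by (rule exI[of _ 0]) auto

lemma is_form_add: "is_form d F \<Longrightarrow> is_form d G \<Longrightarrow> is_form d (\<lambda>v. F v + G v)"
  unfolding is_form_def
proof (elim exE conjE)
  fix p q assume "\<forall>m\<in>Poly_Mapping.keys p. (\<Sum>i\<in>Poly_Mapping.keys m. Poly_Mapping.lookup m i) = d"
    "\<forall>m\<in>Poly_Mapping.keys q. (\<Sum>i\<in>Poly_Mapping.keys m. Poly_Mapping.lookup m i) = d"
    and F: "F = (\<lambda>v. mpoly_eval p (($) v))" "G = (\<lambda>v. mpoly_eval q (($) v))"
  thus "\<exists>p. (\<forall>m\<in>Poly_Mapping.keys p. (\<Sum>i\<in>Poly_Mapping.keys m. Poly_Mapping.lookup m i) = d) \<and>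
        (\<lambda>v. F v + G v) = (\<lambda>v. mpoly_eval p (($) v))"
    using Poly_Mapping.keys_add[of p q] by (intro exI[of _ "p + q"]) (auto simp: mpoly_eval_add)
qed

lemma is_form_sum: "(\<And>a. a \<in> A \<Longrightarrow> is_form d (F a)) \<Longrightarrow> is_form d (\<lambda>v. \<Sum>a\<in>A. F a v)"
  by (induction A rule: infinite_finite_induct) (auto simp: is_form_0 is_form_add)

lemma is_form_form3:
  assumes "distinct3 i j k" shows "is_form d (form3 i j k d c)"
proof -
  have "is_form d (\<lambda>v. c a b * (v $ i ^ a * v $ j ^ b * v $ k ^ (d - a - b)))"
    if "(a, b) \<in> tri d" for a b
    using is_form_monom[OF assms, of a b "d - a - b" "c a b"] that by simp
  hence "is_form d (\<lambda>v. \<Sum>x\<in>tri d. (case x of (a, b) \<Rightarrow>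
      (\<lambda>v. c a b * (v $ i ^ a * v $ j ^ b * v $ k ^ (d - a - b)))) v)"
    by (intro is_form_sum) auto
  moreover have "form3 i j k d c = (\<lambda>v. \<Sum>x\<in>tri d. (case x of (a, b) \<Rightarrow>
      (\<lambda>v. c a b * (v $ i ^ a * v $ j ^ b * v $ k ^ (d - a - b)))) v)"
    by (auto simp: form3_def fun_eq_iff intro!: sum.cong)
  ultimately show ?thesis by simp
qed

text \<open>Homogeneity forces the exponent of the third coordinate, so the coefficients can be
  indexed by the exponents of the other two.\<close>

lemma is_formE:
  assumes "distinct3 i j k" "is_form d F"
  obtains c where "F = form3 i j k d c"
proof -
  obtain p where p: "\<And>m. m \<in> Poly_Mapping.keys p \<Longrightarrow> (\<Sum>i\<in>Poly_Mapping.keys m. Poly_Mapping.lookup m i) = d"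
     "F = (\<lambda>v. mpoly_eval p (\<lambda>i. v $ i))"
    using assms(2) unfolding is_form_def by blast
  let ?K = "Poly_Mapping.keys p"
  define ex where "ex m = (Poly_Mapping.lookup m i, Poly_Mapping.lookup m j)" for m :: "3 \<Rightarrow>\<^sub>0 nat"
  have d: "Poly_Mapping.lookup m i + Poly_Mapping.lookup m j + Poly_Mapping.lookup m k = d"
    if "m \<in> ?K" for m
  proof -
    have "d = (\<Sum>l\<in>UNIV. Poly_Mapping.lookup m l)"
      unfolding p(1)[OF that, symmetric]
      by (rule sum.mono_neutral_left) (auto simp: in_keys_iff)
    thus ?thesis
      using assms(1) unfolding distinct3_UNIV[OF assms(1)] by (auto simp: distinct3_def)
  qed
  have mon: "mon_eval m (\<lambda>i. v $ i) = v $ i ^ Poly_Mapping.lookup m i * v $ j ^ Poly_Mapping.lookup m j *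
     v $ k ^ Poly_Mapping.lookup m k" for m and v :: "'a ^ 3"
  proof -
    have "mon_eval m (\<lambda>i. v $ i) = (\<Prod>l\<in>UNIV. v $ l ^ Poly_Mapping.lookup m l)"
      by (rule mon_eval_superset) auto
    thus ?thesis
      using assms(1) unfolding distinct3_UNIV[OF assms(1)] by (auto simp: distinct3_def mult.assoc)
  qed
  define c where "c a b = (\<Sum>m | m \<in> ?K \<and> ex m = (a, b). Poly_Mapping.lookup p m)" for a b
  have "F v = form3 i j k d c v" for v
  proof -
    have "F v = (\<Sum>m\<in>?K. Poly_Mapping.lookup p m * mon_eval m (\<lambda>i. v $ i))"
      unfolding p(2) by (rule mpoly_eval_superset) auto
    also have "\<dots> = (\<Sum>x\<in>tri d. \<Sum>m | m \<in> ?K \<and> ex m = x. Poly_Mapping.lookup p m * mon_eval m (\<lambda>i. v $ i))"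
    proof (rule sum.group[symmetric])
      show "ex ` ?K \<subseteq> tri d"
      proof
        fix x assume "x \<in> ex ` ?K"
        then obtain m where "m \<in> ?K" "x = ex m" by blast
        thus "x \<in> tri d" using d[of m] by (simp add: ex_def)
      qed
    qed simp_all
    also have "\<dots> = (\<Sum>(a, b)\<in>tri d. c a b * (v $ i ^ a * v $ j ^ b * v $ k ^ (d - a - b)))"
    proof (intro sum.cong refl, clarify)
      fix a b assume "(a, b) \<in> tri d"
      show "(\<Sum>m | m \<in> ?K \<and> ex m = (a, b). Poly_Mapping.lookup p m * mon_eval m (\<lambda>i. v $ i)) =
        c a b * (v $ i ^ a * v $ j ^ b * v $ k ^ (d - a - b))"
        unfolding c_def sum_distrib_right
      proof (intro sum.cong refl)
        fix m assume m: "m \<in> {m. m \<in> ?K \<and> ex m = (a, b)}"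
        hence "Poly_Mapping.lookup m k = d - a - b" using d[of m] by (auto simp: ex_def)
        thus "Poly_Mapping.lookup p m * mon_eval m (\<lambda>i. v $ i) =
            Poly_Mapping.lookup p m * (v $ i ^ a * v $ j ^ b * v $ k ^ (d - a - b))"
          using m by (simp add: mon ex_def)
      qed
    qed
    finally show ?thesis by (simp add: form3_def)
  qed
  thus ?thesis using that by blast
qed

lemma is_form_mult:
  fixes F G :: "'a::field ^ 3 \<Rightarrow> 'a"
  assumes "is_form d F" "is_form e G"
  shows "is_form (d + e) (\<lambda>v. F v * G v)"
proof -
  have "\<exists>p. (\<forall>m\<in>Poly_Mapping.keys p. (\<Sum>i\<in>UNIV. Poly_Mapping.lookup m i) = d) \<and>
     F = (\<lambda>v. mpoly_eval p (\<lambda>i. v $ i))" if "is_form d F" for d and F :: "'a ^ 3 \<Rightarrow> 'a"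
  proof -
    have "(\<Sum>i\<in>Poly_Mapping.keys m. Poly_Mapping.lookup m i) = (\<Sum>i\<in>UNIV. Poly_Mapping.lookup m i)"
      for m :: "3 \<Rightarrow>\<^sub>0 nat"
      by (rule sum.mono_neutral_left) (auto simp: in_keys_iff)
    thus ?thesis using that unfolding is_form_def by simp
  qed
  from this[OF assms(1)] this[OF assms(2)] obtain p q where
    p: "\<forall>m\<in>Poly_Mapping.keys p. (\<Sum>i\<in>UNIV. Poly_Mapping.lookup m i) = d" "F = (\<lambda>v. mpoly_eval p (\<lambda>i. v $ i))"
    and q: "\<forall>m\<in>Poly_Mapping.keys q. (\<Sum>i\<in>UNIV. Poly_Mapping.lookup m i) = e" "G = (\<lambda>v. mpoly_eval q (\<lambda>i. v $ i))"
    by blast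
  have s: "(\<Sum>i\<in>Poly_Mapping.keys m. Poly_Mapping.lookup m i) = (\<Sum>i\<in>UNIV. Poly_Mapping.lookup m i)"
    for m :: "3 \<Rightarrow>\<^sub>0 nat"
    by (rule sum.mono_neutral_left) (auto simp: in_keys_iff)
  show ?thesis unfolding is_form_def s
  proof (intro exI[of _ "p * q"] conjI ballI)
    fix m assume "m \<in> Poly_Mapping.keys (p * q)"
    then obtain a b where "a \<in> Poly_Mapping.keys p" "b \<in> Poly_Mapping.keys q" "m = a + b"
      using Poly_Mapping.keys_mult[of p q] by blast
    thus "(\<Sum>i\<in>UNIV. Poly_Mapping.lookup m i) = d + e"
      using p q by (simp add: lookup_add sum.distrib)
  qed (simp add: p q mpoly_eval_mult)
qed

lemma is_form_power: "is_form d F \<Longrightarrow> is_form (n * d) (\<lambda>v. F v ^ n)"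
proof (induction n)
  case 0
  show ?case using is_form_monom[of 1 2 3 0 0 0 1] by (simp add: distinct3_def)
next
  case (Suc n)
  thus ?case using is_form_mult[of d F "n * d" "\<lambda>v. F v ^ n"] by simp
qed

lemma ex_distinct3: "\<exists>j k. distinct3 i j k"
proof -
  have "distinct3 1 2 3" "distinct3 2 1 3" "distinct3 3 1 2" by (simp_all add: distinct3_def)
  thus ?thesis using exhaust_3[of i] by blast
qed

lemma is_form_coord: "is_form 1 (\<lambda>v. v $ i)"
proof -
  obtain j k where "distinct3 i j k" using ex_distinct3 by blast
  from is_form_monom[OF this, of 1 0 0 1] show ?thesis by simp
qed

lemma is_form_cmult: "is_form d F \<Longrightarrow> is_form d (\<lambda>v. c * F v)"
  using is_form_mult[of 0 "\<lambda>v. c" d F] is_form_monom[of 1 2 3 0 0 0 c]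
  by (simp add: distinct3_def)

lemma is_form_diff: "is_form d F \<Longrightarrow> is_form d G \<Longrightarrow> is_form d (\<lambda>v. F v - G v)"
  using is_form_add[of d F "\<lambda>v. -1 * G v"] is_form_cmult[of d G "-1"] by simp

lemma form_scale: "is_form d F \<Longrightarrow> F (c *s v) = c ^ d * F v"
proof -
  assume "is_form d F"
  moreover have D: "distinct3 1 2 3" by (simp add: distinct3_def)
  ultimately obtain f where F: "F = form3 1 2 3 d f" using is_formE by blast
  show ?thesis
    unfolding F form3_def sum_distrib_left
  proof (intro sum.cong refl, clarify)
    fix a b assume "(a, b) \<in> tri d"
    hence "c ^ d = c ^ a * c ^ b * c ^ (d - a - b)"
      by (simp flip: power_add)
    thus "f a b * ((c *s v) $ 1 ^ a * (c *s v) $ 2 ^ b * (c *s v) $ 3 ^ (d - a - b)) =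
       c ^ d * (f a b * (v $ 1 ^ a * v $ 2 ^ b * v $ 3 ^ (d - a - b)))"
      by (simp add: power_mult_distrib)
  qed
qed

section \<open>Points of the plane, closed sets and their vanishing forms\<close>

definition cls :: "'a::field ^ 3 \<Rightarrow> ('a ^ 3) set" where
  "cls v = proportional `` {v}"

lemma in_cls: "w \<in> cls v \<longleftrightarrow> v \<noteq> 0 \<and> (\<exists>c. c \<noteq> 0 \<and> w = c *s v)"
  by (auto simp: cls_def proportional_def)

lemma self_in_cls: "v \<noteq> 0 \<Longrightarrow> v \<in> cls v"
  unfolding in_cls by (intro conjI exI[of _ 1]) auto

lemma cls_eq_iff: "v \<noteq> 0 \<Longrightarrow> w \<noteq> 0 \<Longrightarrow> cls v = cls w \<longleftrightarrow> (\<exists>c. c \<noteq> 0 \<and> w = c *s v)"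
proof
  assume "v \<noteq> 0" "w \<noteq> 0" "cls v = cls w"
  hence "w \<in> cls v" using self_in_cls[of w] by simp
  thus "\<exists>c. c \<noteq> 0 \<and> w = c *s v" by (simp add: in_cls)
next
  assume *: "v \<noteq> 0" "w \<noteq> 0" "\<exists>c. c \<noteq> 0 \<and> w = c *s v"
  then obtain c where c: "c \<noteq> 0" "w = c *s v" by blast
  have v: "v = inverse c *s w" unfolding c(2) using c(1) by (simp add: vector_smult_assoc)
  have sub: "cls x \<subseteq> cls y" if "x \<noteq> 0" "y \<noteq> 0" "d \<noteq> 0" "x = d *s y" for x y :: "'a ^ 3" and d
  proof
    fix u assume "u \<in> cls x"
    then obtain b where "b \<noteq> 0" "u = b *s x" by (auto simp: in_cls)
    hence "b * d \<noteq> 0 \<and> u = (b * d) *s y" using that by (simp add: vector_smult_assoc)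
    thus "u \<in> cls y" using that unfolding in_cls by blast
  qed
  have "inverse c \<noteq> 0" using c by simp
  from sub[OF *(1,2) this v] sub[OF *(2,1) c] show "cls v = cls w" by (rule subset_antisym)
qed

lemma proj_plane_eq: "proj_plane = cls ` (UNIV - {0})"
  by (auto simp: proj_plane_def quotient_def cls_def)

lemma planeE:
  assumes "P \<in> proj_plane"
  obtains v where "v \<noteq> 0" "P = cls v"
  using assms by (auto simp: proj_plane_eq)

lemma cls_in_plane: "v \<noteq> 0 \<Longrightarrow> cls v \<in> proj_plane"
  by (auto simp: proj_plane_eq)

lemma form_zero_cls: "is_form d F \<Longrightarrow> c \<noteq> 0 \<Longrightarrow> F (c *s v) = 0 \<longleftrightarrow> F v = 0"
  by (simp add: form_scale)

definition vanish :: "('a::field ^ 3 \<Rightarrow> 'a) \<Rightarrow> ('a ^ 3) set set \<Rightarrow> bool" where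
  "vanish F V \<longleftrightarrow> (\<forall>v. v \<noteq> 0 \<longrightarrow> cls v \<in> V \<longrightarrow> F v = 0)"

definition zset :: "('a::field ^ 3 \<Rightarrow> 'a) \<Rightarrow> ('a ^ 3) set set" where
  "zset F = {cls v | v. v \<noteq> 0 \<and> F v = 0}"

lemma cls_in_zset: "is_form d F \<Longrightarrow> v \<noteq> 0 \<Longrightarrow> cls v \<in> zset F \<longleftrightarrow> F v = 0"
proof -
  assume F: "is_form d F" and v: "v \<noteq> 0"
  have "F v = 0" if "cls v = cls w" "w \<noteq> 0" "F w = 0" for w
    using that cls_eq_iff[OF v that(2)] v form_zero_cls[OF F] by auto
  thus ?thesis using v unfolding zset_def by blast
qed

lemma zset_plane: "zset F \<subseteq> proj_plane"
  by (auto simp: zset_def cls_in_plane)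

lemma vanish_iff: "is_form d F \<Longrightarrow> V \<subseteq> proj_plane \<Longrightarrow> vanish F V \<longleftrightarrow> V \<subseteq> zset F"
  unfolding vanish_def proj_plane_eq using cls_in_zset[of d F] by blast

lemma homogeneous_form:
  "mpoly_homogeneous p \<Longrightarrow> \<exists>d. is_form d (\<lambda>v. mpoly_eval p (\<lambda>i. v $ i))"
  unfolding mpoly_homogeneous_def is_form_def by blast

lemma form_homogeneous:
  "is_form d F \<Longrightarrow> \<exists>p. mpoly_homogeneous p \<and> F = (\<lambda>v. mpoly_eval p (\<lambda>i. v $ i))"
  unfolding mpoly_homogeneous_def is_form_def by blast

lemma cls_in_proj_zeros:
  assumes "\<forall>p\<in>S. mpoly_homogeneous p" "v \<noteq> 0"
  shows "cls v \<in> proj_zeros S \<longleftrightarrow> (\<forall>p\<in>S. mpoly_eval p (\<lambda>i. v $ i) = 0)"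
proof -
  have "(\<forall>x\<in>cls v. mpoly_eval p (\<lambda>i. x $ i) = 0) \<longleftrightarrow> mpoly_eval p (\<lambda>i. v $ i) = 0" if p: "p \<in> S" for p
  proof -
    obtain d where "is_form d (\<lambda>v. mpoly_eval p (\<lambda>i. v $ i))"
      using assms p homogeneous_form by blast
    from form_zero_cls[OF this] have "mpoly_eval p (($) w) = 0 \<longleftrightarrow> mpoly_eval p (($) v) = 0"
      if "w \<in> cls v" for w using that unfolding in_cls by blast
    thus ?thesis using self_in_cls[OF assms(2)] by blast
  qed
  thus ?thesis unfolding proj_zeros_def using assms(2) by (auto simp: cls_in_plane)
qed

text \<open>All forms vanishing on \<open>V\<close> together can serve as the defining set.
  Closedness thus becomes separation of each outside point by one form, and no defining set has to
  be carried along.\<close>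

lemma closed_iff:
  "zariski_closed V \<longleftrightarrow> V \<subseteq> proj_plane \<and>
     (\<forall>v. v \<noteq> 0 \<longrightarrow> cls v \<notin> V \<longrightarrow> (\<exists>d F. is_form d F \<and> vanish F V \<and> F v \<noteq> 0))"
proof
  assume "zariski_closed V"
  then obtain S where S: "\<forall>p\<in>S. mpoly_homogeneous p" "V = proj_zeros S"
    unfolding zariski_closed_def by blast
  show "V \<subseteq> proj_plane \<and>
     (\<forall>v. v \<noteq> 0 \<longrightarrow> cls v \<notin> V \<longrightarrow> (\<exists>d F. is_form d F \<and> vanish F V \<and> F v \<noteq> 0))"
  proof (intro conjI allI impI)
    show "V \<subseteq> proj_plane" unfolding S by (auto simp: proj_zeros_def)
    fix v :: "'a ^ 3" assume v: "v \<noteq> 0" "cls v \<notin> V"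
    then obtain p where p: "p \<in> S" "mpoly_eval p (\<lambda>i. v $ i) \<noteq> 0"
      unfolding S(2) using cls_in_proj_zeros[OF S(1)] by blast
    moreover have "vanish (\<lambda>v. mpoly_eval p (\<lambda>i. v $ i)) V"
      unfolding vanish_def S(2) using cls_in_proj_zeros[OF S(1)] p by blast
    ultimately show "\<exists>d F. is_form d F \<and> vanish F V \<and> F v \<noteq> 0"
      using homogeneous_form[of p] S(1) by blast
  qed
next
  assume *: "V \<subseteq> proj_plane \<and>
     (\<forall>v. v \<noteq> 0 \<longrightarrow> cls v \<notin> V \<longrightarrow> (\<exists>d F. is_form d F \<and> vanish F V \<and> F v \<noteq> 0))"
  define S where "S = {p. mpoly_homogeneous p \<and> vanish (\<lambda>v. mpoly_eval p (\<lambda>i. v $ i)) V}"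
  have S: "\<forall>p\<in>S. mpoly_homogeneous p" by (simp add: S_def)
  have "cls v \<in> V \<longleftrightarrow> cls v \<in> proj_zeros S" if "v \<noteq> 0" for v
    unfolding cls_in_proj_zeros[OF S that]
  proof
    assume z: "\<forall>p\<in>S. mpoly_eval p (($) v) = 0"
    show "cls v \<in> V"
    proof (rule ccontr)
      assume "cls v \<notin> V"
      with *[THEN conjunct2, rule_format, OF that] obtain d F
        where F: "is_form d F" "vanish F V" "F v \<noteq> 0" by blast
      obtain p where p: "mpoly_homogeneous p" "F = (\<lambda>v. mpoly_eval p (\<lambda>i. v $ i))"
        using form_homogeneous[OF F(1)] by blast
      have "p \<in> S" using p F(2) by (simp add: S_def)
      thus False using z p(2) F(3) by auto
    qed
  qed (use that in \<open>auto simp: S_def vanish_def\<close>)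
  moreover have "proj_zeros S \<subseteq> proj_plane" by (auto simp: proj_zeros_def)
  moreover have "V \<subseteq> proj_plane" using * by blast
  ultimately have "V = proj_zeros S" unfolding proj_plane_eq by (intro set_eqI) blast
  thus "zariski_closed V" using S unfolding zariski_closed_def by blast
qed

lemma closed_plane: "zariski_closed V \<Longrightarrow> V \<subseteq> proj_plane"
  by (simp add: closed_iff)

lemma vanish_subset: "vanish F V \<Longrightarrow> W \<subseteq> V \<Longrightarrow> vanish F W"
  by (auto simp: vanish_def)

lemma closed_Int_zset:
  assumes "zariski_closed V" "is_form d F"
  shows "zariski_closed (V \<inter> zset F)"
  unfolding closed_iff
proof (intro conjI allI impI)
  show "V \<inter> zset F \<subseteq> proj_plane" using zset_plane by auto
  fix v :: "'a ^ 3" assume v: "v \<noteq> 0" "cls v \<notin> V \<inter> zset F"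
  show "\<exists>d G. is_form d G \<and> vanish G (V \<inter> zset F) \<and> G v \<noteq> 0"
  proof (cases "cls v \<in> V")
    case True
    hence "F v \<noteq> 0" using v cls_in_zset[OF assms(2)] by auto
    moreover have "vanish F (V \<inter> zset F)"
      using cls_in_zset[OF assms(2)] by (auto simp: vanish_def)
    ultimately show ?thesis using assms(2) by blast
  next
    case False
    thus ?thesis using v assms(1) vanish_subset[of _ V "V \<inter> zset F"] unfolding closed_iff by blast
  qed
qed

text \<open>Irreducibility is primality of the homogeneous vanishing ideal. If F G vanishes on
  \<open>V\<close>, then \<open>V\<close> is covered by its intersections with the two zero sets;
  conversely, forms separating the two halves of a proper covering have a product that vanishes on
  \<open>V\<close>.\<close>

lemma irreducible_closed_iff:
  "zariski_irreducible_closed V \<longleftrightarrow> zariski_closed V \<and> V \<noteq> {} \<and>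
     (\<forall>d e F G. is_form d F \<longrightarrow> is_form e G \<longrightarrow> vanish (\<lambda>v. F v * G v) V \<longrightarrow> vanish F V \<or> vanish G V)"
    (is "_ \<longleftrightarrow> _ \<and> _ \<and> ?prime")
proof -
  have "(\<forall>A B. zariski_closed A \<and> zariski_closed B \<and> V = A \<union> B \<longrightarrow> V = A \<or> V = B) \<longleftrightarrow> ?prime"
    if V: "zariski_closed V"
  proof
    assume irr: "\<forall>A B. zariski_closed A \<and> zariski_closed B \<and> V = A \<union> B \<longrightarrow> V = A \<or> V = B"
    have VP: "V \<subseteq> proj_plane" using V closed_iff by blast
    show ?prime
    proof (intro allI impI)
      fix d e and F G :: "'a ^ 3 \<Rightarrow> 'a"
      assume F: "is_form d F" and G: "is_form e G" and FG: "vanish (\<lambda>v. F v * G v) V"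
      have "P \<in> zset F \<union> zset G" if P: "P \<in> V" for P
      proof -
        obtain v where "v \<noteq> 0" "P = cls v" using subsetD[OF VP P] by (rule planeE)
        thus ?thesis using FG P cls_in_zset[OF F] cls_in_zset[OF G] unfolding vanish_def by auto
      qed
      hence "V = (V \<inter> zset F) \<union> (V \<inter> zset G)" by blast
      hence "V = V \<inter> zset F \<or> V = V \<inter> zset G"
        using irr closed_Int_zset[OF V F] closed_Int_zset[OF V G] by blast
      thus "vanish F V \<or> vanish G V" using vanish_iff[OF F VP] vanish_iff[OF G VP] by blast
    qed
  next
    assume prime: ?prime
    show "\<forall>A B. zariski_closed A \<and> zariski_closed B \<and> V = A \<union> B \<longrightarrow> V = A \<or> V = B"
    proof (intro allI impI, elim conjE, rule ccontr)
      fix A B assume A: "zariski_closed A" "zariski_closed B" and AB: "V = A \<union> B" and n: "\<not> (V = A \<or> V = B)"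
      have ex: "\<exists>d F. is_form d F \<and> vanish F A \<and> \<not> vanish F V" if A: "zariski_closed A" "A \<subset> V" for A
      proof -
        obtain P where P: "P \<in> V" "P \<notin> A" using A by blast
        obtain v where v: "v \<noteq> 0" "P = cls v"
          using subsetD[OF closed_plane[OF V] P(1)] by (rule planeE)
        with A(1)[unfolded closed_iff, THEN conjunct2, rule_format, OF v(1)] P
        obtain d F where "is_form d F" "vanish F A" "F v \<noteq> 0" by blast
        thus ?thesis using v P unfolding vanish_def by blast
      qed
      obtain d F where F: "is_form d F" "vanish F A" "\<not> vanish F V" using ex[of A] A AB n by blast
      obtain e G where G: "is_form e G" "vanish G B" "\<not> vanish G V" using ex[of B] A AB n by blast
      have "vanish (\<lambda>v. F v * G v) V" using F G unfolding vanish_def AB by auto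
      thus False using prime F G by blast
    qed
  qed
  from this show ?thesis unfolding zariski_irreducible_closed_def
    by (intro conj_cong[OF refl])
qed

lemma plane_iff: "V \<subseteq> proj_plane \<Longrightarrow> V \<noteq> proj_plane \<longleftrightarrow> (\<exists>v. v \<noteq> 0 \<and> cls v \<notin> V)"
  unfolding proj_plane_eq by blast

lemma Var_iff:
  "V \<in> Var \<longleftrightarrow> zariski_closed V \<and> V \<noteq> {} \<and> (\<exists>v. v \<noteq> 0 \<and> cls v \<notin> V) \<and>
     (\<forall>d e F G. is_form d F \<longrightarrow> is_form e G \<longrightarrow> vanish (\<lambda>v. F v * G v) V \<longrightarrow> vanish F V \<or> vanish G V)"
  unfolding Var_def using plane_iff[of V] closed_iff[of V] by (auto simp: irreducible_closed_iff)

lemma form_line: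
  assumes "is_form d F"
  obtains A where "\<And>t. F (u + t *s w) = poly A t" "degree A \<le> d"
proof -
  have D: "distinct3 1 2 3" by (simp add: distinct3_def)
  obtain c where F: "F = form3 1 2 3 d c" using is_formE[OF D assms] .
  define l where "l i = [:u $ i, w $ i:]" for i
  have dl: "degree (l i ^ n) \<le> n" for i n
    using degree_power_le[of "l i" n] degree_pCons_le[of "u $ i" "[:w $ i:]"]
    by (simp add: l_def split: if_splits)
  define A where "A = (\<Sum>(a, b)\<in>tri d. smult (c a b) (l 1 ^ a * l 2 ^ b * l 3 ^ (d - a - b)))"
  show ?thesis
  proof
    fix t
    show "F (u + t *s w) = poly A t"
      unfolding F form3_def A_def poly_sum
      by (intro sum.cong refl) (auto simp: l_def algebra_simps split: prod.splits)
  next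
    show "degree A \<le> d" unfolding A_def
    proof (intro degree_sum_le, simp, clarify)
      fix a b assume ab: "(a, b) \<in> tri d"
      have "degree (l 1 ^ a * l 2 ^ b * l 3 ^ (d - a - b)) \<le> a + b + (d - a - b)"
        by (intro order.trans[OF degree_mult_le] add_mono dl)
      thus "degree (smult (c a b) (l 1 ^ a * l 2 ^ b * l 3 ^ (d - a - b))) \<le> d"
        using ab by (simp add: degree_smult_le[THEN order.trans])
    qed
  qed
qed

text \<open>The exceptional value \<open>c\<close> accommodates identities whose derivation divides
  by the parameter.\<close>

lemma poly_eq_inf:
  fixes p q :: "'a::{idom, ring_char_0} poly"
  assumes "\<And>t. t \<noteq> c \<Longrightarrow> poly p t = poly q t"
  shows "p = q"
proof (rule ccontr)
  assume "p \<noteq> q"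
  hence "finite {t. poly (p - q) t = 0}" by (intro poly_roots_finite) simp
  moreover have "UNIV - {c} \<subseteq> {t. poly (p - q) t = 0}" using assms by auto
  ultimately have "finite (UNIV - {c})" by (rule rev_finite_subset)
  thus False using infinite_UNIV_char_0[where ?'a='a] by simp
qed

lemma monom_cancel: "A * monom (1::'a::idom) n = B * monom 1 n \<Longrightarrow> A = B"
  by (subst (asm) mult_right_cancel) auto

section \<open>Irreducible closed sets are points and curves\<close>

text \<open>Elements of \<open>'a poly poly\<close> are bivariate: the outer variable is \<open>y\<close>.\<close>

definition ev2 :: "'a::comm_ring_1 poly poly \<Rightarrow> 'a \<Rightarrow> 'a \<Rightarrow> 'a" where
  "ev2 P x y = poly (poly P [:y:]) x"

lemma ev2_simps [simp]:
  "ev2 0 x y = 0" "ev2 (P + Q) x y = ev2 P x y + ev2 Q x y" "ev2 (P * Q) x y = ev2 P x y * ev2 Q x y"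
  "ev2 (pCons a P) x y = poly a x + y * ev2 P x y" "ev2 (smult s P) x y = poly s x * ev2 P x y"
  by (simp_all add: ev2_def)

lemma ev2_monom [simp]: "ev2 (monom (monom c a) b) x y = c * x ^ a * y ^ b"
  by (simp add: ev2_def poly_monom poly_power)

lemma ev2_sum: "ev2 (\<Sum>a\<in>A. f a) x y = (\<Sum>a\<in>A. ev2 (f a) x y)"
  by (simp add: ev2_def poly_sum)

abbreviation X_minus :: "'a::comm_ring_1 \<Rightarrow> 'a poly poly" where
  "X_minus c \<equiv> [:[:- c, 1:]:]"

lemma ev2_as_poly_y:
  fixes P :: "'a::comm_ring_1 poly poly"
  obtains r where "\<And>y. ev2 P c y = poly r y"
proof -
  have "\<exists>r. \<forall>y. ev2 P c y = poly r y"
  proof (induction P)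
    case 0
    show ?case by (rule exI[of _ 0]) simp
  next
    case (pCons a P)
    then obtain r where "\<forall>y. ev2 P c y = poly r y" by blast
    thus ?case by (intro exI[of _ "pCons (poly a c) r"]) simp
  qed
  thus ?thesis using that by blast
qed

lemma poly_y_as_ev2:
  fixes r :: "'a::comm_ring_1 poly"
  shows "\<exists>R. \<forall>x y. ev2 R x y = poly r y"
proof (induction r)
  case 0
  show ?case by (rule exI[of _ 0]) simp
next
  case (pCons a r)
  then obtain R where "\<forall>x y. ev2 R x y = poly r y" by blast
  thus ?case by (intro exI[of _ "pCons [:a:] R"]) simp
qed

text \<open>On the vertical line over \<open>c\<close> the polynomial becomes a polynomial in y that
  is zero everywhere, so each of its coefficients, a polynomial in x, has the root
  \<open>c\<close>.\<close>

lemma X_minus_dvd: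
  fixes P :: "'a::{idom, ring_char_0} poly poly"
  assumes "\<And>y. ev2 P c y = 0"
  shows "X_minus c dvd P"
  using assms
proof (induction P)
  case (pCons a P)
  obtain r where r: "\<And>y. ev2 P c y = poly r y" using ev2_as_poly_y[of P c] by blast
  have a: "poly a c = 0" using pCons(3)[of 0] by simp
  have "r = 0"
    by (rule poly_eq_inf[of 0]) (use pCons(3) a r in auto)
  hence "X_minus c dvd P" using pCons(2) r by simp
  then obtain Q where Q: "P = X_minus c * Q" by (elim dvdE)
  obtain b where b: "a = [:-c, 1:] * b" using a by (auto simp: poly_eq_0_iff_dvd elim: dvdE)
  have "pCons a P = X_minus c * pCons b Q" unfolding Q b by simp
  thus ?case by (rule dvdI)
qed simp

lemma ev2_nonzero_both:
  fixes P Q :: "'a::{idom, ring_char_0} poly poly"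
  assumes "\<And>y. ev2 P c y * ev2 Q c y = 0"
  shows "(\<forall>y. ev2 P c y = 0) \<or> (\<forall>y. ev2 Q c y = 0)"
proof -
  obtain r where r: "\<And>y. ev2 P c y = poly r y" using ev2_as_poly_y[of P c] by blast
  obtain s where s: "\<And>y. ev2 Q c y = poly s y" using ev2_as_poly_y[of Q c] by blast
  have "r * s = 0" by (rule poly_eq_inf[of 0]) (use assms r s in auto)
  thus ?thesis using r s by auto
qed

text \<open>Gauss's lemma. The factor \<open>s\<close> is removed one root \<open>c\<close> at a
  time: on the vertical line over \<open>c\<close> the product \<open>P * q\<close> vanishes while
  \<open>P\<close> does not, so the cofactor \<open>q\<close> vanishes there and is divisible by x -
  c.\<close>

lemma gauss_primitive:
  fixes P :: "'a::{alg_closed_field, field_char_0} poly poly"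
  assumes prim: "\<And>c. \<exists>y. ev2 P c y \<noteq> 0" and "s \<noteq> 0" "P dvd smult s Q"
  shows "P dvd Q"
  using assms(2,3)
proof (induction "degree s" arbitrary: s)
  case 0
  then obtain c where c: "s = [:c:]" "c \<noteq> 0" by (metis degree_eq_zeroE pCons_0_0)
  have "P dvd smult [:inverse c:] (smult s Q)" using 0(3) by (rule dvd_smult)
  thus ?case using c by (simp add: one_pCons[symmetric])
next
  case (Suc n)
  then obtain c where "poly s c = 0" using alg_closed_imp_poly_has_root[of s] by auto
  then obtain s' where s': "s = [:-c, 1:] * s'" by (auto simp: poly_eq_0_iff_dvd elim: dvdE)
  have s0: "s' \<noteq> 0" using Suc s' by auto
  have deg: "n = degree s'" using Suc(2) s0 unfolding s' by (subst (asm) degree_mult_eq) auto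
  obtain q where q: "smult s Q = P * q" using Suc(4) by (elim dvdE)
  have "ev2 P c y * ev2 q c y = 0" for y
    using arg_cong[OF q, of "\<lambda>R. ev2 R c y"] \<open>poly s c = 0\<close> by simp
  hence "\<forall>y. ev2 q c y = 0" using ev2_nonzero_both[of P c q] prim[of c] by blast
  hence "X_minus c dvd q" using X_minus_dvd by blast
  then obtain q' where q': "q = X_minus c * q'" by (elim dvdE)
  have "X_minus c * smult s' Q = X_minus c * (P * q')"
    using q unfolding s' q' by (simp add: algebra_simps)
  hence "smult s' Q = P * q'" by (subst (asm) mult_cancel_left) simp
  hence "P dvd smult s' Q" by (rule dvdI)
  thus ?case using Suc(1)[OF deg s0] by blast
qed

lemma pseudo_division:
  fixes f g :: "'a::idom poly"
  assumes "g \<noteq> 0"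
  obtains s q r where "s \<noteq> 0" "smult s f = g * q + r" "r = 0 \<or> degree r < degree g"
proof -
  obtain q r where qr: "pseudo_divmod f g = (q, r)" by (cases "pseudo_divmod f g")
  from pseudo_divmod[OF assms qr] show ?thesis
    using assms by (intro that[of "coeff g (degree g) ^ (Suc (degree f) - degree g)" q r]) auto
qed

section \<open>Passing between forms and bivariate polynomials\<close>

definition tdeg_le :: "'a::zero poly poly \<Rightarrow> nat \<Rightarrow> bool" where
  "tdeg_le P d \<longleftrightarrow> (\<forall>a b. coeff (coeff P b) a \<noteq> 0 \<longrightarrow> a + b \<le> d)"

definition cf2 :: "'a::zero poly poly \<Rightarrow> nat \<Rightarrow> nat \<Rightarrow> 'a" where
  "cf2 P a b = coeff (coeff P b) a"

lemma coeff2_finite: "finite {(a, b). coeff (coeff P b) a \<noteq> 0}"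
proof (rule finite_subset)
  show "{(a, b). coeff (coeff P b) a \<noteq> 0} \<subseteq>
     (\<Union>b\<in>{..degree P}. (\<lambda>a. (a, b)) ` {..degree (coeff P b)})"
  proof clarify
    fix a b assume ne: "coeff (coeff P b) a \<noteq> 0"
    hence "a \<le> degree (coeff P b)" by (rule le_degree)
    moreover have "b \<le> degree P" using ne by (intro le_degree) auto
    ultimately show "(a, b) \<in> (\<Union>b\<in>{..degree P}. (\<lambda>a. (a, b)) ` {..degree (coeff P b)})" by auto
  qed
qed auto

text \<open>The exhibited monomial of top degree ensures that homogenising in exactly this degree
  introduces no factor of the third coordinate; see \<open>hom_top\<close>.\<close>

lemma ex_tdeg:
  assumes "P \<noteq> 0"
  obtains d a b where "tdeg_le P d" "a + b = d" "coeff (coeff P b) a \<noteq> 0"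
proof -
  let ?S = "(\<lambda>(a, b). a + b) ` {(a, b). coeff (coeff P b) a \<noteq> 0}"
  have fin: "finite ?S" by (intro finite_imageI coeff2_finite)
  have "coeff (lead_coeff P) (degree (lead_coeff P)) \<noteq> 0" using assms by simp
  hence "?S \<noteq> {}" by blast
  hence "Max ?S \<in> ?S" using fin by (intro Max_in)
  moreover have "tdeg_le P (Max ?S)" unfolding tdeg_le_def
    by (intro allI impI Max_ge fin) force
  ultimately show ?thesis using that by auto
qed

lemma ex_tdeg_le: obtains d where "tdeg_le P d"
proof (cases "P = 0")
  case True
  thus ?thesis using that[of 0] by (simp add: tdeg_le_def)
next
  case False
  thus ?thesis using ex_tdeg[of P] that by metis
qed

lemma ev2_tdeg:
  fixes P :: "'a::comm_ring_1 poly poly"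
  assumes "tdeg_le P d"
  shows "ev2 P x y = (\<Sum>(a, b)\<in>tri d. cf2 P a b * x ^ a * y ^ b)"
proof -
  have "P = (\<Sum>(a, b)\<in>tri d. monom (monom (cf2 P a b) a) b)"
  proof (intro poly_eqI)
    fix b a
    have "coeff (coeff (\<Sum>(a, b)\<in>tri d. monom (monom (cf2 P a b) a) b) b) a =
      (\<Sum>z\<in>tri d. if z = (a, b) then cf2 P a b else 0)"
      unfolding coeff_sum by (intro sum.cong refl) (auto split: prod.splits)
    also have "\<dots> = coeff (coeff P b) a"
      using assms by (auto simp: sum.delta tdeg_le_def cf2_def)
    finally show "coeff (coeff P b) a =
      coeff (coeff (\<Sum>(a, b)\<in>tri d. monom (monom (cf2 P a b) a) b) b) a" ..
  qed
  hence "ev2 P x y = ev2 (\<Sum>(a, b)\<in>tri d. monom (monom (cf2 P a b) a) b) x y" by simp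
  thus ?thesis by (simp add: ev2_sum case_prod_unfold)
qed

definition vec3 :: "3 \<Rightarrow> 3 \<Rightarrow> 3 \<Rightarrow> 'a \<Rightarrow> 'a \<Rightarrow> 'a \<Rightarrow> 'a ^ 3" where
  "vec3 i j k a b c = (\<chi> l. if l = i then a else if l = j then b else c)"

lemma vec3_nth:
  assumes "distinct3 i j k"
  shows "vec3 i j k a b c $ i = a" "vec3 i j k a b c $ j = b" "vec3 i j k a b c $ k = c"
  using assms by (auto simp: vec3_def distinct3_def)

lemma vec3_eq_iff:
  assumes "distinct3 i j k"
  shows "v = w \<longleftrightarrow> v $ i = w $ i \<and> v $ j = w $ j \<and> v $ k = w $ k"
proof -
  have "v = w \<longleftrightarrow> (\<forall>l\<in>UNIV. v $ l = w $ l)" by (simp add: vec_eq_iff)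
  thus ?thesis unfolding distinct3_UNIV[OF assms] by simp
qed

lemma vec3_eq_0_iff: "distinct3 i j k \<Longrightarrow> vec3 i j k a b c = 0 \<longleftrightarrow> a = 0 \<and> b = 0 \<and> c = 0"
  by (simp add: vec3_eq_iff[of i j k] vec3_nth)

lemma hom_affine:
  assumes "distinct3 i j k" "tdeg_le P d"
  shows "form3 i j k d (cf2 P) (vec3 i j k x y 1) = ev2 P x y"
  unfolding ev2_tdeg[OF assms(2)] form3_def
  by (intro sum.cong refl) (auto simp: vec3_nth[OF assms(1)])

lemma affine_rep:
  fixes v :: "'a::field ^ 3"
  assumes "distinct3 i j k" "v $ k \<noteq> 0"
  shows "v = v $ k *s vec3 i j k (v $ i / v $ k) (v $ j / v $ k) 1"
  using assms by (simp add: vec3_eq_iff[OF assms(1)] vec3_nth)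

lemma hom_eval:
  assumes "distinct3 i j k" "tdeg_le P d" "v $ k \<noteq> 0"
  shows "form3 i j k d (cf2 P) v = (v $ k) ^ d * ev2 P (v $ i / v $ k) (v $ j / v $ k)"
  by (subst affine_rep[OF assms(1,3)], subst form_scale[OF is_form_form3[OF assms(1)]])
    (simp add: hom_affine[OF assms(1,2)])

lemma form_dehom:
  assumes "distinct3 i j k" "is_form d F"
  obtains P where "tdeg_le P d" "F = form3 i j k d (cf2 P)"
proof -
  obtain c where F: "F = form3 i j k d c" using is_formE[OF assms] .
  define P where "P = (\<Sum>(a, b)\<in>tri d. monom (monom (c a b) a) b)"
  have cf: "cf2 P a b = (if a + b \<le> d then c a b else 0)" for a b
  proof -
    have "cf2 P a b = (\<Sum>z\<in>tri d. if z = (a, b) then c a b else 0)"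
      unfolding cf2_def P_def coeff_sum by (intro sum.cong refl) (auto split: prod.splits)
    thus ?thesis by (simp add: sum.delta)
  qed
  have "tdeg_le P d" using cf unfolding tdeg_le_def cf2_def by (metis (full_types))
  moreover have "F = form3 i j k d (cf2 P)"
    unfolding F form3_def by (intro ext sum.cong refl) (auto simp: cf)
  ultimately show ?thesis using that by blast
qed

text \<open>Where the third coordinate is 0, only the monomials of degree exactly \<open>d\<close>
  survive, and one of them is present. So the homogenisation does not vanish on the whole line at
  infinity of the chart.\<close>

lemma hom_top:
  assumes D: "distinct3 i j k" and "coeff (coeff P b) a \<noteq> (0::'a::field)" "a + b = d"
  obtains r where "r \<noteq> 0" "\<And>x. form3 i j k d (cf2 P) (vec3 i j k x 1 0) = poly r x"
proof -
  define r where "r = (\<Sum>a\<le>d. monom (cf2 P a (d - a)) a)"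
  have "coeff r a = cf2 P a (d - a)"
    unfolding r_def coeff_sum using assms(3) by (simp add: sum.delta)
  also have "\<dots> \<noteq> 0" using assms by (auto simp: cf2_def)
  finally have "r \<noteq> 0" by auto
  moreover have "form3 i j k d (cf2 P) (vec3 i j k x 1 0) = poly r x" for x
  proof -
    have "form3 i j k d (cf2 P) (vec3 i j k x 1 0) =
       (\<Sum>z\<in>tri d. if z \<in> (\<lambda>a. (a, d - a)) ` {..d} then cf2 P (fst z) (snd z) * x ^ fst z else 0)"
      unfolding form3_def
    proof (intro sum.cong refl, clarify)
      fix a b assume "(a, b) \<in> tri d"
      hence *: "(a, b) \<in> (\<lambda>a. (a, d - a)) ` {..d} \<longleftrightarrow> d - a - b = 0" by auto
      show "cf2 P a b * (vec3 i j k x 1 0 $ i ^ a * vec3 i j k x 1 0 $ j ^ b * vec3 i j k x 1 0 $ k ^ (d - a - b)) =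
         (if (a, b) \<in> (\<lambda>a. (a, d - a)) ` {..d} then cf2 P (fst (a, b)) (snd (a, b)) * x ^ fst (a, b) else 0)"
        unfolding * vec3_nth[OF D] by (auto simp: power_0_left)
    qed
    also have "\<dots> = (\<Sum>z\<in>(\<lambda>a. (a, d - a)) ` {..d}. cf2 P (fst z) (snd z) * x ^ fst z)"
    proof -
      have "tri d \<inter> {z. z \<in> (\<lambda>a. (a, d - a)) ` {..d}} = (\<lambda>a. (a, d - a)) ` {..d}" by auto
      thus ?thesis by (simp add: sum.If_cases)
    qed
    also have "\<dots> = (\<Sum>a\<le>d. cf2 P a (d - a) * x ^ a)"
      by (subst sum.reindex) (auto simp: inj_on_def)
    also have "\<dots> = poly r x" by (simp add: r_def poly_sum poly_monom)
    finally show ?thesis .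
  qed
  ultimately show ?thesis using that by blast
qed

text \<open>Coordinate \<open>k\<close> is chosen not to vanish identically on \<open>V\<close>. By
  primality a form vanishing on the affine part of \<open>V\<close> then vanishes on all of
  \<open>V\<close>, so the ideal \<open>I\<close> of the affine part carries the full
  information.\<close>

locale chart =
  fixes V :: "('a::{alg_closed_field, field_char_0} ^ 3) set set" and i j k :: 3
  assumes V: "V \<in> Var" and D: "distinct3 i j k" and k: "\<not> vanish (\<lambda>v. v $ k) V"
begin

definition apt :: "'a \<Rightarrow> 'a \<Rightarrow> ('a ^ 3) set" where "apt x y = cls (vec3 i j k x y 1)"

definition I :: "'a poly poly set" where "I = {P. \<forall>x y. apt x y \<in> V \<longrightarrow> ev2 P x y = 0}"

abbreviation "hom d P \<equiv> form3 i j k d (cf2 P)"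

lemma hom_form: "is_form d (hom d P)"
  by (rule is_form_form3[OF D])

lemma primeV: "is_form d F \<Longrightarrow> is_form e G \<Longrightarrow> vanish (\<lambda>v. F v * G v) V \<Longrightarrow> vanish F V \<or> vanish G V"
  using V unfolding Var_iff by blast

lemma planeV: "V \<subseteq> proj_plane"
  using V unfolding Var_iff by (auto dest: closed_plane)

lemma apt_ne: "vec3 i j k x y 1 \<noteq> (0 :: 'a ^ 3)"
  by (simp add: vec3_eq_0_iff[OF D])

lemma affine_cls:
  assumes "v $ k \<noteq> 0"
  shows "cls v = apt (v $ i / v $ k) (v $ j / v $ k)"
proof -
  have "v \<noteq> 0" using assms by auto
  have "cls (vec3 i j k (v $ i / v $ k) (v $ j / v $ k) 1) = cls v"
    by (subst cls_eq_iff[OF apt_ne \<open>v \<noteq> 0\<close>]) (use affine_rep[OF D assms] assms in blast)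
  thus ?thesis by (simp add: apt_def)
qed

text \<open>What happens at infinity is invisible to \<open>I\<close>. It is neutralised by the
  factor \<open>v $ k\<close>, which primality removes again.\<close>

lemma I_iff:
  assumes "tdeg_le P d"
  shows "P \<in> I \<longleftrightarrow> vanish (hom d P) V"
proof
  assume P: "P \<in> I"
  have "vanish (\<lambda>v. hom d P v * v $ k) V" unfolding vanish_def
  proof (intro allI impI)
    fix v :: "'a ^ 3" assume v: "v \<noteq> 0" "cls v \<in> V"
    show "hom d P v * v $ k = 0"
    proof (cases "v $ k = 0")
      case False
      hence "ev2 P (v $ i / v $ k) (v $ j / v $ k) = 0"
        using P v affine_cls[OF False] unfolding I_def by auto
      thus ?thesis by (simp add: hom_eval[OF D assms False])
    qed simp
  qed
  thus "vanish (hom d P) V" using primeV[OF hom_form is_form_coord] k by blast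
next
  assume *: "vanish (hom d P) V"
  show "P \<in> I" unfolding I_def
  proof (intro CollectI allI impI)
    fix x y assume "apt x y \<in> V"
    hence "hom d P (vec3 i j k x y 1) = 0" using * apt_ne unfolding vanish_def apt_def by blast
    thus "ev2 P x y = 0" by (simp add: hom_affine[OF D assms])
  qed
qed

lemma I_prime:
  assumes "P * Q \<in> I" shows "P \<in> I \<or> Q \<in> I"
proof -
  obtain d where d: "tdeg_le P d" using ex_tdeg_le .
  obtain e where e: "tdeg_le Q e" using ex_tdeg_le .
  have "vanish (\<lambda>v. hom d P v * (hom e Q v * v $ k)) V" unfolding vanish_def
  proof (intro allI impI)
    fix v :: "'a ^ 3" assume v: "v \<noteq> 0" "cls v \<in> V"
    show "hom d P v * (hom e Q v * v $ k) = 0"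
    proof (cases "v $ k = 0")
      case False
      hence "ev2 (P * Q) (v $ i / v $ k) (v $ j / v $ k) = 0"
        using assms v affine_cls[OF False] unfolding I_def by auto
      thus ?thesis by (auto simp: hom_eval[OF D d False] hom_eval[OF D e False])
    qed simp
  qed
  hence "vanish (hom d P) V \<or> vanish (\<lambda>v. hom e Q v * v $ k) V"
    by (rule primeV[OF hom_form is_form_mult[OF hom_form is_form_coord]])
  hence "vanish (hom d P) V \<or> vanish (hom e Q) V"
    using primeV[OF hom_form is_form_coord, of e Q] k by blast
  thus ?thesis using I_iff d e by blast
qed

lemma I_ideal: "P \<in> I \<Longrightarrow> Q \<in> I \<Longrightarrow> P + Q \<in> I" "P \<in> I \<Longrightarrow> P * R \<in> I" "P \<in> I \<Longrightarrow> smult s P \<in> I"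
  "P \<in> I \<Longrightarrow> P dvd R \<Longrightarrow> R \<in> I"
  by (auto simp: I_def elim!: dvdE)

lemma ex_apt: obtains x y where "apt x y \<in> V"
proof -
  obtain v where "cls v \<in> V" "v $ k \<noteq> 0" using k unfolding vanish_def by blast
  thus ?thesis using that affine_cls by metis
qed

lemma I_nonzero: obtains P where "P \<in> I" "P \<noteq> 0"
proof -
  obtain w where "w \<noteq> 0" "cls w \<notin> V" "zariski_closed V" using V unfolding Var_iff by blast
  then obtain d F where F: "is_form d F" "vanish F V" "F w \<noteq> 0"
    using closed_iff[THEN iffD1, THEN conjunct2, rule_format] by blast
  obtain P where P: "tdeg_le P d" "F = hom d P" using form_dehom[OF D F(1)] .
  have "P \<in> I" using I_iff[OF P(1)] F P by simp
  moreover have "P \<noteq> 0" using F P by (auto simp: form3_def cf2_def)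
  ultimately show ?thesis using that by blast
qed

text \<open>\<open>r\<close> splits into linear factors, and primality of \<open>I\<close> selects
  one that vanishes on the affine part. The function \<open>sel\<close> is one of the two coordinate
  projections.\<close>

lemma coordinate_const:
  fixes sel :: "'a \<Rightarrow> 'a \<Rightarrow> 'a"
  assumes sel: "\<And>r. \<exists>R. \<forall>x y. ev2 R x y = poly r (sel x y)"
  assumes "r \<noteq> 0" "\<And>x y. apt x y \<in> V \<Longrightarrow> poly r (sel x y) = 0"
  shows "\<exists>b. \<forall>x y. apt x y \<in> V \<longrightarrow> sel x y = b"
  using assms(2,3)
proof (induction "degree r" arbitrary: r)
  case 0
  then obtain c where "r = [:c:]" "c \<noteq> 0" by (metis degree_eq_zeroE pCons_0_0)
  thus ?case using 0(3) ex_apt by auto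
next
  case (Suc n)
  then obtain b where "poly r b = 0" using alg_closed_imp_poly_has_root[of r] by auto
  then obtain r' where r': "r = [:-b, 1:] * r'" by (auto simp: poly_eq_0_iff_dvd elim: dvdE)
  have r0: "r' \<noteq> 0" using Suc r' by auto
  have deg: "n = degree r'" using Suc(2) r0 unfolding r' by (subst (asm) degree_mult_eq) auto
  obtain R S where R: "\<And>x y. ev2 R x y = poly [:-b, 1:] (sel x y)" "\<And>x y. ev2 S x y = poly r' (sel x y)"
    using sel by metis
  have "R * S \<in> I" using Suc(4) unfolding I_def r' by (auto simp: R)
  hence "R \<in> I \<or> S \<in> I" by (rule I_prime)
  thus ?case
  proof
    assume "R \<in> I"
    thus ?thesis by (intro exI[of _ b]) (auto simp: I_def R(1))
  next
    assume "S \<in> I"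
    thus ?thesis using Suc(1)[OF deg r0] by (auto simp: I_def R(2))
  qed
qed

text \<open>\<open>P\<close> generates the ideal of an irreducible affine curve. The last clause is
  a qualitative form of Bezout's theorem.\<close>

definition good :: "'a poly poly \<Rightarrow> bool" where
  "good P \<longleftrightarrow> P \<noteq> 0 \<and> P \<in> I \<and> (\<forall>Q\<in>I. P dvd Q) \<and>
     (\<forall>g. g \<notin> I \<longrightarrow> finite {(x, y). ev2 P x y = 0 \<and> ev2 g x y = 0})"

text \<open>If \<open>I\<close> contains a polynomial in x alone, then x is constant on the affine
  part, which is a point or fills a vertical line as far as polynomials can tell. Otherwise an
  element of \<open>I\<close> minimal in a suitable order generates \<open>I\<close>.\<close>

lemma I_structure: "(\<exists>a b. \<forall>x y. apt x y \<in> V \<longrightarrow> x = a \<and> y = b) \<or> (\<exists>P. good P)"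
proof (cases "\<exists>q. q \<noteq> 0 \<and> [:q:] \<in> I")
  case True
  then obtain q where q: "q \<noteq> 0" "\<And>x y. apt x y \<in> V \<Longrightarrow> poly q x = 0" unfolding I_def by auto
  have "\<exists>c. \<forall>x y. apt x y \<in> V \<longrightarrow> x = c"
    by (rule coordinate_const[OF _ q]) (auto intro!: exI[of _ "[:_:]"])
  then obtain c where c: "\<And>x y. apt x y \<in> V \<Longrightarrow> x = c" by blast
  hence X: "X_minus c \<in> I" unfolding I_def by auto
  have dvd: "X_minus c dvd Q" if "\<And>y. ev2 Q c y = 0" for Q using X_minus_dvd that by blast
  show ?thesis
  proof (cases "\<forall>Q\<in>I. \<forall>y. ev2 Q c y = 0")
    case True
    have "finite {(x, y). ev2 (X_minus c) x y = 0 \<and> ev2 g x y = 0}" if g: "g \<notin> I" for g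
    proof -
      obtain r where r: "\<And>y. ev2 g c y = poly r y" using ev2_as_poly_y[of g c] by blast
      have "r \<noteq> 0" using g dvd[of g] I_ideal(4)[OF X] r by auto
      hence "finite (Pair c ` {y. poly r y = 0})" by (intro finite_imageI poly_roots_finite)
      moreover have "{(x, y). ev2 (X_minus c) x y = 0 \<and> ev2 g x y = 0} \<subseteq> Pair c ` {y. poly r y = 0}"
        using r by auto
      ultimately show ?thesis by (rule rev_finite_subset)
    qed
    hence "good (X_minus c)" using X True dvd unfolding good_def by auto
    thus ?thesis by blast
  next
    case False
    then obtain Q where Q: "Q \<in> I" "\<exists>y. ev2 Q c y \<noteq> 0" by blast
    obtain r where r: "\<And>y. ev2 Q c y = poly r y" using ev2_as_poly_y[of Q c] by blast
    have "r \<noteq> 0" using Q r by auto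
    moreover have "poly r y = 0" if "apt x y \<in> V" for x y
      using Q(1) c[OF that] that unfolding I_def r[symmetric] by auto
    ultimately have "\<exists>b. \<forall>x y. apt x y \<in> V \<longrightarrow> y = b"
      using coordinate_const[of "\<lambda>x y. y" r] poly_y_as_ev2 by blast
    thus ?thesis using c by blast
  qed
next
  case False
  hence noconst: "q = 0" if "[:q:] \<in> I" for q using that by blast
  obtain P0 where P0: "P0 \<in> I" "P0 \<noteq> 0" using I_nonzero .
  \<comment> \<open>The y-degree makes pseudo-division work; the degree of the leading coefficient
    breaks ties so that a minimal \<open>P\<close> has no factor x - c, that is, \<open>P\<close> is
    primitive.\<close>
  define M where "M = (\<lambda>P::'a poly poly. (degree P, degree (lead_coeff P)))"
  have wf: "wf (less_than <*lex*> less_than)" by (intro wf_lex_prod wf_less_than)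
  obtain P where P: "P \<in> I" "P \<noteq> 0"
    and min: "\<And>Q. Q \<in> I \<Longrightarrow> Q \<noteq> 0 \<Longrightarrow> (M Q, M P) \<notin> less_than <*lex*> less_than"
  proof -
    have "P0 \<in> {P \<in> I. P \<noteq> 0}" using P0 by simp
    thus thesis
    proof (rule wfE_min[OF wf_inv_image[OF wf, of M]])
      fix P assume P: "P \<in> {P \<in> I. P \<noteq> 0}"
        and min: "\<And>Q. (Q, P) \<in> inv_image (less_than <*lex*> less_than) M \<Longrightarrow> Q \<notin> {P \<in> I. P \<noteq> 0}"
      have "(M Q, M P) \<notin> less_than <*lex*> less_than" if "Q \<in> I" "Q \<noteq> 0" for Q
        using min[of Q, unfolded in_inv_image] that by blast
      thus thesis using P that[of P] by blast
    qed
  qed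
  have degP: "degree P > 0"
  proof (rule ccontr)
    assume "\<not> ?thesis"
    then obtain q where "P = [:q:]" using degree_eq_zeroE[of P] by auto
    thus False using noconst P by auto
  qed
  have degmin: "degree P \<le> degree Q" if "Q \<in> I" "Q \<noteq> 0" for Q
    using min[OF that] by (auto simp: M_def)
  have prim: "\<exists>y. ev2 P c y \<noteq> 0" for c
  proof (rule ccontr)
    assume "\<not> ?thesis"
    hence "X_minus c dvd P" using X_minus_dvd by blast
    then obtain P' where P': "P = X_minus c * P'" by (elim dvdE)
    have "X_minus c \<notin> I" using noconst by fastforce
    hence "P' \<in> I" using I_prime P P' by blast
    moreover have n: "P' \<noteq> 0" using P P' by auto
    moreover have "degree P = degree P'" unfolding P' using n by (subst degree_mult_eq) auto
    moreover have "lead_coeff P = [:-c, 1:] * lead_coeff P'"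
      unfolding P' by (subst lead_coeff_mult) simp
    hence "degree (lead_coeff P) = degree ([:-c, 1:] * lead_coeff P')" by (rule arg_cong)
    hence "degree (lead_coeff P) = Suc (degree (lead_coeff P'))"
      using n by (subst (asm) degree_mult_eq) auto
    ultimately show False using min[of P'] by (auto simp: M_def)
  qed
  \<comment> \<open>The pseudo-remainder lies in \<open>I\<close> and has smaller y-degree than
    \<open>P\<close>, hence is zero; Gauss's lemma then clears the multiplier
    \<open>s\<close>.\<close>
  have principal: "P dvd Q" if "Q \<in> I" for Q
  proof -
    obtain s q r where *: "s \<noteq> 0" "smult s Q = P * q + r" "r = 0 \<or> degree r < degree P"
      using pseudo_division[OF P(2), of Q] .
    have "r = smult s Q + P * (- q)" using *(2) by simp
    moreover have "smult s Q + P * (- q) \<in> I" using I_ideal P that by blast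
    ultimately have "r = 0" using degmin *(3) by fastforce
    hence "P dvd smult s Q" using *(2) by simp
    thus ?thesis by (rule gauss_primitive[OF prim *(1)])
  qed
  have "finite {(x, y). ev2 P x y = 0 \<and> ev2 g x y = 0}" if g: "g \<notin> I" for g
  proof -
    \<comment> \<open>A Euclidean substitute for the resultant: an element \<open>R\<close> of least
      y-degree in the ideal generated by \<open>P\<close> and \<open>g\<close> divides both up to
      factors depending on x only.\<close>
    define J where "J = {R. R \<noteq> 0 \<and> (\<exists>u v. R = u * P + v * g)}"
    have "P = 1 * P + 0 * g" by simp
    hence "P \<in> J" using P unfolding J_def by blast
    then obtain R where R: "R \<in> J" and minR: "\<And>S. S \<in> J \<Longrightarrow> degree R \<le> degree S"
      using ex_has_least_nat[of "\<lambda>R. R \<in> J" P degree] by blast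
    obtain u v where uv: "R = u * P + v * g" "R \<noteq> 0" using R unfolding J_def by blast
    have div: "\<exists>s q. s \<noteq> 0 \<and> smult s f = R * q" if f: "f = u' * P + v' * g" for f u' v'
    proof -
      obtain s q r where *: "s \<noteq> 0" "smult s f = R * q + r" "r = 0 \<or> degree r < degree R"
        using pseudo_division[OF uv(2), of f] .
      have "r = smult s f - R * q" using *(2) by simp
      also have "\<dots> = ([:s:] * u' - u * q) * P + ([:s:] * v' - v * q) * g"
        unfolding f uv(1) by (simp add: algebra_simps smult_add_right)
      finally have "r = ([:s:] * u' - u * q) * P + ([:s:] * v' - v * q) * g" .
      hence "r \<noteq> 0 \<Longrightarrow> r \<in> J" unfolding J_def by blast
      hence "r = 0" using minR *(3) by fastforce
      thus ?thesis using * by auto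
    qed
    obtain s q where sq: "s \<noteq> 0" "smult s P = R * q" using div[of P 1 0] by auto
    obtain s' q' where sq': "s' \<noteq> 0" "smult s' g = R * q'" using div[of g 0 1] by auto
    have "R \<in> I \<or> q \<in> I" using I_prime[of R q] I_ideal(3)[OF P(1), of s] sq by simp
    moreover have "R \<notin> I"
    proof
      assume "R \<in> I"
      hence "P dvd smult s' g" using principal sq' by simp
      hence "P dvd g" by (rule gauss_primitive[OF prim sq'(1)])
      thus False using g I_ideal(4)[OF P(1)] by blast
    qed
    ultimately have "P dvd q" using principal by blast
    then obtain h where "q = P * h" by (elim dvdE)
    \<comment> \<open>Cancelling \<open>P\<close> leaves s = R h, so \<open>R\<close> is free of y.
      Its finitely many roots bound the abscissas of common zeros, and over each abscissa the
      primitive \<open>P\<close> has finitely many zeros.\<close>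
    hence "P * [:s:] = P * (R * h)" using sq by (simp add: algebra_simps)
    hence Rh: "[:s:] = R * h" using P(2) by (subst (asm) mult_cancel_left) simp
    hence "h \<noteq> 0" using sq by auto
    hence "degree R = 0" using arg_cong[OF Rh, of degree] uv(2) by (simp add: degree_mult_eq)
    then obtain q0 where q0: "R = [:q0:]" by (rule degree_eq_zeroE)
    hence "q0 \<noteq> 0" using uv by auto
    hence fin: "finite {x. poly q0 x = 0}" by (rule poly_roots_finite)
    have finy: "finite {y. ev2 P x y = 0}" for x
    proof -
      obtain r where r: "\<And>y. ev2 P x y = poly r y" using ev2_as_poly_y[of P x] by blast
      hence "r \<noteq> 0" using prim[of x] by auto
      thus ?thesis unfolding r by (rule poly_roots_finite)
    qed
    have "poly q0 x = 0" if z: "ev2 P x y = 0" "ev2 g x y = 0" for x y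
    proof -
      have "ev2 R x y = 0" unfolding uv(1) by (simp add: z)
      thus ?thesis by (simp add: q0)
    qed
    hence "{(x, y). ev2 P x y = 0 \<and> ev2 g x y = 0} \<subseteq>
        (SIGMA x:{x. poly q0 x = 0}. {y. ev2 P x y = 0})" by auto
    thus "finite {(x, y). ev2 P x y = 0 \<and> ev2 g x y = 0}"
      by (rule finite_subset) (rule finite_SigmaI[OF fin finy])
  qed
  hence "good P" unfolding good_def using P principal by blast
  thus ?thesis by blast
qed

text \<open>In the curve case the form is the homogenised generator of \<open>I\<close>. Its zero
  set contains \<open>V\<close>; the work lies in showing that no further points appear at
  infinity.\<close>

lemma classification:
  "(\<exists>v. v \<noteq> 0 \<and> V = {cls v}) \<or>
   (\<exists>d F. is_form d F \<and> V = zset F \<and> (\<forall>e G. is_form e G \<longrightarrow> \<not> vanish G V \<longrightarrow> finite (V \<inter> zset G)))"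
  using I_structure
proof (elim disjE exE)
  fix a b assume ab: "\<forall>x y. apt x y \<in> V \<longrightarrow> x = a \<and> y = b"
  have f: "is_form 1 (\<lambda>v. v $ l - c * v $ k)" for l and c :: 'a
    by (intro is_form_diff is_form_coord is_form_cmult)
  have "v $ i = a * v $ k \<and> v $ j = b * v $ k" if "cls v \<in> V" "v $ k \<noteq> 0" for v
    using ab that affine_cls[OF that(2)] by (auto simp: field_simps)
  hence "vanish (\<lambda>v. (v $ i - a * v $ k) * v $ k) V" "vanish (\<lambda>v. (v $ j - b * v $ k) * v $ k) V"
    unfolding vanish_def by (auto simp: algebra_simps)
  hence v: "vanish (\<lambda>v. v $ i - a * v $ k) V" "vanish (\<lambda>v. v $ j - b * v $ k) V"
    using primeV[OF f is_form_coord] k by blast+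
  have "P = apt a b" if P: "P \<in> V" for P
  proof -
    obtain w where w: "w \<noteq> 0" "P = cls w" using subsetD[OF planeV P] by (rule planeE)
    have "w $ i = a * w $ k" "w $ j = b * w $ k"
      using v w P unfolding vanish_def by auto
    hence "w $ k \<noteq> 0" using w(1) vec3_eq_iff[OF D, of w 0] by auto
    thus ?thesis using affine_cls[of w] ab P w by auto
  qed
  moreover obtain x y where "apt x y \<in> V" using ex_apt .
  ultimately have "V = {apt a b}" by (intro equalityI subsetI) auto
  hence "V = {cls (vec3 i j k a b 1)}" by (simp add: apt_def)
  thus ?thesis using apt_ne by blast
next
  fix P assume good: "good P"
  hence P: "P \<noteq> 0" "P \<in> I" unfolding good_def by auto
  obtain d a b where d: "tdeg_le P d" "a + b = d" "coeff (coeff P b) a \<noteq> 0" using ex_tdeg[OF P(1)] .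
  define F where "F = hom d P"
  have F: "is_form d F" unfolding F_def by (rule hom_form)
  have VF: "V \<subseteq> zset F" using I_iff[OF d(1)] P vanish_iff[OF F planeV] F_def by simp
  have "cls v \<in> V" if v: "v \<noteq> 0" "F v = 0" for v
  proof (rule ccontr)
    assume "cls v \<notin> V"
    moreover have "zariski_closed V" using V unfolding Var_iff by blast
    ultimately obtain N G where G: "is_form N G" "vanish G V" "G v \<noteq> 0"
      using v(1) closed_iff[THEN iffD1, THEN conjunct2, rule_format] by blast
    obtain g where g: "tdeg_le g N" "G = hom N g" using form_dehom[OF D G(1)] .
    have "g \<in> I" using I_iff[OF g(1)] G g by simp
    hence "P dvd g" using good unfolding good_def by blast
    then obtain h where h: "g = P * h" by (elim dvdE)
    show False
    proof (cases "v $ k = 0")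
      case False
      hence "ev2 P (v $ i / v $ k) (v $ j / v $ k) = 0"
        using v(2) unfolding F_def hom_eval[OF D d(1) False] by simp
      hence "ev2 g (v $ i / v $ k) (v $ j / v $ k) = 0" by (simp add: h)
      thus False using G(3) unfolding g(2) hom_eval[OF D g(1) False] by simp
    next
      case True
      have "g \<noteq> 0" using G(3) g(2) by (auto simp: form3_def cf2_def)
      hence "h \<noteq> 0" using h by auto
      then obtain e a' b' where e: "tdeg_le h e" "a' + b' = e" "coeff (coeff h b') a' \<noteq> 0"
        using ex_tdeg[of h] by metis
      define H where "H = hom e h"
      have H: "is_form e H" unfolding H_def by (rule hom_form)
      \<comment> \<open>The point at infinity is approached along the line through the affine origin
        \<open>w\<close>, whose parameter t is the coordinate \<open>k\<close>. There g = P h turns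
        into G t^(d+e) = F H t^N.\<close>
      define w :: "'a ^ 3" where "w = vec3 i j k 0 0 1"
      have nth: "(u + t *s w) $ i = u $ i" "(u + t *s w) $ j = u $ j" "(u + t *s w) $ k = u $ k + t" for u t
        by (simp_all add: w_def vec3_nth[OF D])
      have eq: "G (u + t *s w) * t ^ (d + e) = F (u + t *s w) * H (u + t *s w) * t ^ N"
        if "t \<noteq> 0" "u $ k = 0" for u t
      proof -
        have nz: "(u + t *s w) $ k \<noteq> 0" using that by (simp only: nth) simp
        have tk: "(u + t *s w) $ k = t" using that by (simp only: nth) simp
        show ?thesis
          unfolding g(2) F_def H_def hom_eval[OF D g(1) nz] hom_eval[OF D d(1) nz] hom_eval[OF D e(1) nz]
          unfolding tk h by (simp add: power_add)
      qed
      have line: "\<exists>A B. (\<forall>t. G (u + t *s w) = poly A t) \<and> (\<forall>t. F (u + t *s w) * H (u + t *s w) = poly B t) \<and>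
          A * monom 1 (d + e) = B * monom 1 N" if u: "u $ k = 0" for u
      proof -
        obtain A where A: "\<And>t. G (u + t *s w) = poly A t" using form_line[OF G(1), of u w] by metis
        obtain B where B: "\<And>t. F (u + t *s w) * H (u + t *s w) = poly B t"
          using form_line[OF is_form_mult[OF F H], of u w] by metis
        have "A * monom 1 (d + e) = B * monom 1 N"
          by (rule poly_eq_inf[of 0]) (use eq[OF _ u] A B in \<open>simp add: poly_monom\<close>)
        thus ?thesis using A B by blast
      qed
      \<comment> \<open>Comparing powers of t: if d + e is at most N, then \<open>G\<close> vanishes
        at \<open>v\<close> together with \<open>F\<close>. Otherwise F H vanishes on the whole line
        at infinity, against \<open>hom_top\<close>.\<close>
      show False
      proof (cases "d + e \<le> N")
        case le: True
        obtain A B where AB: "\<And>t. G (v + t *s w) = poly A t" "\<And>t. F (v + t *s w) * H (v + t *s w) = poly B t"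
          "A * monom 1 (d + e) = B * monom 1 N" using line[OF True] by blast
        have "B * monom 1 N = B * monom 1 (N - (d + e)) * monom 1 (d + e)"
          using le by (simp add: mult.assoc mult_monom)
        with AB(3) have "A * monom 1 (d + e) = B * monom 1 (N - (d + e)) * monom 1 (d + e)"
          by (rule trans)
        hence "A = B * monom 1 (N - (d + e))" by (rule monom_cancel)
        hence "poly A 0 = poly B 0 * poly (monom 1 (N - (d + e))) 0" by simp
        moreover have "poly B 0 = 0" using AB(2)[of 0] v(2) by simp
        ultimately show False using AB(1)[of 0] G(3) by simp
      next
        case gt: False
        have zero: "F u * H u = 0" if "u $ k = 0" for u
        proof -
          obtain A B where AB: "\<And>t. F (u + t *s w) * H (u + t *s w) = poly B t"
            "A * monom 1 (d + e) = B * monom 1 N" using line[OF \<open>u $ k = 0\<close>] by blast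
          have "A * monom 1 (d + e) = A * monom 1 (d + e - N) * monom 1 N"
            using gt by (simp add: mult.assoc mult_monom)
          with AB(2)[symmetric] have "B * monom 1 N = A * monom 1 (d + e - N) * monom 1 N"
            by (rule trans)
          hence "B = A * monom 1 (d + e - N)" by (rule monom_cancel)
          hence "poly B 0 = 0" using gt by (simp add: poly_monom)
          thus ?thesis using AB(1)[of 0] by simp
        qed
        obtain r where r: "r \<noteq> 0" "\<And>x. F (vec3 i j k x 1 0) = poly r x"
          using hom_top[OF D d(3,2)] unfolding F_def by metis
        obtain s where s: "s \<noteq> 0" "\<And>x. H (vec3 i j k x 1 0) = poly s x"
          using hom_top[OF D e(3,2)] unfolding H_def by metis
        have "r * s = 0"
        proof (rule poly_eq_inf[of 0])
          fix t :: 'a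
          have "F (vec3 i j k t 1 0) * H (vec3 i j k t 1 0) = 0"
            by (rule zero) (simp add: vec3_nth[OF D])
          thus "poly (r * s) t = poly 0 t" by (simp add: r s)
        qed
        thus False using r s by simp
      qed
    qed
  qed
  hence VF': "V = zset F" using VF unfolding zset_def by blast
  have "finite (V \<inter> zset G)" if G: "is_form e G" "\<not> vanish G V" for e G
  proof -
    obtain g where g: "tdeg_le g e" "G = hom e g" using form_dehom[OF D G(1)] .
    have "g \<notin> I" using I_iff[OF g(1)] G g by simp
    hence fin: "finite {(x, y). ev2 P x y = 0 \<and> ev2 g x y = 0}" using good unfolding good_def by blast
    obtain r where r: "r \<noteq> 0" "\<And>x. F (vec3 i j k x 1 0) = poly r x"
      using hom_top[OF D d(3,2)] unfolding F_def by metis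
    \<comment> \<open>Affine points come from \<open>good\<close>; points at infinity are those with
      coordinate \<open>j\<close> equal to 1, governed by the roots of \<open>r\<close>, and the
      single remaining point.\<close>
    have "V \<inter> zset G \<subseteq> (\<lambda>(x, y). apt x y) ` {(x, y). ev2 P x y = 0 \<and> ev2 g x y = 0} \<union>
       (\<lambda>x. cls (vec3 i j k x 1 0)) ` {x. poly r x = 0} \<union> {cls (vec3 i j k 1 0 0)}"
    proof
      fix Q assume Q: "Q \<in> V \<inter> zset G"
      hence "Q \<in> proj_plane" using planeV by blast
      then obtain v where v: "v \<noteq> 0" "Q = cls v" by (rule planeE)
      have z: "F v = 0" "G v = 0" using Q v cls_in_zset[OF F v(1)] cls_in_zset[OF G(1) v(1)] VF' by auto
      show "Q \<in> (\<lambda>(x, y). apt x y) ` {(x, y). ev2 P x y = 0 \<and> ev2 g x y = 0} \<union>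
         (\<lambda>x. cls (vec3 i j k x 1 0)) ` {x. poly r x = 0} \<union> {cls (vec3 i j k 1 0 0)}"
      proof (cases "v $ k = 0")
        case False
        have "ev2 P (v $ i / v $ k) (v $ j / v $ k) = 0" "ev2 g (v $ i / v $ k) (v $ j / v $ k) = 0"
          using z False unfolding F_def g(2) hom_eval[OF D d(1) False] hom_eval[OF D g(1) False] by auto
        thus ?thesis unfolding v(2) affine_cls[OF False] by auto
      next
        case k0: True
        show ?thesis
        proof (cases "v $ j = 0")
          case True
          hence vi: "v $ i \<noteq> 0" using k0 v(1) vec3_eq_iff[OF D, of v 0] by auto
          have "v = v $ i *s vec3 i j k 1 0 0"
            using True k0 by (simp add: vec3_eq_iff[OF D] vec3_nth[OF D])
          hence "cls (vec3 i j k 1 0 0) = cls v"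
            using vi v(1) by (subst cls_eq_iff) (auto simp: vec3_eq_0_iff[OF D])
          thus ?thesis using v by simp
        next
          case False
          have *: "v = v $ j *s vec3 i j k (v $ i / v $ j) 1 0"
            using False k0 by (simp add: vec3_eq_iff[OF D] vec3_nth[OF D])
          hence "cls (vec3 i j k (v $ i / v $ j) 1 0) = cls v"
            using False v(1) by (subst cls_eq_iff) (auto simp: vec3_eq_0_iff[OF D])
          moreover have "poly r (v $ i / v $ j) = 0"
          proof -
            have "F (v $ j *s vec3 i j k (v $ i / v $ j) 1 0) = 0" using z(1) * by simp
            thus ?thesis using False by (simp add: form_scale[OF F] r)
          qed
          ultimately show ?thesis using v by auto
        qed
      qed
    qed
    moreover have "finite {x. poly r x = 0}" using r by (intro poly_roots_finite)
    ultimately show ?thesis using fin by (meson finite.emptyI finite_Un finite_imageI finite_insert finite_subset)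
  qed
  thus ?thesis using F VF' by blast
qed

end

text \<open>Some coordinate is nonzero at some point of \<open>V\<close>, and the chart belonging to
  it applies.\<close>

theorem Var_cases:
  fixes V :: "('a::{alg_closed_field, field_char_0} ^ 3) set set"
  assumes "V \<in> Var"
  obtains (point) v where "v \<noteq> 0" "V = {cls v}"
  | (curve) d F where "is_form d F" "V = zset F"
      "\<And>e G. is_form e G \<Longrightarrow> \<not> vanish G V \<Longrightarrow> finite (V \<inter> zset G)"
proof -
  have "V \<noteq> {}" "V \<subseteq> proj_plane" using assms unfolding Var_iff by (auto dest: closed_plane)
  then obtain P where P: "P \<in> V" "P \<in> proj_plane" by blast
  then obtain v where v: "v \<noteq> 0" "P = cls v" using planeE by blast
  then obtain k where "v $ k \<noteq> 0" by (metis vec_eq_iff zero_index)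
  hence "\<not> vanish (\<lambda>v. v $ k) V" using v P unfolding vanish_def by blast
  moreover obtain i j where "distinct3 k i j" using ex_distinct3 by blast
  hence "distinct3 i j k" by (auto simp: distinct3_def)
  ultimately interpret chart V i j k using assms by unfold_locales
  show ?thesis using classification point curve by metis
qed

section \<open>Isomorphisms between subfields\<close>

definition subfld :: "'a::field set \<Rightarrow> bool" where
  "subfld k \<longleftrightarrow> 0 \<in> k \<and> 1 \<in> k \<and> (\<forall>x\<in>k. \<forall>y\<in>k. x + y \<in> k \<and> x * y \<in> k) \<and>
     (\<forall>x\<in>k. - x \<in> k \<and> inverse x \<in> k)"

lemma subfldD:
  assumes "subfld k"
  shows "0 \<in> k" "1 \<in> k" "x \<in> k \<Longrightarrow> y \<in> k \<Longrightarrow> x + y \<in> k" "x \<in> k \<Longrightarrow> y \<in> k \<Longrightarrow> x * y \<in> k"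
    "x \<in> k \<Longrightarrow> - x \<in> k" "x \<in> k \<Longrightarrow> inverse x \<in> k" "x \<in> k \<Longrightarrow> y \<in> k \<Longrightarrow> x - y \<in> k"
    "x \<in> k \<Longrightarrow> y \<in> k \<Longrightarrow> x / y \<in> k" "x \<in> k \<Longrightarrow> x ^ n \<in> k"
proof -
  show *: "0 \<in> k" "1 \<in> k" "x \<in> k \<Longrightarrow> y \<in> k \<Longrightarrow> x + y \<in> k" "x \<in> k \<Longrightarrow> y \<in> k \<Longrightarrow> x * y \<in> k"
    "x \<in> k \<Longrightarrow> - x \<in> k" "x \<in> k \<Longrightarrow> inverse x \<in> k" for x y
    using assms unfolding subfld_def by blast+
  show "x \<in> k \<Longrightarrow> y \<in> k \<Longrightarrow> x - y \<in> k" using *(3)[of x "- y"] *(5)[of y] by simp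
  show "x \<in> k \<Longrightarrow> y \<in> k \<Longrightarrow> x / y \<in> k" using *(4)[of x "inverse y"] *(6)[of y] by (simp add: divide_inverse)
  show "x \<in> k \<Longrightarrow> x ^ n \<in> k" by (induction n) (auto simp: *)
qed

lemma subfld_sum: "subfld k \<Longrightarrow> (\<And>a. a \<in> A \<Longrightarrow> f a \<in> k) \<Longrightarrow> (\<Sum>a\<in>A. f a) \<in> k"
  by (induction A rule: infinite_finite_induct) (auto simp: subfldD)

lemma subfld_prod: "subfld k \<Longrightarrow> (\<And>a. a \<in> A \<Longrightarrow> f a \<in> k) \<Longrightarrow> (\<Prod>a\<in>A. f a) \<in> k"
  by (induction A rule: infinite_finite_induct) (auto simp: subfldD)

definition gen :: "'a::field set \<Rightarrow> 'a set" where
  "gen S = \<Inter>{k. subfld k \<and> S \<subseteq> k}"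

lemma subfld_gen: "subfld (gen S)"
  unfolding gen_def subfld_def by blast

lemma gen_superset: "S \<subseteq> gen S"
  unfolding gen_def by blast

lemma gen_least: "subfld k \<Longrightarrow> S \<subseteq> k \<Longrightarrow> gen S \<subseteq> k"
  unfolding gen_def by blast

lemma gen_mono: "S \<subseteq> T \<Longrightarrow> gen S \<subseteq> gen T"
  by (meson gen_least gen_superset order.trans subfld_gen)

definition pover :: "'a::zero set \<Rightarrow> 'a poly \<Rightarrow> bool" where
  "pover k p \<longleftrightarrow> (\<forall>n. coeff p n \<in> k)"

lemma pover_0: "0 \<in> k \<Longrightarrow> pover k 0"
  by (simp add: pover_def)

lemma pover_pCons_iff: "pover k (pCons a p) \<longleftrightarrow> a \<in> k \<and> pover k p"
  unfolding pover_def coeff_pCons by (auto split: nat.splits)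

lemma pover_add: "subfld k \<Longrightarrow> pover k p \<Longrightarrow> pover k q \<Longrightarrow> pover k (p + q)"
  and pover_diff: "subfld k \<Longrightarrow> pover k p \<Longrightarrow> pover k q \<Longrightarrow> pover k (p - q)"
  and pover_uminus: "subfld k \<Longrightarrow> pover k p \<Longrightarrow> pover k (- p)"
  and pover_smult: "subfld k \<Longrightarrow> c \<in> k \<Longrightarrow> pover k p \<Longrightarrow> pover k (smult c p)"
  by (auto simp: pover_def subfldD)

lemma pover_mult: "subfld k \<Longrightarrow> pover k p \<Longrightarrow> pover k q \<Longrightarrow> pover k (p * q)"
  unfolding pover_def coeff_mult by (auto intro!: subfld_sum subfldD(4))

lemma poly_in_subfld: "subfld k \<Longrightarrow> pover k p \<Longrightarrow> x \<in> k \<Longrightarrow> poly p x \<in> k"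
  unfolding poly_altdef pover_def by (auto intro!: subfld_sum subfldD(4) subfldD(9))

lemma pover_mono: "pover k p \<Longrightarrow> k \<subseteq> m \<Longrightarrow> pover m p"
  by (auto simp: pover_def)

lemma pover_const: "subfld k \<Longrightarrow> c \<in> k \<Longrightarrow> pover k [:c:]"
  by (simp add: pover_pCons_iff pover_0 subfldD)

text \<open>Subfields are sets rather than types, so the division algorithm is rerun to see that
  quotient and remainder keep their coefficients in \<open>k\<close>.\<close>

lemma pover_divide:
  assumes k: "subfld k" and q: "pover k q" "q \<noteq> 0" and "pover k p"
  shows "\<exists>s r. pover k s \<and> pover k r \<and> p = q * s + r \<and> (r = 0 \<or> degree r < degree q)"
  using assms(4)
proof (induction p)
  case 0
  show ?case by (intro exI[of _ 0]) (simp add: pover_0 subfldD[OF k])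
next
  case (pCons a p)
  hence a: "a \<in> k" "pover k p" by (auto simp: pover_pCons_iff)
  then obtain s r where sr: "pover k s" "pover k r" "p = q * s + r" "r = 0 \<or> degree r < degree q"
    using pCons by blast
  define b where "b = coeff (pCons a r) (degree q) / lead_coeff q"
  have b: "b \<in> k" unfolding b_def using sr(2) a q(1) unfolding pover_def
    by (intro subfldD(8)[OF k]) (auto simp: coeff_pCons split: nat.splits)
  have "pCons a p = q * pCons b s + (pCons a r - smult b q)"
    unfolding sr(3) by (simp add: mult_pCons_right)
  moreover have "pover k (pCons b s)" "pover k (pCons a r - smult b q)"
    using a b sr q k by (auto simp: pover_pCons_iff intro!: pover_diff pover_smult)
  moreover have "pCons a r - smult b q = 0 \<or> degree (pCons a r - smult b q) < degree q"
  proof (rule eq_zero_or_degree_less)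
    show "degree (pCons a r - smult b q) \<le> degree q"
      using sr(4) degree_pCons_le[of a r] by (intro degree_diff_le) (auto simp: degree_smult_le)
    show "coeff (pCons a r - smult b q) (degree q) = 0" using q(2) by (simp add: b_def)
  qed
  ultimately show ?case by blast
qed

definition algb :: "'a::field set \<Rightarrow> 'a \<Rightarrow> bool" where
  "algb k x \<longleftrightarrow> (\<exists>p. pover k p \<and> p \<noteq> 0 \<and> poly p x = 0)"

lemma algb_mono: "algb k x \<Longrightarrow> k \<subseteq> m \<Longrightarrow> algb m x"
  unfolding algb_def using pover_mono by blast

lemma algb_self: "subfld k \<Longrightarrow> x \<in> k \<Longrightarrow> algb k x"
  unfolding algb_def
  by (intro exI[of _ "[:-x, 1:]"]) (auto simp: pover_pCons_iff pover_0 subfldD)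

lemma minimal_poly:
  assumes k: "subfld k" and "algb k x"
  obtains m where "pover k m" "m \<noteq> 0" "poly m x = 0" "\<And>p. pover k p \<Longrightarrow> poly p x = 0 \<Longrightarrow>
     \<exists>s. pover k s \<and> p = m * s"
    "\<And>p. pover k p \<Longrightarrow> p \<noteq> 0 \<Longrightarrow> poly p x = 0 \<Longrightarrow> degree m \<le> degree p"
proof -
  let ?P = "\<lambda>p. pover k p \<and> p \<noteq> 0 \<and> poly p x = 0"
  obtain m where m: "?P m" and min: "\<And>p. ?P p \<Longrightarrow> degree m \<le> degree p"
    using assms(2) ex_has_least_nat[of ?P _ degree] unfolding algb_def by blast
  have "\<exists>s. pover k s \<and> p = m * s" if p: "pover k p" "poly p x = 0" for p
  proof -
    obtain s r where sr: "pover k s" "pover k r" "p = m * s + r" "r = 0 \<or> degree r < degree m"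
      using pover_divide[OF k _ _ p(1), of m] m by blast
    have "poly r x = 0" using p(2) m unfolding sr(3) by simp
    hence "r = 0" using min[of r] sr by fastforce
    thus ?thesis using sr by auto
  qed
  thus ?thesis using that m min by blast
qed

definition piso :: "'a::field set \<Rightarrow> 'b::field set \<Rightarrow> ('a \<Rightarrow> 'b) \<Rightarrow> bool" where
  "piso k l \<sigma> \<longleftrightarrow> subfld k \<and> subfld l \<and> bij_betw \<sigma> k l \<and>
     (\<forall>x\<in>k. \<forall>y\<in>k. \<sigma> (x + y) = \<sigma> x + \<sigma> y \<and> \<sigma> (x * y) = \<sigma> x * \<sigma> y)"

locale partial_iso =
  fixes k :: "'a::field set" and l :: "'b::field set" and \<sigma> :: "'a \<Rightarrow> 'b"
  assumes piso: "piso k l \<sigma>"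
begin

lemma sub: "subfld k" "subfld l"
  using piso by (auto simp: piso_def)

lemma inj: "x \<in> k \<Longrightarrow> y \<in> k \<Longrightarrow> \<sigma> x = \<sigma> y \<longleftrightarrow> x = y"
  using piso by (auto simp: piso_def bij_betw_def inj_on_def)

lemma img: "\<sigma> ` k = l" "x \<in> k \<Longrightarrow> \<sigma> x \<in> l"
  using piso by (auto simp: piso_def bij_betw_def)

lemma add: "x \<in> k \<Longrightarrow> y \<in> k \<Longrightarrow> \<sigma> (x + y) = \<sigma> x + \<sigma> y"
  and mult: "x \<in> k \<Longrightarrow> y \<in> k \<Longrightarrow> \<sigma> (x * y) = \<sigma> x * \<sigma> y"
  using piso by (auto simp: piso_def)

lemma zero: "\<sigma> 0 = 0"
proof -
  have "\<sigma> 0 + \<sigma> 0 = \<sigma> 0 + 0" using add[of 0 0] subfldD(1)[OF sub(1)] by simp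
  thus ?thesis by (rule add_left_imp_eq)
qed

lemma eq_0: "x \<in> k \<Longrightarrow> \<sigma> x = 0 \<longleftrightarrow> x = 0"
  using inj[of x 0] zero subfldD[OF sub(1)] by simp

lemma one: "\<sigma> 1 = 1"
proof -
  have "\<sigma> 1 * \<sigma> 1 = \<sigma> 1 * 1" using mult[of 1 1] subfldD[OF sub(1)] by simp
  thus ?thesis using eq_0[of 1] subfldD[OF sub(1)] by (subst (asm) mult_left_cancel) auto
qed

lemma uminus: "x \<in> k \<Longrightarrow> \<sigma> (- x) = - \<sigma> x"
  using add[of x "- x"] subfldD[OF sub(1)] zero by (simp add: add_eq_0_iff)

lemma diff: "x \<in> k \<Longrightarrow> y \<in> k \<Longrightarrow> \<sigma> (x - y) = \<sigma> x - \<sigma> y"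
  using add[of x "- y"] uminus[of y] subfldD[OF sub(1)] by simp

lemma power: "x \<in> k \<Longrightarrow> \<sigma> (x ^ n) = \<sigma> x ^ n"
  by (induction n) (auto simp: one mult subfldD[OF sub(1)])

lemma sum: "(\<And>a. a \<in> A \<Longrightarrow> f a \<in> k) \<Longrightarrow> \<sigma> (\<Sum>a\<in>A. f a) = (\<Sum>a\<in>A. \<sigma> (f a))"
  by (induction A rule: infinite_finite_induct) (auto simp: zero add subfld_sum[OF sub(1)])

lemma divide:
  assumes "x \<in> k" "y \<in> k" shows "\<sigma> (x / y) = \<sigma> x / \<sigma> y"
proof (cases "y = 0")
  case False
  have "\<sigma> (x / y) * \<sigma> y = \<sigma> x" using mult[of "x / y" y] assms subfldD[OF sub(1)] False by simp
  thus ?thesis using eq_0[OF assms(2)] False by (simp add: field_simps)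
qed (simp add: zero)

definition pm :: "'a poly \<Rightarrow> 'b poly" where "pm p = map_poly \<sigma> p"

lemma coeff_pm: "coeff (pm p) n = \<sigma> (coeff p n)"
  by (simp add: pm_def coeff_map_poly zero)

lemma pover_pm: "pover k p \<Longrightarrow> pover l (pm p)"
  by (simp add: pover_def coeff_pm img)

lemma pm_inj: "pover k p \<Longrightarrow> pover k q \<Longrightarrow> pm p = pm q \<longleftrightarrow> p = q"
  by (auto simp: poly_eq_iff coeff_pm pover_def inj)

lemma pm_0: "pm 0 = 0"
  by (simp add: pm_def)

lemma pm_pCons: "pm (pCons a p) = pCons (\<sigma> a) (pm p)"
  by (rule poly_eqI) (simp add: coeff_pm coeff_pCons split: nat.splits)

lemma pm_eq_0: "pover k p \<Longrightarrow> pm p = 0 \<longleftrightarrow> p = 0"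
  using pm_inj[of p 0] pm_0 pover_0 subfldD[OF sub(1)] by metis

lemma degree_pm: "pover k p \<Longrightarrow> degree (pm p) = degree p"
proof (rule antisym)
  show "degree (pm p) \<le> degree p"
    by (rule degree_le) (simp add: coeff_pm coeff_eq_0 zero)
  assume p: "pover k p"
  show "degree p \<le> degree (pm p)"
  proof (cases "p = 0")
    case False
    thus ?thesis using p by (intro le_degree) (simp add: coeff_pm eq_0 pover_def)
  qed simp
qed

lemma pm_add: "pover k p \<Longrightarrow> pover k q \<Longrightarrow> pm (p + q) = pm p + pm q"
  by (rule poly_eqI) (simp add: coeff_pm pover_def add)

lemma pm_diff: "pover k p \<Longrightarrow> pover k q \<Longrightarrow> pm (p - q) = pm p - pm q"
  by (rule poly_eqI) (simp add: coeff_pm pover_def diff)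

lemma pm_mult: "pover k p \<Longrightarrow> pover k q \<Longrightarrow> pm (p * q) = pm p * pm q"
  unfolding pover_def
  by (rule poly_eqI) (simp add: coeff_pm coeff_mult sum mult subfldD[OF sub(1)])

lemma pm_surj: "pover l q \<Longrightarrow> \<exists>p. pover k p \<and> pm p = q"
proof (induction q)
  case 0
  show ?case using pm_0 pover_0[of k] subfldD[OF sub(1)] by blast
next
  case (pCons b q)
  then obtain p where p: "pover k p" "pm p = q" by (auto simp: pover_pCons_iff)
  obtain a where "a \<in> k" "\<sigma> a = b" using pCons img by (auto simp: pover_pCons_iff)
  thus ?case using p by (intro exI[of _ "pCons a p"]) (simp add: pover_pCons_iff pm_pCons)
qed

end

text \<open>The simple extension m(a). Using quotients throughout treats algebraic and
  transcendental \<open>a\<close> alike.\<close>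

definition sext :: "'c::field set \<Rightarrow> 'c \<Rightarrow> 'c set" where
  "sext m a = {poly p a / poly q a | p q. pover m p \<and> pover m q \<and> poly q a \<noteq> 0}"

lemma sextI: "pover m p \<Longrightarrow> pover m q \<Longrightarrow> poly q a \<noteq> 0 \<Longrightarrow> poly p a / poly q a \<in> sext m a"
  unfolding sext_def by blast

lemma sextE:
  assumes "x \<in> sext m a"
  obtains p q where "pover m p" "pover m q" "poly q a \<noteq> 0" "x = poly p a / poly q a"
  using assms unfolding sext_def by blast

lemma pover_1: "subfld m \<Longrightarrow> pover m 1"
  using pover_const[of m 1] subfldD[of m] by (simp add: one_pCons)

lemma subfld_sext:
  assumes m: "subfld m" shows "subfld (sext m a)"
  unfolding subfld_def
proof (intro conjI ballI)
  show "0 \<in> sext m a" using sextI[of m 0 1 a] pover_0[of m] pover_1[OF m] subfldD[OF m] by simp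
  show "1 \<in> sext m a" using sextI[of m 1 1 a] pover_1[OF m] by simp
  fix x assume "x \<in> sext m a"
  then obtain p q where x: "pover m p" "pover m q" "poly q a \<noteq> 0" "x = poly p a / poly q a"
    by (rule sextE)
  show "- x \<in> sext m a"
    using sextI[of m "- p" q a] pover_uminus[OF m] x by simp
  show "inverse x \<in> sext m a"
  proof (cases "poly p a = 0")
    case True
    thus ?thesis using x sextI[of m 0 1 a] pover_0[of m] pover_1[OF m] subfldD[OF m] by simp
  next
    case False
    thus ?thesis using x sextI[of m q p a] by simp
  qed
  fix y assume "y \<in> sext m a"
  then obtain p' q' where y: "pover m p'" "pover m q'" "poly q' a \<noteq> 0" "y = poly p' a / poly q' a"
    by (rule sextE)
  show "x + y \<in> sext m a"
    using sextI[of m "p * q' + p' * q" "q * q'" a] x y m by (simp add: pover_add pover_mult add_frac_eq)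
  show "x * y \<in> sext m a"
    using sextI[of m "p * p'" "q * q'" a] x y m by (simp add: pover_mult)
qed

lemma sext_base: "subfld m \<Longrightarrow> m \<subseteq> sext m a"
proof
  fix x assume "subfld m" "x \<in> m"
  thus "x \<in> sext m a" using sextI[of m "[:x:]" 1 a] pover_1 pover_const by fastforce
qed

lemma sext_gen: "subfld m \<Longrightarrow> a \<in> sext m a"
  using sextI[of m "[:0, 1:]" 1 a] pover_1[of m] by (simp add: pover_pCons_iff pover_0 subfldD)

lemma sext_least:
  assumes "subfld n" "m \<subseteq> n" "a \<in> n" shows "sext m a \<subseteq> n"
proof
  fix x assume "x \<in> sext m a"
  then obtain p q where x: "pover m p" "pover m q" "x = poly p a / poly q a" by (rule sextE)
  thus "x \<in> n" using assms pover_mono[of m _ n]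
    by (auto intro!: subfldD(8)[OF assms(1)] poly_in_subfld)
qed

lemma gen_insert: "gen (insert a S) = sext (gen S) a"
proof
  show "gen (insert a S) \<subseteq> sext (gen S) a"
    using sext_base[OF subfld_gen, of S a] sext_gen[OF subfld_gen, of a S] gen_superset[of S]
    by (intro gen_least subfld_sext subfld_gen) auto
  show "sext (gen S) a \<subseteq> gen (insert a S)"
    using gen_mono[of S "insert a S"] gen_superset[of "insert a S"]
    by (intro sext_least subfld_gen) auto
qed

text \<open>The forward direction of the assumption makes "evaluate the transported fraction at
  \<open>b\<close>" well defined, the backward direction makes it injective.\<close>

lemma (in partial_iso) extend:
  assumes ab: "\<And>p. pover k p \<Longrightarrow> poly p a = 0 \<longleftrightarrow> poly (pm p) b = 0"
  obtains \<tau> where "piso (sext k a) (sext l b) \<tau>" "\<And>x. x \<in> k \<Longrightarrow> \<tau> x = \<sigma> x"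
proof -
  \<comment> \<open>The value is required to fit every representation of \<open>x\<close> at once,
    which packs well-definedness into the choice. Outside the extension the requirement is
    vacuous.\<close>
  have ex: "\<exists>y. \<forall>p q. pover k p \<longrightarrow> pover k q \<longrightarrow> poly q a \<noteq> 0 \<longrightarrow> x = poly p a / poly q a \<longrightarrow>
     y = poly (pm p) b / poly (pm q) b" for x
  proof (cases "x \<in> sext k a")
    case True
    then obtain p q where x: "pover k p" "pover k q" "poly q a \<noteq> 0" "x = poly p a / poly q a"
      by (rule sextE)
    have "poly (pm p) b / poly (pm q) b = poly (pm p') b / poly (pm q') b"
      if x': "pover k p'" "pover k q'" "poly q' a \<noteq> 0" "x = poly p' a / poly q' a" for p' q'
    proof -
      have "poly (p * q' - p' * q) a = 0" using x x' by (simp add: field_simps)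
      hence "poly (pm (p * q' - p' * q)) b = 0"
        using x x' by (subst ab[symmetric]) (auto intro!: pover_diff pover_mult sub)
      moreover have "pm (p * q' - p' * q) = pm p * pm q' - pm p' * pm q"
        using x x' by (simp add: pm_diff pm_mult pover_mult[OF sub(1)])
      moreover have "poly (pm q) b \<noteq> 0" "poly (pm q') b \<noteq> 0" using ab x x' by auto
      ultimately show ?thesis by (simp add: field_simps)
    qed
    thus ?thesis by blast
  next
    case False
    thus ?thesis using sextI by blast
  qed
  then obtain \<tau> where \<tau>: "\<And>p q. pover k p \<Longrightarrow> pover k q \<Longrightarrow> poly q a \<noteq> 0 \<Longrightarrow>
     \<tau> (poly p a / poly q a) = poly (pm p) b / poly (pm q) b"
    using choice[of "\<lambda>x y. \<forall>p q. pover k p \<longrightarrow> pover k q \<longrightarrow> poly q a \<noteq> 0 \<longrightarrow> x = poly p a / poly q a \<longrightarrow>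
     y = poly (pm p) b / poly (pm q) b"] by blast
  have ab': "poly (pm q) b \<noteq> 0 \<longleftrightarrow> poly q a \<noteq> 0" if "pover k q" for q using ab that by blast
  have "piso (sext k a) (sext l b) \<tau>" unfolding piso_def
  proof (intro conjI ballI subfld_sext sub)
    show "bij_betw \<tau> (sext k a) (sext l b)" unfolding bij_betw_def
    proof
      show "inj_on \<tau> (sext k a)"
      proof (rule inj_onI)
        fix x y assume "x \<in> sext k a" "y \<in> sext k a" and eq: "\<tau> x = \<tau> y"
        then obtain p q p' q' where x: "pover k p" "pover k q" "poly q a \<noteq> 0" "x = poly p a / poly q a"
          and y: "pover k p'" "pover k q'" "poly q' a \<noteq> 0" "y = poly p' a / poly q' a"
          by (elim sextE) blast
        have "poly (pm q) b \<noteq> 0" "poly (pm q') b \<noteq> 0" using ab' x y by auto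
        moreover have "poly (pm p) b / poly (pm q) b = poly (pm p') b / poly (pm q') b"
          using eq \<tau> x y by simp
        ultimately have "poly (pm p * pm q' - pm p' * pm q) b = 0" by (simp add: field_simps)
        moreover have "pm (p * q' - p' * q) = pm p * pm q' - pm p' * pm q"
          using x y by (simp add: pm_diff pm_mult pover_mult[OF sub(1)])
        ultimately have "poly (p * q' - p' * q) a = 0"
          using x y by (subst ab) (auto intro!: pover_diff pover_mult sub)
        hence "poly p a * poly q' a = poly p' a * poly q a" by simp
        thus "x = y" using x(3,4) y(3,4) by (simp add: frac_eq_eq)
      qed
      show "\<tau> ` sext k a = sext l b"
      proof (intro equalityI subsetI)
        fix z assume "z \<in> \<tau> ` sext k a"
        then obtain p q where x: "pover k p" "pover k q" "poly q a \<noteq> 0" "z = \<tau> (poly p a / poly q a)"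
          by (auto elim: sextE)
        thus "z \<in> sext l b" using \<tau> ab' by (auto intro!: sextI pover_pm)
      next
        fix z assume "z \<in> sext l b"
        then obtain p q where z: "pover l p" "pover l q" "poly q b \<noteq> 0" "z = poly p b / poly q b"
          by (rule sextE)
        obtain p' q' where "pover k p'" "pm p' = p" "pover k q'" "pm q' = q"
          using pm_surj z by blast
        moreover from this have "poly q' a \<noteq> 0" using ab' z by blast
        ultimately have "z = \<tau> (poly p' a / poly q' a)" "poly p' a / poly q' a \<in> sext k a"
          using \<tau> z by (auto intro: sextI)
        thus "z \<in> \<tau> ` sext k a" by blast
      qed
    qed
  next
    fix x y assume "x \<in> sext k a" "y \<in> sext k a"
    then obtain p q p' q' where x: "pover k p" "pover k q" "poly q a \<noteq> 0" "x = poly p a / poly q a"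
      and y: "pover k p'" "pover k q'" "poly q' a \<noteq> 0" "y = poly p' a / poly q' a"
      by (elim sextE) blast
    have nz: "poly (pm q) b \<noteq> 0" "poly (pm q') b \<noteq> 0" using ab' x y by auto
    have "x + y = poly (p * q' + p' * q) a / poly (q * q') a" using x y by (simp add: add_frac_eq)
    also have "\<tau> \<dots> = poly (pm (p * q' + p' * q)) b / poly (pm (q * q')) b"
      using x y by (intro \<tau>) (auto intro!: pover_add pover_mult sub)
    also have "\<dots> = \<tau> x + \<tau> y"
      using x y nz by (simp add: \<tau> pm_add pm_mult pover_mult[OF sub(1)] add_frac_eq)
    finally show "\<tau> (x + y) = \<tau> x + \<tau> y" .
    have "x * y = poly (p * p') a / poly (q * q') a" using x y by simp
    also have "\<tau> \<dots> = poly (pm (p * p')) b / poly (pm (q * q')) b"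
      using x y by (intro \<tau>) (auto intro!: pover_mult sub)
    also have "\<dots> = \<tau> x * \<tau> y" using x y by (simp add: \<tau> pm_mult)
    finally show "\<tau> (x * y) = \<tau> x * \<tau> y" .
  qed
  moreover have "\<tau> x = \<sigma> x" if "x \<in> k" for x
  proof -
    have "pm 1 = 1" by (rule poly_eqI) (simp add: coeff_pm one zero)
    thus ?thesis using \<tau>[of "[:x:]" 1] pover_const[OF sub(1) that] pover_1[OF sub(1)]
      by (simp add: pm_pCons pm_0)
  qed
  ultimately show ?thesis using that by blast
qed

text \<open>Being contained in a finitely generated field, rather than being one, is enough to leave
  room for transcendental elements.\<close>

definition small :: "'a::field set \<Rightarrow> bool" where
  "small k \<longleftrightarrow> (\<exists>S. finite S \<and> k \<subseteq> gen S)"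

lemma small_sext: "small k \<Longrightarrow> small (sext k a)"
proof -
  assume "small k"
  then obtain S where S: "finite S" "k \<subseteq> gen S" unfolding small_def by blast
  have "sext k a \<subseteq> gen (insert a S)"
    using S gen_mono[of S "insert a S"] gen_superset[of "insert a S"]
    by (intro sext_least subfld_gen) auto
  thus ?thesis using S unfolding small_def by blast
qed

text \<open>Infinite transcendence degree in the form that the game consumes: nothing finite
  exhausts the field algebraically.\<close>

definition inf_tr :: "'a::field itself \<Rightarrow> bool" where
  "inf_tr _ \<longleftrightarrow> (\<forall>S::'a set. finite S \<longrightarrow> (\<exists>x. \<not> algb (gen S) x))"

text \<open>If \<open>a\<close> is transcendental over \<open>k\<close>, any element transcendental
  over \<open>l\<close> will do, and \<open>inf_tr\<close> supplies one. If \<open>a\<close> is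
  algebraic, a root of the transported minimal polynomial is taken.\<close>

lemma ex_conjugate:
  fixes l :: "'b::alg_closed_field set"
  assumes "piso k l \<sigma>" and inf: "inf_tr TYPE('b)" and "small l"
  shows "\<exists>b. \<forall>p. pover k p \<longrightarrow> (poly p a = 0 \<longleftrightarrow> poly (map_poly \<sigma> p) b = 0)"
proof -
  interpret partial_iso k l \<sigma> by unfold_locales (rule assms(1))
  note pm_def[symmetric, simp]
  show ?thesis
  proof (cases "algb k a")
    case False
    obtain S where S: "finite S" "l \<subseteq> gen S" using assms(3) unfolding small_def by blast
    then obtain b where "\<not> algb (gen S) b" using inf unfolding inf_tr_def by blast
    hence b: "\<not> algb l b" using S algb_mono by blast
    have "poly p a = 0 \<longleftrightarrow> poly (pm p) b = 0" if p: "pover k p" for p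
    proof (cases "p = 0")
      case True
      thus ?thesis by (simp add: pm_0)
    next
      case nz: False
      have "poly p a \<noteq> 0" using False p nz unfolding algb_def by blast
      moreover have "poly (pm p) b \<noteq> 0"
        using b pover_pm[OF p] pm_eq_0[OF p] nz unfolding algb_def by blast
      ultimately show ?thesis by simp
    qed
    thus ?thesis by auto
  next
    case True
    obtain m where m: "pover k m" "m \<noteq> 0" "poly m a = 0"
      and mdvd: "\<And>p. pover k p \<Longrightarrow> poly p a = 0 \<Longrightarrow> \<exists>s. pover k s \<and> p = m * s"
      and mmin: "\<And>p. pover k p \<Longrightarrow> p \<noteq> 0 \<Longrightarrow> poly p a = 0 \<Longrightarrow> degree m \<le> degree p"
      using minimal_poly[OF sub(1) True] by metis
    have "degree m \<noteq> 0"
    proof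
      assume "degree m = 0"
      then obtain c where "m = [:c:]" by (rule degree_eq_zeroE)
      thus False using m by simp
    qed
    hence "degree (pm m) > 0" using degree_pm[OF m(1)] by simp
    then obtain b where b: "poly (pm m) b = 0" using alg_closed_imp_poly_has_root by blast
    have nz: "pm m \<noteq> 0" using pm_eq_0 m by blast
    have "algb l b" unfolding algb_def using b nz pover_pm[OF m(1)] by blast
    \<comment> \<open>Irreducibility of the transported polynomial is not proved as such: the
      minimal polynomial \<open>n\<close> of \<open>b\<close> is pulled back to a factor of
      \<open>m\<close>. The complementary factor has smaller degree than \<open>m\<close>, so it is
      \<open>n'\<close> that vanishes at \<open>a\<close>.\<close>
    then obtain n where n: "pover l n" "n \<noteq> 0" "poly n b = 0"
      and ndvd: "\<And>p. pover l p \<Longrightarrow> poly p b = 0 \<Longrightarrow> \<exists>s. pover l s \<and> p = n * s"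
      using minimal_poly[OF sub(2)] by metis
    obtain s where s: "pover l s" "pm m = n * s" using ndvd[OF pover_pm[OF m(1)] b] by blast
    obtain n' s' where ns: "pover k n'" "pm n' = n" "pover k s'" "pm s' = s" using pm_surj n s by metis
    have ms: "m = n' * s'"
      using s(2) ns pm_mult[of n' s'] pm_inj[of m "n' * s'"] m(1) pover_mult[OF sub(1)] by metis
    hence ns0: "n' \<noteq> 0" "s' \<noteq> 0" using m by auto
    have "degree n' > 0"
    proof (rule ccontr)
      assume "\<not> ?thesis"
      then obtain c where c: "n' = [:c:]" by (auto elim: degree_eq_zeroE)
      hence "n = [:\<sigma> c:]" using ns by (simp add: pm_pCons pm_0)
      thus False using n by simp
    qed
    hence "degree s' < degree m" unfolding ms using ns0 by (simp add: degree_mult_eq)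
    hence "poly s' a \<noteq> 0" using mmin[of s'] ns ns0 by fastforce
    hence "poly n' a = 0" using m(3) unfolding ms by simp
    have "poly p a = 0 \<longleftrightarrow> poly (pm p) b = 0" if p: "pover k p" for p
    proof
      assume "poly p a = 0"
      then obtain t where "pover k t" "p = m * t" using mdvd p by blast
      thus "poly (pm p) b = 0" using pm_mult[of m t] m b by simp
    next
      assume "poly (pm p) b = 0"
      then obtain t where t: "pover l t" "pm p = n * t" using ndvd pover_pm[OF p] by blast
      then obtain t' where t': "pover k t'" "pm t' = t" using pm_surj by blast
      have "p = n' * t'"
        using t t' ns pm_mult[of n' t'] pm_inj[of p "n' * t'"] p pover_mult[OF sub(1)] by metis
      thus "poly p a = 0" using \<open>poly n' a = 0\<close> by simp
    qed
    thus ?thesis by auto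
  qed
qed

definition extends :: "'a set \<Rightarrow> ('a \<Rightarrow> 'b) \<Rightarrow> 'a set \<Rightarrow> ('a \<Rightarrow> 'b) \<Rightarrow> bool" where
  "extends k \<sigma> k' \<sigma>' \<longleftrightarrow> k \<subseteq> k' \<and> (\<forall>x\<in>k. \<sigma>' x = \<sigma> x)"

definition fpiso :: "'a::field set \<Rightarrow> 'b::field set \<Rightarrow> ('a \<Rightarrow> 'b) \<Rightarrow> bool" where
  "fpiso k l \<sigma> \<longleftrightarrow> piso k l \<sigma> \<and> small k \<and> small l"

lemma forth:
  fixes l :: "'b::alg_closed_field set"
  assumes inf: "inf_tr TYPE('b)" and "finite A" "fpiso k l \<sigma>"
  shows "\<exists>k' l' \<sigma>'. fpiso k' l' \<sigma>' \<and> extends k \<sigma> k' \<sigma>' \<and> A \<subseteq> k'"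
  using assms(2)
proof (induction A)
  case empty
  show ?case using assms(3) unfolding extends_def by blast
next
  case (insert a A)
  then obtain k' l' \<sigma>' where IH: "fpiso k' l' \<sigma>'" "extends k \<sigma> k' \<sigma>'" "A \<subseteq> k'" by blast
  interpret partial_iso k' l' \<sigma>' by unfold_locales (use IH in \<open>simp add: fpiso_def\<close>)
  obtain b where "\<And>p. pover k' p \<Longrightarrow> poly p a = 0 \<longleftrightarrow> poly (pm p) b = 0"
    using ex_conjugate[OF piso inf] IH unfolding fpiso_def pm_def by blast
  from extend[OF this] obtain \<tau> where \<tau>: "piso (sext k' a) (sext l' b) \<tau>" "\<And>x. x \<in> k' \<Longrightarrow> \<tau> x = \<sigma>' x"
    by metis
  show ?case
    using \<tau> IH small_sext[of k' a] small_sext[of l' b] sext_base[OF sub(1), of a] sext_gen[OF sub(1), of a]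
    by (intro exI[of _ "sext k' a"] exI[of _ "sext l' b"] exI[of _ \<tau>])
      (auto simp: fpiso_def extends_def)
qed

lemma piso_inv: "piso k l \<sigma> \<Longrightarrow> piso l k (inv_into k \<sigma>)"
proof -
  assume "piso k l \<sigma>"
  then interpret partial_iso k l \<sigma> by unfold_locales
  have *: "inv_into k \<sigma> (\<sigma> x) = x" if "x \<in> k" for x
    using that inj by (intro inv_into_f_f) (auto simp: inj_on_def)
  show ?thesis unfolding piso_def
  proof (intro conjI sub ballI)
    show "bij_betw (inv_into k \<sigma>) l k" using piso by (auto simp: piso_def intro: bij_betw_inv_into)
    fix x y assume "x \<in> l" "y \<in> l"
    then obtain a b where ab: "a \<in> k" "b \<in> k" "x = \<sigma> a" "y = \<sigma> b" using img by blast
    show "inv_into k \<sigma> (x + y) = inv_into k \<sigma> x + inv_into k \<sigma> y"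
      unfolding ab using add[OF ab(1,2)] ab(1,2) * subfldD(3)[OF sub(1)] by metis
    show "inv_into k \<sigma> (x * y) = inv_into k \<sigma> x * inv_into k \<sigma> y"
      unfolding ab using mult[OF ab(1,2)] ab(1,2) * subfldD(4)[OF sub(1)] by metis
  qed
qed

lemma fpiso_inv: "fpiso k l \<sigma> \<Longrightarrow> fpiso l k (inv_into k \<sigma>)"
  by (simp add: fpiso_def piso_inv)

lemma piso_inv_cancel:
  assumes "piso k l \<sigma>"
  shows "x \<in> k \<Longrightarrow> inv_into k \<sigma> (\<sigma> x) = x" "y \<in> l \<Longrightarrow> \<sigma> (inv_into k \<sigma> y) = y"
    "x \<in> k \<Longrightarrow> \<sigma> x \<in> l" "y \<in> l \<Longrightarrow> inv_into k \<sigma> y \<in> k"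
  using assms by (auto simp: piso_def bij_betw_def inv_into_into f_inv_into_f)

lemma extends_inv:
  assumes p: "piso k l \<sigma>" "piso l' k' \<tau>" and e: "extends l (inv_into k \<sigma>) l' \<tau>"
  shows "extends k \<sigma> k' (inv_into l' \<tau>)"
  unfolding extends_def
proof (intro conjI ballI subsetI)
  fix x assume x: "x \<in> k"
  have s: "\<sigma> x \<in> l" "\<sigma> x \<in> l'" using piso_inv_cancel[OF p(1)] x e by (auto simp: extends_def)
  have \<tau>: "\<tau> (\<sigma> x) = x" using e s(1) piso_inv_cancel(1)[OF p(1) x] by (simp add: extends_def)
  thus "x \<in> k'" using piso_inv_cancel(3)[OF p(2) s(2)] by simp
  show "inv_into l' \<tau> x = \<sigma> x" using piso_inv_cancel(1)[OF p(2) s(2)] \<tau> by simp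
qed

lemma forth_inv:
  fixes k :: "'a::alg_closed_field set"
  assumes inf: "inf_tr TYPE('a)" and "finite B" and f: "fpiso k l \<sigma>"
  shows "\<exists>k' l' \<sigma>'. fpiso k' l' \<sigma>' \<and> extends k \<sigma> k' \<sigma>' \<and> B \<subseteq> l'"
proof -
  obtain l' k' \<tau> where *: "fpiso l' k' \<tau>" "extends l (inv_into k \<sigma>) l' \<tau>" "B \<subseteq> l'"
    using forth[OF inf assms(2) fpiso_inv[OF f]] by blast
  have "extends k \<sigma> k' (inv_into l' \<tau>)"
    by (rule extends_inv[OF _ _ *(2)]) (use f * in \<open>auto simp: fpiso_def\<close>)
  thus ?thesis using * fpiso_inv by blast
qed

lemma Rats_le_subfld:
  assumes k: "subfld (k :: 'a::field_char_0 set)" shows "\<rat> \<subseteq> k"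
proof
  have nat: "of_nat n \<in> k" for n by (induction n) (auto simp: subfldD[OF k])
  have int: "of_int z \<in> k" for z
    by (cases z rule: int_diff_cases) (auto simp: subfldD[OF k] nat)
  fix x :: 'a assume "x \<in> \<rat>"
  then obtain q where x: "x = of_rat q" by (auto simp: Rats_def)
  obtain a b where "quotient_of q = (a, b)" by (cases "quotient_of q")
  hence "q = of_int a / of_int b" by (rule quotient_of_div)
  thus "x \<in> k" unfolding x by (simp add: of_rat_divide int subfldD[OF k])
qed

lemma subfld_Rats: "subfld (\<rat> :: 'a::field_char_0 set)"
  by (auto simp: subfld_def)

text \<open>The opening position of the game: the two prime fields are identified.\<close>

lemma prime_piso: "\<exists>\<sigma> :: 'a::field_char_0 \<Rightarrow> 'b::field_char_0. fpiso \<rat> \<rat> \<sigma>"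
proof
  let ?\<sigma> = "\<lambda>x::'a. of_rat (inv of_rat x) :: 'b"
  have inj: "inj (of_rat :: rat \<Rightarrow> 'a)" by (simp add: inj_def)
  have *: "?\<sigma> (of_rat q) = of_rat q" for q by (simp add: inv_f_f[OF inj])
  have "bij_betw ?\<sigma> \<rat> \<rat>" unfolding bij_betw_def
  proof
    show "inj_on ?\<sigma> \<rat>" by (rule inj_onI) (auto simp: Rats_def inv_f_f[OF inj])
    show "?\<sigma> ` \<rat> = \<rat>" by (auto simp: Rats_def image_image *)
  qed
  moreover have "?\<sigma> (x + y) = ?\<sigma> x + ?\<sigma> y \<and> ?\<sigma> (x * y) = ?\<sigma> x * ?\<sigma> y" if xy: "x \<in> \<rat>" "y \<in> \<rat>" for x y
  proof -
    obtain p q where "x = of_rat p" "y = of_rat q" using xy by (auto simp: Rats_def)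
    thus ?thesis using *[of p] *[of q] *[of "p + q"] *[of "p * q"] by (simp add: of_rat_add of_rat_mult)
  qed
  moreover have "small (\<rat> :: 'a set)" "small (\<rat> :: 'b set)" unfolding small_def
    by (auto intro!: exI[of _ "{}"] Rats_le_subfld subfld_gen)
  ultimately show "fpiso \<rat> \<rat> ?\<sigma>" by (auto simp: fpiso_def piso_def subfld_Rats)
qed

lemma distinct3_123 [simp]: "distinct3 1 2 3"
  by (simp add: distinct3_def)

section \<open>The back-and-forth system of subvarieties\<close>

definition mapv :: "('a \<Rightarrow> 'b) \<Rightarrow> 'a ^ 'n \<Rightarrow> 'b ^ 'n" where
  "mapv f v = (\<chi> i. f (v $ i))"

lemma mapv_nth [simp]: "mapv f v $ i = f (v $ i)"
  by (simp add: mapv_def)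

definition vover :: "'a set \<Rightarrow> 'a ^ 'n \<Rightarrow> bool" where
  "vover k v \<longleftrightarrow> (\<forall>i. v $ i \<in> k)"

definition cover :: "nat \<Rightarrow> 'a set \<Rightarrow> (nat \<Rightarrow> nat \<Rightarrow> 'a) \<Rightarrow> bool" where
  "cover d k c \<longleftrightarrow> (\<forall>(a, b)\<in>tri d. c a b \<in> k)"

lemma coverD: "cover d k c \<Longrightarrow> a + b \<le> d \<Longrightarrow> c a b \<in> k"
  unfolding cover_def by (auto dest: bspec[of _ _ "(a, b)"])

abbreviation fm :: "nat \<Rightarrow> (nat \<Rightarrow> nat \<Rightarrow> 'a::field) \<Rightarrow> 'a ^ 3 \<Rightarrow> 'a" where
  "fm \<equiv> form3 1 2 3"

lemma is_form_fm: "is_form d (fm d c)"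
  by (rule is_form_form3) simp

lemma fm_map:
  assumes "piso k l \<sigma>" "cover d k c" "vover k v"
  shows "fm d (\<lambda>a b. \<sigma> (c a b)) (mapv \<sigma> v) = \<sigma> (fm d c v)" "fm d c v \<in> k"
proof -
  interpret partial_iso k l \<sigma> by unfold_locales (rule assms)
  note k = subfldD[OF sub(1)]
  have v: "v $ i \<in> k" for i using assms by (auto simp: vover_def)
  have c: "c a b \<in> k" if "(a, b) \<in> tri d" for a b using assms that by (auto simp: cover_def)
  have m: "c a b * (v $ 1 ^ a * v $ 2 ^ b * v $ 3 ^ e) \<in> k" if "(a, b) \<in> tri d" for a b e
    by (intro k(4) k(9) v c that)
  show "fm d c v \<in> k" unfolding form3_def
    by (rule subfld_sum[OF sub(1)]) (use m in auto)
  have "\<sigma> (fm d c v) = (\<Sum>z\<in>tri d. \<sigma> (case z of (a, b) \<Rightarrow> c a b * (v $ 1 ^ a * v $ 2 ^ b * v $ 3 ^ (d - a - b))))"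
    unfolding form3_def by (rule sum) (use m in auto)
  also have "\<dots> = fm d (\<lambda>a b. \<sigma> (c a b)) (mapv \<sigma> v)"
    unfolding form3_def
  proof (intro sum.cong refl, clarify)
    fix a b assume ab: "(a, b) \<in> tri d"
    show "\<sigma> (c a b * (v $ 1 ^ a * v $ 2 ^ b * v $ 3 ^ (d - a - b))) =
       \<sigma> (c a b) * (mapv \<sigma> v $ 1 ^ a * mapv \<sigma> v $ 2 ^ b * mapv \<sigma> v $ 3 ^ (d - a - b))"
      by (simp add: mult power k(4) k(9) v c[OF ab])
  qed
  finally show "fm d (\<lambda>a b. \<sigma> (c a b)) (mapv \<sigma> v) = \<sigma> (fm d c v)" ..
qed

lemma mapv_eq_0: "piso k l \<sigma> \<Longrightarrow> vover k v \<Longrightarrow> mapv \<sigma> v = 0 \<longleftrightarrow> v = 0"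
proof -
  assume "piso k l \<sigma>" and v: "vover k v"
  then interpret partial_iso k l \<sigma> by unfold_locales
  show ?thesis using v by (simp add: vec_eq_iff vover_def eq_0)
qed

lemma vover_map: "piso k l \<sigma> \<Longrightarrow> vover k v \<Longrightarrow> vover l (mapv \<sigma> v)"
  by (auto simp: vover_def dest: piso_inv_cancel(3))

text \<open>Only the defining data correspond; neither side is required to lie in
  \<open>Var\<close>. That irreducibility is carried over is a theorem,
  \<open>vrel_Var\<close>.\<close>

definition vrel :: "'a::field set \<Rightarrow> ('a \<Rightarrow> 'b::field) \<Rightarrow> ('a ^ 3) set set \<Rightarrow> ('b ^ 3) set set \<Rightarrow> bool" where
  "vrel k \<sigma> V W \<longleftrightarrow>
     (\<exists>v. v \<noteq> 0 \<and> vover k v \<and> V = {cls v} \<and> W = {cls (mapv \<sigma> v)}) \<or>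
     (\<exists>d c. cover d k c \<and> V = zset (fm d c) \<and> W = zset (fm d (\<lambda>a b. \<sigma> (c a b))))"

lemma zset_fm_cong: "(\<And>a b. (a, b) \<in> tri d \<Longrightarrow> c a b = c' a b) \<Longrightarrow> zset (fm d c) = zset (fm d c')"
proof -
  assume "\<And>a b. (a, b) \<in> tri d \<Longrightarrow> c a b = c' a b"
  hence "fm d c = fm d c'" unfolding form3_def by (intro ext sum.cong) auto
  thus ?thesis by simp
qed

lemma mapv_cong: "(\<And>i. f (v $ i) = g (v $ i)) \<Longrightarrow> mapv f v = mapv g v"
  by (simp add: mapv_def)

lemma vrel_extends:
  assumes "vrel k \<sigma> V W" "extends k \<sigma> k' \<sigma>'"
  shows "vrel k' \<sigma>' V W"
  using assms(1) unfolding vrel_def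
proof (elim disjE exE conjE)
  fix v assume v: "v \<noteq> 0" "vover k v" "V = {cls v}" "W = {cls (mapv \<sigma> v)}"
  hence "vover k' v" "mapv \<sigma> v = mapv \<sigma>' v"
    using assms(2) by (auto simp: vover_def extends_def intro!: mapv_cong)
  thus "(\<exists>v. v \<noteq> 0 \<and> vover k' v \<and> V = {cls v} \<and> W = {cls (mapv \<sigma>' v)}) \<or>
     (\<exists>d c. cover d k' c \<and> V = zset (fm d c) \<and> W = zset (fm d (\<lambda>a b. \<sigma>' (c a b))))"
    using v by auto
next
  fix d c assume c: "cover d k c" "V = zset (fm d c)" "W = zset (fm d (\<lambda>a b. \<sigma> (c a b)))"
  have "cover d k' c" using c assms(2) by (auto simp: cover_def extends_def)
  moreover have "W = zset (fm d (\<lambda>a b. \<sigma>' (c a b)))"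
    unfolding c(3) using coverD[OF c(1)] assms(2) by (intro zset_fm_cong) (auto simp: extends_def)
  ultimately show "(\<exists>v. v \<noteq> 0 \<and> vover k' v \<and> V = {cls v} \<and> W = {cls (mapv \<sigma>' v)}) \<or>
     (\<exists>d c. cover d k' c \<and> V = zset (fm d c) \<and> W = zset (fm d (\<lambda>a b. \<sigma>' (c a b))))"
    using c by blast
qed

lemma vrel_inv:
  assumes \<sigma>: "piso k l \<sigma>" and "vrel k \<sigma> V W"
  shows "vrel l (inv_into k \<sigma>) W V"
  using assms(2) unfolding vrel_def
proof (elim disjE exE conjE)
  fix v assume v: "v \<noteq> 0" "vover k v" "V = {cls v}" "W = {cls (mapv \<sigma> v)}"
  have "mapv (inv_into k \<sigma>) (mapv \<sigma> v) = v"
    using v(2) piso_inv_cancel(1)[OF \<sigma>] by (simp add: vec_eq_iff vover_def)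
  thus "(\<exists>v. v \<noteq> 0 \<and> vover l v \<and> W = {cls v} \<and> V = {cls (mapv (inv_into k \<sigma>) v)}) \<or>
     (\<exists>d c. cover d l c \<and> W = zset (fm d c) \<and> V = zset (fm d (\<lambda>a b. inv_into k \<sigma> (c a b))))"
    using v mapv_eq_0[OF \<sigma> v(2)] vover_map[OF \<sigma> v(2)] by metis
next
  fix d c assume c: "cover d k c" "V = zset (fm d c)" "W = zset (fm d (\<lambda>a b. \<sigma> (c a b)))"
  have "cover d l (\<lambda>a b. \<sigma> (c a b))" using c(1) piso_inv_cancel(3)[OF \<sigma>] by (auto simp: cover_def)
  moreover have "V = zset (fm d (\<lambda>a b. inv_into k \<sigma> (\<sigma> (c a b))))"
    unfolding c(2) using coverD[OF c(1)] piso_inv_cancel(1)[OF \<sigma>] by (intro zset_fm_cong) auto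
  ultimately show "(\<exists>v. v \<noteq> 0 \<and> vover l v \<and> W = {cls v} \<and> V = {cls (mapv (inv_into k \<sigma>) v)}) \<or>
     (\<exists>d c. cover d l c \<and> W = zset (fm d c) \<and> V = zset (fm d (\<lambda>a b. inv_into k \<sigma> (c a b))))"
    using c(3) by blast
qed

text \<open>Incidence with a point whose coordinates lie in \<open>k\<close> is an equation over
  \<open>k\<close>, and the isomorphism preserves equations.\<close>

lemma vrel_mem:
  assumes \<sigma>: "piso k l \<sigma>" and "vrel k \<sigma> V W" and w: "vover k w" "w \<noteq> 0"
  shows "cls w \<in> V \<longleftrightarrow> cls (mapv \<sigma> w) \<in> W"
proof -
  interpret partial_iso k l \<sigma> by unfold_locales (rule assms)
  have \<sigma>w: "mapv \<sigma> w \<noteq> 0" using mapv_eq_0[OF \<sigma>] w by blast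
  show ?thesis using assms(2) unfolding vrel_def
  proof (elim disjE exE conjE)
    fix v assume v: "v \<noteq> 0" "vover k v" "V = {cls v}" "W = {cls (mapv \<sigma> v)}"
    have \<sigma>v: "mapv \<sigma> v \<noteq> 0" using mapv_eq_0[OF \<sigma>] v by blast
    have vk: "v $ i \<in> k" "w $ i \<in> k" for i using v w by (auto simp: vover_def)
    obtain i where i: "v $ i \<noteq> 0" using v(1) by (metis vec_eq_iff zero_index)
    \<comment> \<open>Dividing by a fixed nonzero coordinate eliminates the unknown factor of
      proportionality, so that equality of points becomes a system of equations within
      \<open>k\<close>.\<close>
    have *: "cls v = cls w \<longleftrightarrow> w = (w $ i / v $ i) *s v"
      if nz: "v \<noteq> 0" "w \<noteq> 0" "v $ i \<noteq> 0" for v w :: "'c::field ^ 3"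
    proof
      assume "w = (w $ i / v $ i) *s v"
      moreover from this nz have "w $ i / v $ i \<noteq> 0" by (metis vector_smult_lzero)
      ultimately show "cls v = cls w" using cls_eq_iff[OF nz(1,2)] by blast
    next
      assume "cls v = cls w"
      then obtain c where "w = c *s v" using cls_eq_iff[OF nz(1,2)] by blast
      thus "w = (w $ i / v $ i) *s v" using nz(3) by simp
    qed
    have "cls w \<in> V \<longleftrightarrow> cls v = cls w" unfolding v(3) by blast
    also have "\<dots> \<longleftrightarrow> w = (w $ i / v $ i) *s v" by (rule *[OF v(1) w(2) i])
    also have "\<dots> \<longleftrightarrow> (\<forall>j. w $ j = w $ i / v $ i * v $ j)" by (simp add: vec_eq_iff)
    also have "\<dots> \<longleftrightarrow> (\<forall>j. \<sigma> (w $ j) = \<sigma> (w $ i / v $ i * v $ j))"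
      using vk by (simp add: inj subfldD[OF sub(1)])
    also have "\<dots> \<longleftrightarrow> mapv \<sigma> w = (mapv \<sigma> w $ i / mapv \<sigma> v $ i) *s mapv \<sigma> v"
      using vk by (simp add: vec_eq_iff mult divide subfldD[OF sub(1)])
    also have "\<dots> \<longleftrightarrow> cls (mapv \<sigma> v) = cls (mapv \<sigma> w)"
      by (rule *[OF \<sigma>v \<sigma>w, symmetric]) (use i vk eq_0 in simp)
    also have "\<dots> \<longleftrightarrow> cls (mapv \<sigma> w) \<in> W" unfolding v(4) by blast
    finally show ?thesis .
  next
    fix d c assume c: "cover d k c" "V = zset (fm d c)" "W = zset (fm d (\<lambda>a b. \<sigma> (c a b)))"
    show ?thesis
      unfolding c(2,3) cls_in_zset[OF is_form_fm w(2)] cls_in_zset[OF is_form_fm \<sigma>w]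
      using fm_map[OF \<sigma> c(1) w(1)] eq_0 by simp
  qed
qed

lemma vrel_plane: "piso k l \<sigma> \<Longrightarrow> vrel k \<sigma> V W \<Longrightarrow> V \<subseteq> proj_plane \<and> W \<subseteq> proj_plane"
  unfolding vrel_def
proof (elim disjE exE conjE)
  fix v assume "piso k l \<sigma>" "v \<noteq> 0" "vover k v" "V = {cls v}" "W = {cls (mapv \<sigma> v)}"
  thus ?thesis using cls_in_plane[of v] cls_in_plane[of "mapv \<sigma> v"] mapv_eq_0 by blast
qed (simp add: zset_plane)

lemma finite_coords: "finite (range (($) (v :: 'a ^ 'n)))"
  by simp

lemma finite_coeffs: "finite ((\<lambda>(a, b). c a b) ` tri d)"
  by simp

lemma vover_iff: "vover k v \<longleftrightarrow> range (($) v) \<subseteq> k"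
  by (auto simp: vover_def)

lemma cover_iff: "cover d k c \<longleftrightarrow> (\<lambda>(a, b). c a b) ` tri d \<subseteq> k"
  by (auto simp: cover_def)

lemma fpiso_piso: "fpiso k l \<sigma> \<Longrightarrow> piso k l \<sigma>"
  by (simp add: fpiso_def)

text \<open>A point of \<open>W\<close> need not have coordinates in \<open>l\<close>. The
  isomorphism is first extended so that it does, then the point is pulled back and tested in
  \<open>V\<close>.\<close>

lemma vrel_subset1:
  fixes k :: "'a::alg_closed_field set" and l :: "'b::alg_closed_field set"
  assumes inf: "inf_tr TYPE('a)" and f: "fpiso k l \<sigma>"
    and r: "vrel k \<sigma> V W" "vrel k \<sigma> V' W'" and sub: "V \<subseteq> V'"
  shows "W \<subseteq> W'"
proof
  fix Q assume Q: "Q \<in> W"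
  hence "Q \<in> proj_plane" using vrel_plane[OF fpiso_piso[OF f] r(1)] by blast
  then obtain w where w: "w \<noteq> 0" "Q = cls w" by (rule planeE)
  obtain k' l' \<sigma>' where e: "fpiso k' l' \<sigma>'" "extends k \<sigma> k' \<sigma>'" "range (($) w) \<subseteq> l'"
    using forth_inv[OF inf finite_coords f] by blast
  note p = fpiso_piso[OF e(1)]
  define v where "v = mapv (inv_into k' \<sigma>') w"
  have v: "vover k' v" "v \<noteq> 0" "mapv \<sigma>' v = w"
    using vover_map[OF piso_inv[OF p], of w] mapv_eq_0[OF piso_inv[OF p], of w] e(3) w(1)
      piso_inv_cancel(2)[OF p] unfolding v_def vover_iff by (auto simp: vec_eq_iff)
  have "cls v \<in> V" using vrel_mem[OF p vrel_extends[OF r(1) e(2)] v(1,2)] Q w v(3) by simp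
  hence "cls v \<in> V'" using sub by blast
  thus "Q \<in> W'" using vrel_mem[OF p vrel_extends[OF r(2) e(2)] v(1,2)] w v(3) by simp
qed

lemma vrel_subset:
  fixes k :: "'a::alg_closed_field set" and l :: "'b::alg_closed_field set"
  assumes inf: "inf_tr TYPE('a)" "inf_tr TYPE('b)" and f: "fpiso k l \<sigma>"
    and r: "vrel k \<sigma> V W" "vrel k \<sigma> V' W'"
  shows "V \<subseteq> V' \<longleftrightarrow> W \<subseteq> W'"
  using vrel_subset1[OF inf(1) f r] vrel_subset1[OF inf(2) fpiso_inv[OF f]
      vrel_inv[OF fpiso_piso[OF f] r(1)] vrel_inv[OF fpiso_piso[OF f] r(2)]] by blast

lemma vanish_point: "is_form d F \<Longrightarrow> v \<noteq> 0 \<Longrightarrow> vanish F {cls v} \<longleftrightarrow> F v = 0"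
proof -
  assume F: "is_form d F" and v: "v \<noteq> 0"
  have "F w = 0" if w: "F v = 0" "w \<noteq> 0" "cls w = cls v" for w
  proof -
    obtain c where "w = c *s v" using cls_eq_iff[OF v w(2)] w(3) by auto
    thus ?thesis using w(1) by (simp add: form_scale[OF F])
  qed
  thus ?thesis using v unfolding vanish_def by blast
qed

lemma point_in_Var:
  fixes v :: "'a::field ^ 3"
  assumes v: "v \<noteq> 0"
  shows "{cls v} \<in> Var"
  unfolding Var_iff
proof (intro conjI allI impI)
  obtain i where i: "v $ i \<noteq> 0" using v by (metis vec_eq_iff zero_index)
  show "zariski_closed {cls v}" unfolding closed_iff
  proof (intro conjI allI impI)
    show "{cls v} \<subseteq> proj_plane" using v cls_in_plane by blast
    fix w :: "'a ^ 3" assume w: "w \<noteq> 0" "cls w \<notin> {cls v}"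
    \<comment> \<open>A point is cut out by the 2 by 2 minors of its coordinate vector with a
      variable one.\<close>
    have "\<exists>j. v $ i * w $ j - v $ j * w $ i \<noteq> 0"
    proof (rule ccontr)
      assume "\<not> ?thesis"
      hence *: "w = (w $ i / v $ i) *s v" using i by (simp add: vec_eq_iff field_simps)
      moreover from this w(1) have "w $ i / v $ i \<noteq> 0" by (metis vector_smult_lzero)
      ultimately show False using cls_eq_iff[OF v w(1)] w(2) by blast
    qed
    then obtain j where j: "v $ i * w $ j - v $ j * w $ i \<noteq> 0" by blast
    have F: "is_form 1 (\<lambda>u. v $ i * u $ j - v $ j * u $ i)"
      by (intro is_form_diff is_form_cmult is_form_coord)
    have "vanish (\<lambda>u. v $ i * u $ j - v $ j * u $ i) {cls v}"
      unfolding vanish_point[OF F v] by simp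
    thus "\<exists>d F. is_form d F \<and> vanish F {cls v} \<and> F w \<noteq> 0" using F j by blast
  qed
  obtain j k where D: "distinct3 i j k" using ex_distinct3 by blast
  have "vec3 i j k 0 1 0 \<noteq> (0 :: 'a ^ 3)" by (simp add: vec3_eq_0_iff[OF D])
  moreover have "cls (vec3 i j k 0 1 0) \<noteq> cls v"
  proof
    assume "cls (vec3 i j k 0 1 0) = cls v"
    then obtain c where "v = c *s vec3 i j k 0 1 0"
      using cls_eq_iff[OF \<open>vec3 i j k 0 1 0 \<noteq> 0\<close> v] by blast
    thus False using i by (simp add: vec3_nth[OF D])
  qed
  ultimately show "\<exists>w. w \<noteq> 0 \<and> cls w \<notin> {cls v}" by blast
next
  fix d e and F G :: "'a ^ 3 \<Rightarrow> 'a"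
  assume F: "is_form d F" and G: "is_form e G" and "vanish (\<lambda>v. F v * G v) {cls v}"
  hence "F v * G v = 0" using vanish_point[OF is_form_mult[OF F G] v] by simp
  thus "vanish F {cls v} \<or> vanish G {cls v}" using vanish_point[OF F v] vanish_point[OF G v] by simp
qed simp

lemma zset_closed: "is_form d F \<Longrightarrow> zariski_closed (zset F)"
  unfolding closed_iff
proof (intro conjI allI impI zset_plane)
  fix v assume F: "is_form d F" and v: "v \<noteq> 0" "cls v \<notin> zset F"
  have "vanish F (zset F)" unfolding vanish_def using cls_in_zset[OF F] by blast
  thus "\<exists>d G. is_form d G \<and> vanish G (zset F) \<and> G v \<noteq> 0" using F v cls_in_zset[OF F] by blast
qed

text \<open>In the curve case a failure of primality for \<open>W\<close> involves two forms and two
  points, hence finitely many field elements. Pulled back along an extended isomorphism, it would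
  contradict primality for \<open>V\<close>.\<close>

lemma vrel_Var:
  fixes k :: "'a::alg_closed_field set" and l :: "'b::alg_closed_field set"
  assumes inf: "inf_tr TYPE('a)" "inf_tr TYPE('b)" and f: "fpiso k l \<sigma>"
    and r: "vrel k \<sigma> V W" and V: "V \<in> Var"
  shows "W \<in> Var"
  using r[unfolded vrel_def]
proof (elim disjE exE conjE)
  fix v assume "v \<noteq> 0" "vover k v" "W = {cls (mapv \<sigma> v)}"
  thus ?thesis using mapv_eq_0[OF fpiso_piso[OF f]] point_in_Var by auto
next
  fix d c assume c: "cover d k c" "V = zset (fm d c)" "W = zset (fm d (\<lambda>a b. \<sigma> (c a b)))"
  have pull: "\<exists>k' l' \<sigma>'. fpiso k' l' \<sigma>' \<and> extends k \<sigma> k' \<sigma>' \<and> vrel k' \<sigma>' V W \<and> B \<subseteq> l'"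
    if "finite B" for B
    using forth_inv[OF inf(1) that f] vrel_extends[OF r] by blast
  have push: "\<exists>v'. vover k' v' \<and> v' \<noteq> 0 \<and> mapv \<sigma>' v' = w"
    if "fpiso k' l' \<sigma>'" "vover l' w" "w \<noteq> 0" for k' l' and \<sigma>' :: "'a \<Rightarrow> 'b" and w :: "'b ^ 3"
  proof (intro exI conjI)
    note p = fpiso_piso[OF that(1)]
    show "vover k' (mapv (inv_into k' \<sigma>') w)" "mapv (inv_into k' \<sigma>') w \<noteq> 0"
      using vover_map[OF piso_inv[OF p]] mapv_eq_0[OF piso_inv[OF p]] that by auto
    show "mapv \<sigma>' (mapv (inv_into k' \<sigma>') w) = w"
      using that piso_inv_cancel(2)[OF p] by (simp add: vec_eq_iff vover_def)
  qed
  show ?thesis unfolding Var_iff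
  proof (intro conjI allI impI)
    show "zariski_closed W" unfolding c(3) by (rule zset_closed[OF is_form_fm])
    have VP: "V \<subseteq> proj_plane" using vrel_plane[OF fpiso_piso[OF f] r] by blast
    obtain P where "P \<in> V" using V unfolding Var_iff by blast
    moreover from this have "P \<in> proj_plane" using VP by blast
    then obtain v where "v \<noteq> 0" "P = cls v" by (rule planeE)
    ultimately have v: "v \<noteq> 0" "cls v \<in> V" by auto
    obtain k' l' \<sigma>' where e: "fpiso k' l' \<sigma>'" "extends k \<sigma> k' \<sigma>'" "range (($) v) \<subseteq> k'"
      using forth[OF inf(2) finite_coords f] by blast
    show "W \<noteq> {}"
      using vrel_mem[OF fpiso_piso[OF e(1)] vrel_extends[OF r e(2)], of v] v e(3) by (auto simp: vover_iff)
    obtain u where u: "u \<noteq> 0" "cls u \<notin> V" using V unfolding Var_iff by blast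
    obtain k' l' \<sigma>' where e: "fpiso k' l' \<sigma>'" "extends k \<sigma> k' \<sigma>'" "range (($) u) \<subseteq> k'"
      using forth[OF inf(2) finite_coords f] by blast
    have "mapv \<sigma>' u \<noteq> 0" "cls (mapv \<sigma>' u) \<notin> W"
      using vrel_mem[OF fpiso_piso[OF e(1)] vrel_extends[OF r e(2)], of u] u e(3)
        mapv_eq_0[OF fpiso_piso[OF e(1)], of u] by (auto simp: vover_iff)
    thus "\<exists>v. v \<noteq> 0 \<and> cls v \<notin> W" by blast
  next
    fix d1 d2 and F G :: "'b ^ 3 \<Rightarrow> 'b"
    assume F: "is_form d1 F" and G: "is_form d2 G" and FG: "vanish (\<lambda>v. F v * G v) W"
    obtain f where f: "F = fm d1 f" using is_formE[OF distinct3_123 F] .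
    obtain g where g: "G = fm d2 g" using is_formE[OF distinct3_123 G] .
    show "vanish F W \<or> vanish G W"
    proof (rule ccontr)
      assume "\<not> ?thesis"
      then obtain w1 w2 where w: "w1 \<noteq> 0" "cls w1 \<in> W" "F w1 \<noteq> 0" "w2 \<noteq> 0" "cls w2 \<in> W" "G w2 \<noteq> 0"
        unfolding vanish_def by blast
      \<comment> \<open>The coefficients of both forms and the coordinates of the two
        witnesses.\<close>
      define B where "B = (\<lambda>(a, b). f a b) ` tri d1 \<union> (\<lambda>(a, b). g a b) ` tri d2 \<union> range (($) w1) \<union> range (($) w2)"
      have "finite B" unfolding B_def by simp
      from pull[OF this] obtain k' l' \<sigma>' where e: "fpiso k' l' \<sigma>'" "vrel k' \<sigma>' V W" "B \<subseteq> l'" by blast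
      note p = fpiso_piso[OF e(1)]
      let ?\<tau> = "inv_into k' \<sigma>'"
      have cov: "cover d1 l' f" "cover d2 l' g" "vover l' w1" "vover l' w2"
        using e(3) unfolding B_def cover_iff vover_iff by auto
      define f' where "f' a b = ?\<tau> (f a b)" for a b
      define g' where "g' a b = ?\<tau> (g a b)" for a b
      have cov': "cover d1 k' f'" "cover d2 k' g'"
        using cov piso_inv_cancel(4)[OF p] by (auto simp: cover_def f'_def g'_def)
      have bk: "fm d1 (\<lambda>a b. \<sigma>' (f' a b)) = F" "fm d2 (\<lambda>a b. \<sigma>' (g' a b)) = G"
        unfolding f g form3_def f'_def g'_def using coverD[OF cov(1)] coverD[OF cov(2)] piso_inv_cancel(2)[OF p]
        by (auto simp: fun_eq_iff intro!: sum.cong)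
      \<comment> \<open>A point \<open>v\<close> of \<open>V\<close> may lie outside the enlarged
        subfield as well, so for each such point the isomorphism is extended once more, now on the
        other side.\<close>
      have "vanish (\<lambda>v. fm d1 f' v * fm d2 g' v) V" unfolding vanish_def
      proof (intro allI impI)
        fix v :: "'a ^ 3" assume v: "v \<noteq> 0" "cls v \<in> V"
        obtain k'' l'' \<sigma>'' where e': "fpiso k'' l'' \<sigma>''" "extends k' \<sigma>' k'' \<sigma>''" "range (($) v) \<subseteq> k''"
          using forth[OF inf(2) finite_coords e(1)] by blast
        note p'' = fpiso_piso[OF e'(1)]
        interpret partial_iso k'' l'' \<sigma>'' by unfold_locales (rule p'')
        have vk: "vover k'' v" using e'(3) by (simp add: vover_iff)
        have "cls (mapv \<sigma>'' v) \<in> W"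
          using vrel_mem[OF p'' vrel_extends[OF e(2) e'(2)] vk v(1)] v(2) by simp
        hence 0: "F (mapv \<sigma>'' v) * G (mapv \<sigma>'' v) = 0"
          using FG mapv_eq_0[OF p'' vk] v(1) unfolding vanish_def by blast
        have c'': "cover d1 k'' f'" "cover d2 k'' g'" using cov' e'(2) by (auto simp: cover_def extends_def)
        have "fm d1 (\<lambda>a b. \<sigma>'' (f' a b)) = fm d1 (\<lambda>a b. \<sigma>' (f' a b))"
          "fm d2 (\<lambda>a b. \<sigma>'' (g' a b)) = fm d2 (\<lambda>a b. \<sigma>' (g' a b))"
          using coverD[OF cov'(1)] coverD[OF cov'(2)] e'(2) unfolding form3_def
          by (auto simp: extends_def fun_eq_iff intro!: sum.cong)
        hence "\<sigma>'' (fm d1 f' v) * \<sigma>'' (fm d2 g' v) = 0"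
          using 0 fm_map(1)[OF p'' c''(1) vk] fm_map(1)[OF p'' c''(2) vk] bk by simp
        thus "fm d1 f' v * fm d2 g' v = 0"
          using eq_0 fm_map(2)[OF p'' c''(1) vk] fm_map(2)[OF p'' c''(2) vk] by auto
      qed
      hence V0: "vanish (fm d1 f') V \<or> vanish (fm d2 g') V"
        using V is_form_fm unfolding Var_iff by blast
      have "\<exists>v'. v' \<noteq> 0 \<and> cls v' \<in> V \<and> fm d h' v' \<noteq> 0"
        if h: "cover d k' h'" "vover l' w" "w \<noteq> 0" "cls w \<in> W" "fm d (\<lambda>a b. \<sigma>' (h' a b)) w \<noteq> 0" for d h' w
      proof -
        interpret partial_iso k' l' \<sigma>' by unfold_locales (rule p)
        obtain v' where v': "vover k' v'" "v' \<noteq> 0" "mapv \<sigma>' v' = w" using push[OF e(1) h(2,3)] by blast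
        have "cls v' \<in> V" using vrel_mem[OF p e(2) v'(1,2)] v'(3) h by simp
        moreover have "fm d h' v' \<noteq> 0"
          using fm_map(1)[OF p h(1) v'(1)] h(5) v'(3) zero by auto
        ultimately show ?thesis using v' by blast
      qed
      from this[of d1 f' w1] this[of d2 g' w2] show False
        using V0 cov' cov w bk unfolding vanish_def by auto
    qed
  qed
qed

lemma vrel_forth:
  fixes k :: "'a::{alg_closed_field, field_char_0} set" and l :: "'b::{alg_closed_field, field_char_0} set"
  assumes inf: "inf_tr TYPE('a)" "inf_tr TYPE('b)" and f: "fpiso k l \<sigma>" and V: "V \<in> Var"
  shows "\<exists>k' l' \<sigma>' W. fpiso k' l' \<sigma>' \<and> extends k \<sigma> k' \<sigma>' \<and> vrel k' \<sigma>' V W \<and> W \<in> Var"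
proof -
  have "\<exists>k' l' \<sigma>' W. fpiso k' l' \<sigma>' \<and> extends k \<sigma> k' \<sigma>' \<and> vrel k' \<sigma>' V W"
    using V
  proof (cases rule: Var_cases)
    case (point v)
    obtain k' l' \<sigma>' where "fpiso k' l' \<sigma>'" "extends k \<sigma> k' \<sigma>'" "range (($) v) \<subseteq> k'"
      using forth[OF inf(2) finite_coords f] by blast
    thus ?thesis using point unfolding vrel_def vover_iff[symmetric] by blast
  next
    case (curve d F)
    obtain c where F: "F = fm d c" using is_formE[OF distinct3_123 curve(1)] .
    obtain k' l' \<sigma>' where "fpiso k' l' \<sigma>'" "extends k \<sigma> k' \<sigma>'" "(\<lambda>(a, b). c a b) ` tri d \<subseteq> k'"
      using forth[OF inf(2) finite_coeffs f] by blast
    thus ?thesis using curve(2) unfolding F vrel_def cover_iff[symmetric] by blast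
  qed
  thus ?thesis using vrel_Var[OF inf _ _ V] by blast
qed

text \<open>Winning positions are the partial isomorphisms for which the elements chosen so far are
  related by \<open>vrel\<close>. The isomorphism varies in the induction because each quantifier
  enlarges it.\<close>

lemma game:
  fixes k :: "'a::{alg_closed_field, field_char_0} set" and l :: "'b::{alg_closed_field, field_char_0} set"
  assumes inf: "inf_tr TYPE('a)" "inf_tr TYPE('b)"
  shows "fpiso k l \<sigma> \<Longrightarrow> (\<And>n. n \<in> free_vars \<phi> \<Longrightarrow> vrel k \<sigma> (e n) (e' n)) \<Longrightarrow>
    satisfies Var (\<subseteq>) e \<phi> \<longleftrightarrow> satisfies Var (\<subseteq>) e' \<phi>"
proof (induction \<phi> arbitrary: k l \<sigma> e e')
  case (Eq i j)
  thus ?case using vrel_subset[OF inf Eq(1), of "e i" "e' i" "e j" "e' j"]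
      vrel_subset[OF inf Eq(1), of "e j" "e' j" "e i" "e' i"] by auto
next
  case (Le i j)
  thus ?case using vrel_subset[OF inf Le(1), of "e i" "e' i" "e j" "e' j"] by auto
next
  case (Neg \<phi>)
  have "satisfies Var (\<subseteq>) e \<phi> \<longleftrightarrow> satisfies Var (\<subseteq>) e' \<phi>"
    by (rule Neg.IH[OF Neg.prems(1)]) (use Neg.prems(2) in simp)
  thus ?case by simp
next
  case (Conj \<phi> \<psi>)
  have "satisfies Var (\<subseteq>) e \<phi> \<longleftrightarrow> satisfies Var (\<subseteq>) e' \<phi>"
    by (rule Conj.IH(1)[OF Conj.prems(1)]) (use Conj.prems(2) in simp)
  moreover have "satisfies Var (\<subseteq>) e \<psi> \<longleftrightarrow> satisfies Var (\<subseteq>) e' \<psi>"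
    by (rule Conj.IH(2)[OF Conj.prems(1)]) (use Conj.prems(2) in simp)
  ultimately show ?case by simp
next
  case (Exi i \<phi>)
  have step: "satisfies Var (\<subseteq>) (e(i := V)) \<phi> \<longleftrightarrow> satisfies Var (\<subseteq>) (e'(i := W)) \<phi>"
    if "fpiso k' l' \<sigma>'" "extends k \<sigma> k' \<sigma>'" "vrel k' \<sigma>' V W" for k' l' \<sigma>' V W
  proof (rule Exi.IH[OF that(1)])
    fix n assume "n \<in> free_vars \<phi>"
    thus "vrel k' \<sigma>' ((e(i := V)) n) ((e'(i := W)) n)"
      using Exi.prems(2)[of n] vrel_extends[OF _ that(2)] that(3) by (cases "n = i") auto
  qed
  show ?case
  proof
    assume "satisfies Var (\<subseteq>) e (Exi i \<phi>)"
    then obtain V where V: "V \<in> Var" "satisfies Var (\<subseteq>) (e(i := V)) \<phi>" by auto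
    thus "satisfies Var (\<subseteq>) e' (Exi i \<phi>)"
      using vrel_forth[OF inf Exi.prems(1) V(1)] step by auto
  next
    assume "satisfies Var (\<subseteq>) e' (Exi i \<phi>)"
    then obtain W where W: "W \<in> Var" "satisfies Var (\<subseteq>) (e'(i := W)) \<phi>" by auto
    \<comment> \<open>A move in the second structure is a move in the first for the inverse
      isomorphism.\<close>
    obtain l' k' \<tau> V where *: "fpiso l' k' \<tau>" "extends l (inv_into k \<sigma>) l' \<tau>" "vrel l' \<tau> W V" "V \<in> Var"
      using vrel_forth[OF inf(2,1) fpiso_inv[OF Exi.prems(1)] W(1)] by blast
    have "extends k \<sigma> k' (inv_into l' \<tau>)"
      by (rule extends_inv[OF fpiso_piso[OF Exi.prems(1)] fpiso_piso[OF *(1)] *(2)])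
    hence "satisfies Var (\<subseteq>) (e(i := V)) \<phi>"
      using step[OF fpiso_inv[OF *(1)] _ vrel_inv[OF fpiso_piso[OF *(1)] *(3)]] W(2) by blast
    thus "satisfies Var (\<subseteq>) e (Exi i \<phi>)" using *(4) by auto
  qed
qed

theorem inf_tr_elementarily_equivalent:
  assumes "inf_tr TYPE('a::{alg_closed_field, field_char_0})" "inf_tr TYPE('b::{alg_closed_field, field_char_0})"
  shows "elementarily_equivalent (Var :: ('a ^ 3) set set set) (\<subseteq>) (Var :: ('b ^ 3) set set set) (\<subseteq>)"
  unfolding elementarily_equivalent_def
proof (intro allI impI)
  fix \<phi> assume "sentence \<phi>"
  obtain \<sigma> :: "'a \<Rightarrow> 'b" where \<sigma>: "fpiso \<rat> \<rat> \<sigma>" using prime_piso by blast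
  have *: "satisfies Var (\<subseteq>) e \<phi> \<longleftrightarrow> satisfies Var (\<subseteq>) e' \<phi>"
    for e :: "nat \<Rightarrow> ('a ^ 3) set set" and e' :: "nat \<Rightarrow> ('b ^ 3) set set"
    by (rule game[OF assms \<sigma>]) (use \<open>sentence \<phi>\<close> in \<open>simp add: sentence_def\<close>)
  have "\<exists>e::nat \<Rightarrow> ('a ^ 3) set set. \<forall>n. e n \<in> Var"
    using point_in_Var[of "vec 1 :: 'a ^ 3"] by (intro exI[of _ "\<lambda>_. {cls (vec 1)}"]) (simp add: vec_eq_iff)
  moreover have "\<exists>e::nat \<Rightarrow> ('b ^ 3) set set. \<forall>n. e n \<in> Var"
    using point_in_Var[of "vec 1 :: 'b ^ 3"] by (intro exI[of _ "\<lambda>_. {cls (vec 1)}"]) (simp add: vec_eq_iff)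
  ultimately show "models (Var :: ('a ^ 3) set set set) (\<subseteq>) \<phi> \<longleftrightarrow> models (Var :: ('b ^ 3) set set set) (\<subseteq>) \<phi>"
    unfolding models_def using * by blast
qed

section \<open>Transcendence bases\<close>

definition subrg :: "'a::comm_ring_1 set \<Rightarrow> bool" where
  "subrg R \<longleftrightarrow> 0 \<in> R \<and> 1 \<in> R \<and> (\<forall>x\<in>R. \<forall>y\<in>R. x + y \<in> R \<and> x * y \<in> R) \<and> (\<forall>x\<in>R. - x \<in> R)"

lemma subrgD:
  assumes "subrg R"
  shows "0 \<in> R" "1 \<in> R" "x \<in> R \<Longrightarrow> y \<in> R \<Longrightarrow> x + y \<in> R" "x \<in> R \<Longrightarrow> y \<in> R \<Longrightarrow> x * y \<in> R"
    "x \<in> R \<Longrightarrow> - x \<in> R" "x \<in> R \<Longrightarrow> x ^ n \<in> R"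
proof -
  show *: "0 \<in> R" "1 \<in> R" "x \<in> R \<Longrightarrow> y \<in> R \<Longrightarrow> x + y \<in> R" "x \<in> R \<Longrightarrow> y \<in> R \<Longrightarrow> x * y \<in> R"
    "x \<in> R \<Longrightarrow> - x \<in> R" for x y
    using assms unfolding subrg_def by blast+
  show "x \<in> R \<Longrightarrow> x ^ n \<in> R" by (induction n) (auto simp: *)
qed

lemma subrg_sum: "subrg R \<Longrightarrow> (\<And>a. a \<in> A \<Longrightarrow> f a \<in> R) \<Longrightarrow> (\<Sum>a\<in>A. f a) \<in> R"
  by (induction A rule: infinite_finite_induct) (auto simp: subrgD)

definition fracs :: "'a::field set \<Rightarrow> 'a set" where
  "fracs R = {x / y | x y. x \<in> R \<and> y \<in> R \<and> y \<noteq> 0}"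

lemma fracsI: "x \<in> R \<Longrightarrow> y \<in> R \<Longrightarrow> y \<noteq> 0 \<Longrightarrow> x / y \<in> fracs R"
  unfolding fracs_def by blast

lemma subfld_fracs:
  assumes R: "subrg R" shows "subfld (fracs R)"
  unfolding subfld_def
proof (intro conjI ballI)
  show "0 \<in> fracs R" using fracsI[of 0 R 1] subrgD[OF R] by simp
  show "1 \<in> fracs R" using fracsI[of 1 R 1] subrgD[OF R] by simp
  fix x assume "x \<in> fracs R"
  then obtain p q where x: "p \<in> R" "q \<in> R" "q \<noteq> 0" "x = p / q" unfolding fracs_def by blast
  show "- x \<in> fracs R" using fracsI[of "- p" R q] subrgD[OF R] x by simp
  show "inverse x \<in> fracs R"
    using fracsI[of q R p] fracsI[of 0 R 1] subrgD[OF R] x by (cases "p = 0") auto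
  fix y assume "y \<in> fracs R"
  then obtain p' q' where y: "p' \<in> R" "q' \<in> R" "q' \<noteq> 0" "y = p' / q'" unfolding fracs_def by blast
  show "x + y \<in> fracs R"
    using fracsI[of "p * q' + p' * q" R "q * q'"] x y subrgD[OF R] by (simp add: add_frac_eq)
  show "x * y \<in> fracs R" using fracsI[of "p * p'" R "q * q'"] x y subrgD[OF R] by simp
qed

lemma fracs_superset: "subrg R \<Longrightarrow> R \<subseteq> fracs R"
  using fracsI[of _ R 1] subrgD[of R] by auto

lemma common_denominator:
  assumes R: "subrg R" and "pover (fracs R) q"
  shows "\<exists>D\<in>R. D \<noteq> 0 \<and> pover R (smult D q)"
  using assms(2)
proof (induction q)
  case 0
  show ?case using subrgD[OF R] by (intro bexI[of _ 1]) (auto simp: pover_def)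
next
  case (pCons a q)
  then obtain D where D: "D \<in> R" "D \<noteq> 0" "pover R (smult D q)" by (auto simp: pover_pCons_iff)
  obtain x y where a: "x \<in> R" "y \<in> R" "y \<noteq> 0" "a = x / y"
    using pCons by (auto simp: pover_pCons_iff fracs_def)
  have "D * x \<in> R" "D * y \<in> R" using subrgD(4)[OF R] D a by auto
  moreover have "D * y * a = D * x" using a by simp
  moreover have "pover R (smult y (smult D q))"
    using D(3) a(2) subrgD(4)[OF R] unfolding pover_def coeff_smult by blast
  hence "pover R (smult (D * y) q)" by (simp add: mult.commute)
  ultimately show ?case using D a by (intro bexI[of _ "D * y"]) (auto simp: pover_pCons_iff)
qed

definition qpoly :: "'a::field_char_0 set \<Rightarrow> ('a, 'a) mpoly \<Rightarrow> bool" where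
  "qpoly B p \<longleftrightarrow> (\<forall>m\<in>Poly_Mapping.keys p. Poly_Mapping.keys m \<subseteq> B) \<and> (\<forall>m. Poly_Mapping.lookup p m \<in> \<rat>)"

abbreviation self_eval :: "('a::comm_ring_1, 'a) mpoly \<Rightarrow> 'a" where
  "self_eval p \<equiv> mpoly_eval p (\<lambda>b. b)"

lemma alg_independent_iff: "alg_independent B \<longleftrightarrow> (\<forall>p. qpoly B p \<longrightarrow> self_eval p = 0 \<longrightarrow> p = 0)"
  unfolding alg_independent_def qpoly_def by blast

lemma qpoly_single: "Poly_Mapping.keys m \<subseteq> B \<Longrightarrow> c \<in> \<rat> \<Longrightarrow> qpoly B (Poly_Mapping.single m c)"
  by (auto simp: qpoly_def lookup_single when_def)

lemma qpoly_0: "qpoly B 0"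
  by (simp add: qpoly_def)

lemma qpoly_add: "qpoly B p \<Longrightarrow> qpoly B q \<Longrightarrow> qpoly B (p + q)"
  unfolding qpoly_def using Poly_Mapping.keys_add[of p q] by (auto simp: lookup_add) blast

lemma qpoly_sum: "(\<And>a. a \<in> A \<Longrightarrow> qpoly B (f a)) \<Longrightarrow> qpoly B (\<Sum>a\<in>A. f a)"
  by (induction A rule: infinite_finite_induct) (auto simp: qpoly_add qpoly_0)

lemma qpoly_mult:
  assumes "qpoly B p" "qpoly B q" shows "qpoly B (p * q)"
  unfolding mpoly_mult_expand
proof (intro qpoly_sum qpoly_single)
  fix m n assume "m \<in> Poly_Mapping.keys p" "n \<in> Poly_Mapping.keys q"
  thus "Poly_Mapping.keys (m + n) \<subseteq> B"
    using Poly_Mapping.keys_add[of m n] assms unfolding qpoly_def by blast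
qed (use assms in \<open>auto simp: qpoly_def\<close>)

definition QB :: "'a::field_char_0 set \<Rightarrow> 'a set" where
  "QB B = self_eval ` {p. qpoly B p}"

lemma QBI: "qpoly B p \<Longrightarrow> self_eval p \<in> QB B"
  by (simp add: QB_def)

lemma subrg_QB: "subrg (QB B)"
  unfolding subrg_def
proof (intro conjI ballI)
  show "0 \<in> QB B" using QBI[OF qpoly_0] by simp
  have "qpoly B (Poly_Mapping.single 0 1)" by (rule qpoly_single) auto
  hence "self_eval (Poly_Mapping.single 0 1) \<in> QB B" by (rule QBI)
  thus "1 \<in> QB B" unfolding mpoly_eval_single by simp
  fix x assume "x \<in> QB B"
  then obtain p where p: "qpoly B p" "x = self_eval p" by (auto simp: QB_def)
  have "qpoly B (Poly_Mapping.single 0 (-1))" by (rule qpoly_single) auto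
  hence "qpoly B (Poly_Mapping.single 0 (-1) * p)" using p qpoly_mult by blast
  thus "- x \<in> QB B"
    using QBI[of B "Poly_Mapping.single 0 (-1) * p"] p by (simp add: mpoly_eval_mult mpoly_eval_single)
  fix y assume "y \<in> QB B"
  then obtain q where q: "qpoly B q" "y = self_eval q" by (auto simp: QB_def)
  show "x + y \<in> QB B" using QBI[OF qpoly_add[OF p(1) q(1)]] p q by (simp add: mpoly_eval_add)
  show "x * y \<in> QB B" using QBI[OF qpoly_mult[OF p(1) q(1)]] p q by (simp add: mpoly_eval_mult)
qed

lemma base_QB: "B \<subseteq> QB B"
proof
  fix b assume "b \<in> B"
  hence "qpoly B (Poly_Mapping.single (Poly_Mapping.single b 1) 1)" by (intro qpoly_single) auto
  thus "b \<in> QB B" using QBI by (force simp: mpoly_eval_single mon_eval_single)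
qed

lemma gen_fracs_QB: "gen B \<subseteq> fracs (QB B)"
  using base_QB[of B] fracs_superset[OF subrg_QB, of B]
  by (intro gen_least subfld_fracs subrg_QB) auto

lemma lookup_mult_shift:
  "Poly_Mapping.lookup (p * Poly_Mapping.single t (1::'a::comm_ring_1)) (m + t) =
   Poly_Mapping.lookup p (m :: 'i \<Rightarrow>\<^sub>0 nat)"
proof -
  have "p * Poly_Mapping.single t 1 =
      (\<Sum>n\<in>Poly_Mapping.keys p. Poly_Mapping.single (n + t) (Poly_Mapping.lookup p n))"
    by (subst (1) poly_mapping_sum_singles[of p]) (simp add: sum_distrib_right mult_single)
  thus ?thesis by (simp add: lookup_sum lookup_single when_def sum.delta in_keys_iff)
qed

lemma lookup_mult_single_eq_0:
  assumes "\<And>m'. m' \<in> Poly_Mapping.keys p \<Longrightarrow> m \<noteq> m' + t"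
  shows "Poly_Mapping.lookup (p * Poly_Mapping.single t (1::'a::comm_ring_1)) m = 0"
proof (rule ccontr)
  assume "\<not> ?thesis"
  hence "m \<in> Poly_Mapping.keys (p * Poly_Mapping.single t 1)" by (simp add: in_keys_iff)
  thus False using Poly_Mapping.keys_mult[of p "Poly_Mapping.single t 1"] assms by auto
qed

text \<open>Clearing denominators turns an equation of \<open>b\<close> over the field into one over
  the polynomial ring. Replacing its coefficients by polynomials that represent them gives a
  polynomial relation among elements of \<open>B\<close>.\<close>

lemma independent_not_algb:
  assumes B: "alg_independent B" and b: "b \<in> B"
  shows "\<not> algb (gen (B - {b})) b"
proof
  let ?B = "B - {b}"
  assume "algb (gen ?B) b"
  then obtain q where q: "pover (fracs (QB ?B)) q" "q \<noteq> 0" "poly q b = 0"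
    unfolding algb_def using pover_mono[OF _ gen_fracs_QB] by blast
  obtain D where D: "D \<noteq> 0" "pover (QB ?B) (smult D q)" using common_denominator[OF subrg_QB q(1)] by blast
  define r where "r = smult D q"
  have r: "pover (QB ?B) r" "r \<noteq> 0" "poly r b = 0" using D q by (auto simp: r_def)
  have "\<forall>n. \<exists>p. qpoly ?B p \<and> coeff r n = self_eval p" using r(1) by (auto simp: pover_def QB_def)
  then obtain P where P: "\<And>n. qpoly ?B (P n)" "\<And>n. coeff r n = self_eval (P n)" by metis
  let ?b = "\<lambda>n. Poly_Mapping.single b (n::nat)"
  \<comment> \<open>Here \<open>b\<close> itself becomes the variable that accompanies the
    coefficient polynomials.\<close>
  define p where "p = (\<Sum>n\<le>degree r. P n * Poly_Mapping.single (?b n) 1)"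
  have "qpoly B p" unfolding p_def
  proof (intro qpoly_sum qpoly_mult qpoly_single)
    fix n show "qpoly B (P n)" using P(1)[of n] unfolding qpoly_def by blast
  qed (use b in auto)
  moreover have "self_eval p = poly r b"
    unfolding p_def poly_altdef mpoly_eval_sum P(2)
    by (intro sum.cong refl) (simp add: mpoly_eval_mult mpoly_eval_single mon_eval_single)
  ultimately have "p = 0" using B r(3) unfolding alg_independent_iff by simp
  \<comment> \<open>Since \<open>b\<close> does not occur in the coefficient polynomials, terms with
    different powers of \<open>b\<close> cannot cancel, and \<open>p = 0\<close> forces each of them
    to vanish.\<close>
  have nb: "Poly_Mapping.lookup m b = 0" if "m \<in> Poly_Mapping.keys (P n)" for m n
    using P(1)[of n] that unfolding qpoly_def by (auto simp: in_keys_iff subset_iff)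
  have "P n = 0" if n: "n \<le> degree r" for n
  proof (rule poly_mapping_eqI)
    fix m
    show "Poly_Mapping.lookup (P n) m = Poly_Mapping.lookup 0 m"
    proof (cases "m \<in> Poly_Mapping.keys (P n)")
      case True
      have "Poly_Mapping.lookup (P i * Poly_Mapping.single (?b i) 1) (m + ?b n) = 0" if "i \<noteq> n" for i
      proof (rule lookup_mult_single_eq_0)
        fix m' assume m': "m' \<in> Poly_Mapping.keys (P i)"
        show "m + ?b n \<noteq> m' + ?b i"
        proof
          assume "m + ?b n = m' + ?b i"
          hence "Poly_Mapping.lookup (m + ?b n) b = Poly_Mapping.lookup (m' + ?b i) b" by simp
          thus False using nb[OF True] nb[OF m'] \<open>i \<noteq> n\<close> by (simp add: lookup_add)
        qed
      qed
      hence "Poly_Mapping.lookup p (m + ?b n) =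
          (\<Sum>i\<le>degree r. if i = n then Poly_Mapping.lookup (P n) m else 0)"
        unfolding p_def lookup_sum
        by (intro sum.cong refl) (auto simp: lookup_mult_shift)
      thus ?thesis using n \<open>p = 0\<close> by simp
    qed (simp add: in_keys_iff)
  qed
  hence "coeff r (degree r) = 0" using P(2)[of "degree r"] by simp
  thus False using r by simp
qed

text \<open>The converse rearrangement: a relation that involves \<open>x\<close> is sorted by the
  exponent of \<open>x\<close>.\<close>

lemma dependent_insert:
  assumes B: "alg_independent B" and x: "x \<notin> B" and dep: "\<not> alg_independent (insert x B)"
  shows "\<exists>q. pover (QB B) q \<and> q \<noteq> 0 \<and> poly q x = 0"
proof -
  obtain p where p: "qpoly (insert x B) p" "self_eval p = 0" "p \<noteq> 0"
    using dep unfolding alg_independent_iff by blast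
  let ?K = "Poly_Mapping.keys p"
  let ?x = "\<lambda>n. Poly_Mapping.single x (n::nat)"
  define e where "e m = Poly_Mapping.lookup m x" for m :: "'a \<Rightarrow>\<^sub>0 nat"
  define rest where "rest m = m - ?x (e m)" for m :: "'a \<Rightarrow>\<^sub>0 nat"
  have split: "m = rest m + ?x (e m)" for m
    by (rule poly_mapping_eqI) (auto simp: rest_def e_def lookup_add lookup_minus lookup_single when_def)
  have krest: "Poly_Mapping.keys (rest m) \<subseteq> B" if "m \<in> ?K" for m
  proof
    fix y assume y: "y \<in> Poly_Mapping.keys (rest m)"
    hence "Poly_Mapping.lookup (rest m) y \<noteq> 0" by (simp add: in_keys_iff)
    hence "y \<noteq> x" "y \<in> Poly_Mapping.keys m"
      by (auto simp: rest_def e_def lookup_minus lookup_single when_def in_keys_iff split: if_splits)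
    thus "y \<in> B" using p(1) that unfolding qpoly_def by blast
  qed
  define c where "c j = (\<Sum>m | m \<in> ?K \<and> e m = j. Poly_Mapping.single (rest m) (Poly_Mapping.lookup p m))" for j
  have qc: "qpoly B (c j)" for j unfolding c_def
    by (intro qpoly_sum qpoly_single) (use krest p(1) in \<open>auto simp: qpoly_def\<close>)
  define N where "N = Max (e ` ?K)"
  have N: "e m \<le> N" if "m \<in> ?K" for m unfolding N_def using that by (intro Max_ge) auto
  define q where "q = (\<Sum>j\<le>N. monom (self_eval (c j)) j)"
  have cq: "coeff q j = (if j \<le> N then self_eval (c j) else 0)" for j
    unfolding q_def coeff_sum by (simp add: sum.delta)
  have "pover (QB B) q" unfolding pover_def cq
    using QBI[OF qc] subrgD(1)[OF subrg_QB] by auto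
  moreover have "poly q x = 0"
  proof -
    have "poly q x = (\<Sum>j\<le>N. \<Sum>m | m \<in> ?K \<and> e m = j. Poly_Mapping.lookup p m * mon_eval m (\<lambda>b. b))"
      unfolding q_def poly_sum poly_monom c_def mpoly_eval_sum sum_distrib_right
    proof (intro sum.cong refl)
      fix j m assume "m \<in> {m \<in> ?K. e m = j}"
      hence "mon_eval m (\<lambda>b. b) = mon_eval (rest m) (\<lambda>b. b) * x ^ j"
        by (subst split) (simp add: mon_eval_add mon_eval_single)
      thus "mpoly_eval (Poly_Mapping.single (rest m) (Poly_Mapping.lookup p m)) (\<lambda>b. b) * x ^ j =
        Poly_Mapping.lookup p m * mon_eval m (\<lambda>b. b)" by (simp add: mpoly_eval_single)
    qed
    also have "\<dots> = (\<Sum>m\<in>?K. Poly_Mapping.lookup p m * mon_eval m (\<lambda>b. b))"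
      using N by (intro sum.group) auto
    also have "\<dots> = self_eval p" by (rule mpoly_eval_superset[symmetric]) auto
    finally show ?thesis using p(2) by simp
  qed
  \<comment> \<open>For the exponent occurring in some monomial \<open>m0\<close>, the collected
    coefficient is a nonzero polynomial over \<open>B\<close>; independence keeps its value
    nonzero.\<close>
  moreover have "q \<noteq> 0"
  proof -
    obtain m0 where m0: "m0 \<in> ?K" using p(3) by (metis all_not_in_conv keys_eq_empty)
    have inj: "rest m = rest m0 \<longleftrightarrow> m = m0" if "e m = e m0" for m
      using split[of m] split[of m0] that by metis
    have "Poly_Mapping.lookup (c (e m0)) (rest m0) =
       (\<Sum>m | m \<in> ?K \<and> e m = e m0. if m = m0 then Poly_Mapping.lookup p m0 else 0)"
      unfolding c_def lookup_sum by (intro sum.cong refl) (auto simp: lookup_single when_def inj)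
    also have "\<dots> = Poly_Mapping.lookup p m0" using m0 by (simp add: sum.delta)
    finally have "c (e m0) \<noteq> 0" using m0 by (auto simp: in_keys_iff)
    hence "self_eval (c (e m0)) \<noteq> 0" using B qc unfolding alg_independent_iff by blast
    thus ?thesis using cq[of "e m0"] N[OF m0] by auto
  qed
  ultimately show ?thesis by blast
qed

lemma alg_independent_empty: "alg_independent {}"
  unfolding alg_independent_iff
proof (intro allI impI)
  fix p :: "('a, 'a) mpoly" assume p: "qpoly {} p" "self_eval p = 0"
  have K: "Poly_Mapping.keys p \<subseteq> {0}" using p(1) unfolding qpoly_def by auto
  hence "self_eval p = Poly_Mapping.lookup p 0" by (subst mpoly_eval_superset[of "{0}"]) auto
  hence p0: "Poly_Mapping.lookup p 0 = 0" using p(2) by simp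
  show "p = 0"
  proof (rule poly_mapping_eqI)
    fix m show "Poly_Mapping.lookup p m = Poly_Mapping.lookup 0 m"
      using K p0 by (cases "m = 0") (auto simp: in_keys_iff)
  qed
qed

text \<open>Zorn's lemma applies because a polynomial mentions finitely many variables, which all
  lie in one member of a chain.\<close>

lemma ex_transcendence_basis: "\<exists>B. transcendence_basis B"
proof -
  have "\<Union>C \<in> {B. alg_independent B}" if C: "subset.chain {B. alg_independent B} C" for C :: "'a set set"
  proof (cases "C = {}")
    case True
    thus ?thesis using alg_independent_empty by simp
  next
    case False
    have "p = 0" if p: "qpoly (\<Union>C) p" "self_eval p = 0" for p
    proof -
      have "finite (\<Union>m\<in>Poly_Mapping.keys p. Poly_Mapping.keys m)" by simp
      moreover have "(\<Union>m\<in>Poly_Mapping.keys p. Poly_Mapping.keys m) \<subseteq> \<Union>C"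
        using p(1) unfolding qpoly_def by blast
      ultimately obtain B where B: "B \<in> C" "(\<Union>m\<in>Poly_Mapping.keys p. Poly_Mapping.keys m) \<subseteq> B"
        using finite_subset_Union_chain[OF _ _ False C] by metis
      hence "qpoly B p" using p(1) unfolding qpoly_def by blast
      moreover have "alg_independent B" using B C by (auto simp: subset.chain_def)
      ultimately show "p = 0" using p(2) unfolding alg_independent_iff by blast
    qed
    thus ?thesis unfolding alg_independent_iff by blast
  qed
  from subset_Zorn'[of "{B::'a set. alg_independent B}", OF this] show ?thesis
    unfolding transcendence_basis_def by blast
qed

section \<open>Finite extensions, transitivity of algebraicity and the exchange property\<close>

lemma linear_dependence:
  fixes M :: "'i \<Rightarrow> 'j \<Rightarrow> 'a::field"
  assumes k: "subfld k"
  shows "finite J \<Longrightarrow> finite I \<Longrightarrow> card J < card I \<Longrightarrow> (\<And>i j. i \<in> I \<Longrightarrow> j \<in> J \<Longrightarrow> M i j \<in> k) \<Longrightarrow>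
    \<exists>c. (\<forall>i. c i \<in> k) \<and> (\<exists>i\<in>I. c i \<noteq> 0) \<and> (\<forall>j\<in>J. (\<Sum>i\<in>I. c i * M i j) = 0)"
proof (induction J arbitrary: I M rule: finite_induct)
  case empty
  then obtain i where "i \<in> I" by fastforce
  thus ?case using subfldD[OF k] by (intro exI[of _ "\<lambda>_. 1"]) auto
next
  case (insert j0 J)
  show ?case
  proof (cases "\<forall>i\<in>I. M i j0 = 0")
    case True
    obtain c where "\<forall>i. c i \<in> k" "\<exists>i\<in>I. c i \<noteq> 0" "\<forall>j\<in>J. (\<Sum>i\<in>I. c i * M i j) = 0"
      using insert.IH[of I M] insert.prems insert.hyps by auto
    thus ?thesis using True by (intro exI[of _ c]) auto
  next
    case False
    then obtain i0 where i0: "i0 \<in> I" "M i0 j0 \<noteq> 0" by blast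
    \<comment> \<open>Gaussian elimination: the pivot row \<open>i0\<close> clears column
      \<open>j0\<close>, and the remaining rows are still more numerous than the remaining columns.
      Afterwards \<open>s\<close> fixes the coefficient of the pivot row.\<close>
    define N where "N i j = M i j - M i j0 / M i0 j0 * M i0 j" for i j
    have "\<exists>c. (\<forall>i. c i \<in> k) \<and> (\<exists>i\<in>I - {i0}. c i \<noteq> 0) \<and> (\<forall>j\<in>J. (\<Sum>i\<in>I - {i0}. c i * N i j) = 0)"
    proof (rule insert.IH)
      show "finite (I - {i0})" using insert.prems by simp
      show "card J < card (I - {i0})" using insert.prems insert.hyps i0 by simp
      show "N i j \<in> k" if "i \<in> I - {i0}" "j \<in> J" for i j
        unfolding N_def using that insert.prems(3) i0(1)
        by (intro subfldD(7)[OF k] subfldD(4)[OF k] subfldD(8)[OF k]) auto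
    qed
    then obtain c where c: "\<forall>i. c i \<in> k" "\<exists>i\<in>I - {i0}. c i \<noteq> 0"
      "\<forall>j\<in>J. (\<Sum>i\<in>I - {i0}. c i * N i j) = 0" by blast
    define s where "s = (\<Sum>i\<in>I - {i0}. c i * M i j0) / M i0 j0"
    have "s \<in> k" unfolding s_def using c insert.prems(3) i0(1)
      by (intro subfldD(8)[OF k] subfld_sum[OF k] subfldD(4)[OF k]) auto
    have sumI: "(\<Sum>i\<in>I. (c(i0 := - s)) i * M i j) = - s * M i0 j + (\<Sum>i\<in>I - {i0}. c i * M i j)" for j
      using insert.prems(1) i0(1) by (subst sum.remove[of I i0]) (auto intro!: sum.cong)
    have zero: "(\<Sum>i\<in>I. (c(i0 := - s)) i * M i j) = 0" if "j \<in> insert j0 J" for j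
    proof (cases "j = j0")
      case True
      thus ?thesis unfolding sumI using i0(2) by (simp add: s_def)
    next
      case False
      hence "(\<Sum>i\<in>I - {i0}. c i * N i j) = 0" using c that by auto
      moreover have "(\<Sum>i\<in>I - {i0}. c i * N i j) = (\<Sum>i\<in>I - {i0}. c i * M i j) - s * M i0 j"
        unfolding N_def s_def
        by (simp add: algebra_simps sum_subtractf sum_distrib_left sum_divide_distrib)
      ultimately show ?thesis unfolding sumI by simp
    qed
    have "\<exists>i\<in>I. (c(i0 := - s)) i \<noteq> 0"
    proof -
      obtain i where "i \<in> I - {i0}" "c i \<noteq> 0" using c(2) by blast
      thus ?thesis by (intro bexI[of _ i]) auto
    qed
    moreover have "\<forall>i. (c(i0 := - s)) i \<in> k" using c(1) \<open>s \<in> k\<close> subfldD(5)[OF k] by simp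
    ultimately show ?thesis using zero by blast
  qed
qed

text \<open>The linear span of \<open>T\<close> over \<open>k\<close>, generated term by term so
  that the tower law \<open>spn_tower\<close> becomes an induction.\<close>

inductive_set spn :: "'a::field set \<Rightarrow> 'a set \<Rightarrow> 'a set" for k T where
  spn_0: "0 \<in> spn k T"
| spn_step: "t \<in> T \<Longrightarrow> c \<in> k \<Longrightarrow> y \<in> spn k T \<Longrightarrow> c * t + y \<in> spn k T"

lemma spn_add: "x \<in> spn k T \<Longrightarrow> y \<in> spn k T \<Longrightarrow> x + y \<in> spn k T"
  by (induction rule: spn.induct) (auto simp: add.assoc intro: spn_step)

lemma spn_rep:
  assumes k: "subfld k" and T: "finite T" and "x \<in> spn k T"
  shows "\<exists>f. (\<forall>t. f t \<in> k) \<and> x = (\<Sum>t\<in>T. f t * t)"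
  using assms(3)
proof (induction rule: spn.induct)
  case spn_0
  show ?case using subfldD[OF k] by (intro exI[of _ "\<lambda>_. 0"]) simp
next
  case (spn_step t c y)
  then obtain f where f: "\<forall>t. f t \<in> k" "y = (\<Sum>t\<in>T. f t * t)" by blast
  have "(\<Sum>s\<in>T. (f(t := f t + c)) s * s) = (\<Sum>s\<in>T. f s * s + (if s = t then c * t else 0))"
    by (intro sum.cong refl) (auto simp: algebra_simps)
  also have "\<dots> = c * t + y" using T spn_step(1) f by (simp add: sum.distrib)
  finally show ?case using f spn_step(2) subfldD(3)[OF k]
    by (intro exI[of _ "f(t := f t + c)"]) auto
qed

lemma spn_tower:
  assumes "x \<in> spn E T'" and ET: "E \<subseteq> spn k T"
  shows "x \<in> spn k ((\<lambda>(t, t'). t * t') ` (T \<times> T'))"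
  using assms(1)
proof (induction rule: spn.induct)
  case spn_0
  show ?case by (rule spn.spn_0)
next
  case (spn_step t' c y)
  have "c * t' \<in> spn k ((\<lambda>(t, t'). t * t') ` (T \<times> T'))" using subsetD[OF ET spn_step(2)]
  proof (induction rule: spn.induct)
    case spn_0
    show ?case by (simp add: spn.spn_0)
  next
    case (spn_step t d z)
    have "d * (t * t') + z * t' \<in> spn k ((\<lambda>(t, t'). t * t') ` (T \<times> T'))"
      using spn_step \<open>t' \<in> T'\<close> by (intro spn.spn_step) auto
    thus ?case by (simp add: algebra_simps)
  qed
  thus ?case using spn_step by (intro spn_add)
qed

definition fin_over :: "'a::field set \<Rightarrow> 'a set \<Rightarrow> bool" where
  "fin_over k E \<longleftrightarrow> (\<exists>T. finite T \<and> E \<subseteq> spn k T)"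

lemma fin_over_trans: "fin_over k E \<Longrightarrow> fin_over E F \<Longrightarrow> fin_over k F"
  unfolding fin_over_def
proof (elim exE conjE)
  fix T T' assume "finite T" "E \<subseteq> spn k T" "finite T'" "F \<subseteq> spn E T'"
  thus "\<exists>T. finite T \<and> F \<subseteq> spn k T"
    using spn_tower by (intro exI[of _ "(\<lambda>(t, t'). t * t') ` (T \<times> T')"]) blast
qed

text \<open>If \<open>T\<close> spans, the powers of \<open>x\<close> with exponents 0 to
  \<open>card T\<close> outnumber \<open>T\<close> and are linearly dependent.\<close>

lemma fin_over_algb:
  assumes k: "subfld k" and "fin_over k E" and pow: "\<And>n. x ^ n \<in> E"
  shows "algb k x"
proof -
  obtain T where T: "finite T" "E \<subseteq> spn k T" using assms(2) unfolding fin_over_def by blast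
  have "\<forall>n. \<exists>f. (\<forall>t. f t \<in> k) \<and> x ^ n = (\<Sum>t\<in>T. f t * t)"
    using spn_rep[OF k T(1)] T(2) pow by blast
  then obtain f where f: "\<And>n t. f n t \<in> k" "\<And>n. x ^ n = (\<Sum>t\<in>T. f n t * t)" by metis
  have "\<exists>c. (\<forall>i. c i \<in> k) \<and> (\<exists>i\<in>{..card T}. c i \<noteq> 0) \<and> (\<forall>t\<in>T. (\<Sum>i\<le>card T. c i * f i t) = 0)"
    by (rule linear_dependence[OF k T(1)]) (use f in auto)
  then obtain c where c: "\<And>i. c i \<in> k" "\<exists>i\<le>card T. c i \<noteq> 0" "\<And>t. t \<in> T \<Longrightarrow> (\<Sum>i\<le>card T. c i * f i t) = 0"
    by auto
  define p where "p = (\<Sum>i\<le>card T. monom (c i) i)"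
  have cp: "coeff p j = (if j \<le> card T then c j else 0)" for j
    unfolding p_def coeff_sum by (simp add: sum.delta)
  have "poly p x = (\<Sum>i\<le>card T. \<Sum>t\<in>T. c i * f i t * t)"
    unfolding p_def poly_sum poly_monom f(2) sum_distrib_left by (simp add: mult.assoc)
  also have "\<dots> = (\<Sum>t\<in>T. (\<Sum>i\<le>card T. c i * f i t) * t)"
    by (subst sum.swap) (simp add: sum_distrib_right)
  also have "\<dots> = 0" using c(3) by simp
  finally have "poly p x = 0" .
  moreover have "p \<noteq> 0" using c(2) cp by (metis coeff_0)
  moreover have "pover k p" using c(1) subfldD[OF k] by (simp add: pover_def cp)
  ultimately show ?thesis unfolding algb_def by blast
qed

lemma subrg_polys: "subfld k \<Longrightarrow> subrg {poly p x | p. pover k p}"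
  unfolding subrg_def
proof (intro conjI ballI)
  assume k: "subfld k"
  show "0 \<in> {poly p x | p. pover k p}" using pover_0 subfldD(1)[OF k] by force
  show "1 \<in> {poly p x | p. pover k p}" using pover_1[OF k] by force
  fix a assume "a \<in> {poly p x | p. pover k p}"
  then obtain p where p: "pover k p" "a = poly p x" by blast
  show "- a \<in> {poly p x | p. pover k p}" using p pover_uminus[OF k] by force
  fix b assume "b \<in> {poly p x | p. pover k p}"
  then obtain q where q: "pover k q" "b = poly q x" by blast
  show "a + b \<in> {poly p x | p. pover k p}" using p q pover_add[OF k] by force
  show "a * b \<in> {poly p x | p. pover k p}" using p q pover_mult[OF k] by force
qed

lemma sext_fracs: "sext k x = fracs {poly p x | p. pover k p}"
  unfolding sext_def fracs_def by blast

lemma fin_over_polys: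
  assumes k: "subfld k" and "algb k x"
  shows "fin_over k {poly p x | p. pover k p}"
proof -
  obtain m where m: "pover k m" "m \<noteq> 0" "poly m x = 0" using assms(2) unfolding algb_def by blast
  let ?T = "(\<lambda>i. x ^ i) ` {..degree m}"
  have "poly p x \<in> spn k ?T" if p: "pover k p" for p
  proof -
    obtain s r where sr: "pover k s" "pover k r" "p = m * s + r" "r = 0 \<or> degree r < degree m"
      using pover_divide[OF k m(1,2) p] by blast
    have "(\<Sum>i<n. coeff r i * x ^ i) \<in> spn k ?T" if "n \<le> Suc (degree m)" for n
      using that
    proof (induction n)
      case (Suc n)
      hence "coeff r n * x ^ n + (\<Sum>i<n. coeff r i * x ^ i) \<in> spn k ?T"
        using sr(2) by (intro spn_step) (auto simp: pover_def)
      thus ?case by (simp add: add.commute)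
    qed (simp add: spn_0)
    from this[of "Suc (degree r)"] have "poly r x \<in> spn k ?T"
      using sr(4) by (auto simp: poly_altdef lessThan_Suc_atMost)
    thus ?thesis using sr(3) m(3) by simp
  qed
  thus ?thesis unfolding fin_over_def by (intro exI[of _ ?T]) auto
qed

lemma pover_pcompose: "subfld k \<Longrightarrow> pover k p \<Longrightarrow> pover k q \<Longrightarrow> pover k (pcompose p q)"
proof (induction p)
  case (pCons a p)
  thus ?case
    by (auto simp: pcompose_pCons pover_pCons_iff pover_const pover_0 subfldD intro!: pover_add pover_mult)
qed simp

text \<open>By minimality the minimal polynomial has a nonzero constant term, and solving for that
  term exhibits the inverse.\<close>

lemma inverse_poly:
  assumes k: "subfld k" and "algb k y" "y \<noteq> 0"
  shows "\<exists>r. pover k r \<and> inverse y = poly r y"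
proof -
  obtain m where m: "pover k m" "m \<noteq> 0" "poly m y = 0"
    and min: "\<And>p. pover k p \<Longrightarrow> p \<noteq> 0 \<Longrightarrow> poly p y = 0 \<Longrightarrow> degree m \<le> degree p"
    using minimal_poly[OF assms(1,2)] by metis
  obtain c m' where m': "m = pCons c m'" by (rule pCons_cases)
  have c: "c \<in> k" "pover k m'" using m m' by (auto simp: pover_pCons_iff)
  have "c \<noteq> 0"
  proof
    assume "c = 0"
    hence "poly m' y = 0" "m' \<noteq> 0" using m m' assms(3) by auto
    thus False using min[of m'] c m' by simp
  qed
  hence "y * (- poly m' y / c) = 1" using m(3) m' by (simp add: field_simps add_eq_0_iff2)
  hence "inverse y = - poly m' y / c" by (rule inverse_unique)
  also have "\<dots> = poly (smult (- 1 / c) m') y" by simp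
  finally have "inverse y = poly (smult (- 1 / c) m') y" .
  moreover have "pover k (smult (- 1 / c) m')"
    by (intro pover_smult[OF k] c subfldD(8)[OF k] subfldD(5)[OF k] subfldD(2)[OF k])
  ultimately show ?thesis by (intro exI[of _ "smult (- 1 / c) m'"] conjI)
qed

text \<open>Values of polynomials at an algebraic \<open>x\<close> are algebraic, so their inverses
  are again polynomial values and the fractions collapse to k[x].\<close>

lemma fin_over_sext:
  assumes k: "subfld k" and x: "algb k x"
  shows "fin_over k (sext k x)"
proof -
  let ?R = "{poly p x | p. pover k p}"
  have alg: "algb k y" if "y \<in> ?R" for y
    by (rule fin_over_algb[OF k fin_over_polys[OF k x]]) (rule subrgD(6)[OF subrg_polys[OF k] that])
  have "sext k x \<subseteq> ?R"
  proof
    fix z assume "z \<in> sext k x"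
    then obtain p q where z: "pover k p" "pover k q" "poly q x \<noteq> 0" "z = poly p x / poly q x"
      by (rule sextE)
    obtain r where r: "pover k r" "inverse (poly q x) = poly r (poly q x)"
      using inverse_poly[OF k alg z(3)] z(2) by blast
    have "z = poly (p * pcompose r q) x" using r z by (simp add: divide_inverse poly_pcompose)
    thus "z \<in> ?R" using r z pover_mult[OF k] pover_pcompose[OF k] by blast
  qed
  thus ?thesis using fin_over_polys[OF k x] unfolding fin_over_def by blast
qed

lemma fin_over_self: "fin_over k k"
proof -
  have "c * 1 + 0 \<in> spn k {1}" if "c \<in> k" for c :: 'a
    by (intro spn.intros) (use that in auto)
  thus ?thesis unfolding fin_over_def by (intro exI[of _ "{1}"]) auto
qed

lemma finite_algebraic_extension:
  assumes k: "subfld k" and "finite S" "\<And>s. s \<in> S \<Longrightarrow> algb k s"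
  shows "\<exists>E. subfld E \<and> k \<subseteq> E \<and> S \<subseteq> E \<and> fin_over k E"
  using assms(2,3)
proof (induction S rule: finite_induct)
  case empty
  show ?case using k fin_over_self by blast
next
  case (insert s S)
  then obtain E where E: "subfld E" "k \<subseteq> E" "S \<subseteq> E" "fin_over k E" by auto
  have "algb E s" using insert.prems E(2) algb_mono by blast
  hence "fin_over k (sext E s)" using fin_over_trans[OF E(4) fin_over_sext[OF E(1)]] by blast
  thus ?case using E subfld_sext sext_base[OF E(1), of s] sext_gen[OF E(1), of s] by blast
qed

text \<open>The set \<open>S\<close> lies in a finite extension, over which \<open>x\<close>
  generates a finite extension; finiteness is transitive and gives back algebraicity.\<close>

lemma algb_trans:
  assumes k: "subfld k" and S: "finite S" "\<And>s. s \<in> S \<Longrightarrow> algb k s" and x: "algb (gen S) x"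
  shows "algb k x"
proof -
  obtain E where E: "subfld E" "k \<subseteq> E" "S \<subseteq> E" "fin_over k E"
    using finite_algebraic_extension[OF k S] by blast
  have "algb E x" using x gen_least[OF E(1,3)] algb_mono by blast
  hence "fin_over k (sext E x)" using fin_over_trans[OF E(4) fin_over_sext[OF E(1)]] by blast
  thus ?thesis
    by (rule fin_over_algb[OF k]) (intro subfldD(9)[OF subfld_sext] E sext_gen)
qed

text \<open>An equation for \<open>b\<close> with coefficients in k[x] is a bivariate relation,
  which can be read as an equation for \<open>x\<close> with coefficients in k[b].\<close>

lemma algb_exchange:
  assumes k: "subfld k" and "algb (sext k x) b" and nb: "\<not> algb k b"
  shows "algb (sext k b) x"
proof -
  let ?R = "{poly p x | p. pover k p}"
  obtain q where q: "pover (fracs ?R) q" "q \<noteq> 0" "poly q b = 0"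
    using assms(2) unfolding algb_def sext_fracs by blast
  obtain D where D: "D \<noteq> 0" "pover ?R (smult D q)"
    using common_denominator[OF subrg_polys[OF k] q(1)] by blast
  define r where "r = smult D q"
  have r: "pover ?R r" "r \<noteq> 0" "poly r b = 0" using D q by (auto simp: r_def)
  have "\<forall>j. \<exists>p. pover k p \<and> coeff r j = poly p x" using r(1) by (auto simp: pover_def)
  then obtain P where P: "\<And>j. pover k (P j)" "\<And>j. coeff r j = poly (P j) x" by metis
  define N where "N = Max ((\<lambda>j. degree (P j)) ` {..degree r})"
  have N: "degree (P j) \<le> N" if "j \<le> degree r" for j
    unfolding N_def using that by (intro Max_ge) auto
  \<comment> \<open>\<open>R i\<close> collects the coefficients of the i-th power of
    \<open>x\<close>. Should all of these vanish at \<open>b\<close>, they would be zero because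
    \<open>b\<close> is not algebraic over \<open>k\<close>, and with them the leading coefficient
    of \<open>r\<close>.\<close>
  define R where "R i = (\<Sum>j\<le>degree r. monom (coeff (P j) i) j)" for i
  have cR: "coeff (R i) j = (if j \<le> degree r then coeff (P j) i else 0)" for i j
    unfolding R_def coeff_sum by (simp add: sum.delta)
  have pR: "pover k (R i)" for i using P(1) subfldD[OF k] by (auto simp: pover_def cR)
  define Q where "Q = (\<Sum>i\<le>N. monom (poly (R i) b) i)"
  have cQ: "coeff Q i = (if i \<le> N then poly (R i) b else 0)" for i
    unfolding Q_def coeff_sum by (simp add: sum.delta)
  have Rin: "poly (R i) b \<in> sext k b" for i
    using sextI[OF pR pover_1[OF k], of b i] by simp
  have "poly Q x = (\<Sum>i\<le>N. \<Sum>j\<le>degree r. coeff (P j) i * b ^ j * x ^ i)"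
    unfolding Q_def poly_sum poly_monom R_def sum_distrib_right ..
  also have "\<dots> = (\<Sum>j\<le>degree r. (\<Sum>i\<le>N. coeff (P j) i * x ^ i) * b ^ j)"
    by (subst sum.swap) (simp add: sum_distrib_right sum_distrib_left ac_simps)
  also have "\<dots> = (\<Sum>j\<le>degree r. coeff r j * b ^ j)"
  proof (intro sum.cong refl arg_cong2[of _ _ _ _ "(*)"])
    fix j assume "j \<in> {..degree r}"
    hence "degree (P j) \<le> N" using N by simp
    thus "(\<Sum>i\<le>N. coeff (P j) i * x ^ i) = coeff r j"
      unfolding P(2) poly_altdef
      by (intro sum.mono_neutral_right) (auto simp: coeff_eq_0)
  qed
  also have "\<dots> = 0" using r(3) by (simp add: poly_altdef)
  finally have "poly Q x = 0" .
  moreover have "Q \<noteq> 0"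
  proof
    assume "Q = 0"
    hence z: "poly (R i) b = 0" if "i \<le> N" for i using cQ[of i] that by simp
    have "R i = 0" if "i \<le> N" for i using z[OF that] pR nb unfolding algb_def by blast
    hence "coeff (P j) i = 0" if "j \<le> degree r" "i \<le> N" for i j using cR[of i j] that by simp
    hence c0: "coeff (P (degree r)) i = 0" if "i \<le> N" for i using that by simp
    have "P (degree r) = 0"
    proof (rule poly_eqI)
      fix i show "coeff (P (degree r)) i = coeff 0 i"
      proof (cases "i \<le> N")
        case False
        thus ?thesis using N[of "degree r"] by (simp add: coeff_eq_0)
      qed (simp add: c0)
    qed
    hence "coeff r (degree r) = 0" using P(2) by simp
    thus False using r(2) by simp
  qed
  moreover have "pover (sext k b) Q"
    using Rin subfldD(1)[OF subfld_sext[OF k]] by (simp add: pover_def cQ)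
  ultimately show ?thesis unfolding algb_def by blast
qed

text \<open>Steinitz exchange: as long as some b in \<open>B\<close> is missing from
  \<open>S\<close>, it replaces an element of \<open>S\<close> outside \<open>B\<close>. The measure
  \<open>card (S - B)\<close> drops, and the process ends with \<open>B\<close> contained in a
  finite set.\<close>

lemma steinitz:
  assumes B: "alg_independent (B :: 'a::field_char_0 set)"
  shows "finite (S :: 'a set) \<Longrightarrow> (\<And>x. algb (gen S) x) \<Longrightarrow> finite B"
proof (induction "card (S - B)" arbitrary: S rule: less_induct)
  case less
  show ?case
  proof (cases "B \<subseteq> S")
    case True
    thus ?thesis using less.prems finite_subset by blast
  next
    case False
    then obtain b where b: "b \<in> B" "b \<notin> S" by blast
    let ?C = "S \<inter> B"
    have nb: "\<not> algb (gen ?C) b"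
      using independent_not_algb[OF B b(1)] algb_mono[OF _ gen_mono[of ?C "B - {b}"]] b(2) by blast
    \<comment> \<open>A smallest part \<open>X\<close> of S - B that makes \<open>b\<close>
      algebraic over it and the elements of \<open>B\<close> in \<open>S\<close>. It is nonempty by
      independence, and by minimality each of its elements can be exchanged for
      \<open>b\<close>.\<close>
    let ?P = "\<lambda>X. X \<subseteq> S - B \<and> algb (gen (?C \<union> X)) b"
    have "?C \<union> (S - B) = S" by blast
    hence "?P (S - B)" using less.prems(2)[of b] by simp
    then obtain X where X: "?P X" and min: "\<And>Y. ?P Y \<Longrightarrow> card X \<le> card Y"
      using ex_has_least_nat[of ?P "S - B" card] by blast
    have finX: "finite X" using X less.prems(1) finite_subset by blast
    have "X \<noteq> {}" using X nb by auto
    then obtain x where x: "x \<in> X" by blast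
    define k where "k = gen (?C \<union> (X - {x}))"
    have k: "subfld k" unfolding k_def by (rule subfld_gen)
    have "\<not> algb k b"
    proof
      assume "algb k b"
      hence "card X \<le> card (X - {x})" using X unfolding k_def by (intro min) auto
      thus False using x finX card_Diff1_less[OF finX x] by simp
    qed
    moreover have "insert x (?C \<union> (X - {x})) = ?C \<union> X" using x by blast
    hence "sext k x = gen (?C \<union> X)" unfolding k_def gen_insert[symmetric] by simp
    hence "algb (sext k x) b" using X by simp
    ultimately have "algb (sext k b) x" using algb_exchange[OF k] by blast
    define S' where "S' = insert b (S - {x})"
    have "sext k b \<subseteq> gen S'"
      unfolding k_def gen_insert[symmetric] S'_def using X x by (intro gen_mono) auto
    hence ax: "algb (gen S') x" using \<open>algb (sext k b) x\<close> algb_mono by blast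
    have "algb (gen S') s" if "s \<in> S" for s
    proof (cases "s = x")
      case False
      hence "s \<in> gen S'" using that gen_superset[of S'] unfolding S'_def by blast
      thus ?thesis by (rule algb_self[OF subfld_gen])
    qed (simp add: ax)
    hence all: "algb (gen S') z" for z
      by (rule algb_trans[OF subfld_gen less.prems(1) _ less.prems(2)])
    have "S' - B = (S - B) - {x}" using b unfolding S'_def by blast
    moreover have "x \<in> S - B" using X x by blast
    ultimately have "card (S' - B) < card (S - B)"
      using less.prems(1) card_Diff1_less[of "S - B" x] by simp
    moreover have "finite S'" using less.prems(1) by (simp add: S'_def)
    ultimately show ?thesis using less.hyps all by blast
  qed
qed

lemma infinite_independent_inf_tr:
  assumes "alg_independent (B :: 'a::field_char_0 set)" "infinite B"
  shows "inf_tr TYPE('a)"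
  unfolding inf_tr_def using steinitz[OF assms(1)] assms(2) by blast

lemma countable_pover: "countable k \<Longrightarrow> countable {p. pover k p}"
proof -
  assume k: "countable k"
  have "{p. pover k p} \<subseteq> Poly ` lists k"
  proof
    fix p assume "p \<in> {p. pover k p}"
    hence "set (coeffs p) \<subseteq> k" by (auto simp: pover_def coeffs_def)
    thus "p \<in> Poly ` lists k" by (intro image_eqI[of _ _ "coeffs p"]) auto
  qed
  thus ?thesis using k by (meson countable_image countable_lists countable_subset)
qed

lemma countable_sext: "countable k \<Longrightarrow> countable (sext k a)"
proof -
  assume k: "countable k"
  have "sext k a \<subseteq> (\<lambda>(p, q). poly p a / poly q a) ` ({p. pover k p} \<times> {p. pover k p})"
    unfolding sext_def by auto
  moreover have "countable ({p. pover k p} \<times> {p. pover k p})"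
    using countable_pover[OF k] by (intro countable_SIGMA)
  ultimately show ?thesis by (meson countable_image countable_subset)
qed

lemma countable_gen: "finite S \<Longrightarrow> countable (gen (S :: 'a::field_char_0 set))"
proof (induction S rule: finite_induct)
  case empty
  have "gen {} \<subseteq> (\<rat> :: 'a set)" by (intro gen_least subfld_Rats) auto
  moreover have "countable (\<rat> :: 'a set)" unfolding Rats_def by (intro countable_image) simp
  ultimately show ?case using countable_subset by blast
qed (simp add: gen_insert countable_sext)

text \<open>Only countably many numbers are algebraic over a finitely generated, hence countable,
  subfield.\<close>

lemma inf_tr_complex: "inf_tr TYPE(complex)"
  unfolding inf_tr_def
proof (intro allI impI)
  fix S :: "complex set" assume "finite S"
  hence "countable (gen S)" by (rule countable_gen)
  hence "countable ({p. pover (gen S) p} - {0})" using countable_pover by blast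
  moreover have "{x. algb (gen S) x} = (\<Union>p\<in>{p. pover (gen S) p} - {0}. {x. poly p x = 0})"
    by (auto simp: algb_def)
  moreover have "countable {x. poly p x = 0}" if "p \<in> {p. pover (gen S) p} - {0}" for p
    using that by (intro countable_finite poly_roots_finite) auto
  ultimately have "countable {x. algb (gen S) x}" using countable_UN by metis
  thus "\<exists>x. \<not> algb (gen S) x" using uncountable_UNIV_complex by (metis UNIV_eq_I mem_Collect_eq)
qed

section \<open>A sentence about algebraicity over finitely many elements\<close>

definition "Univ n \<phi> = Neg (Exi n (Neg \<phi>))"
definition "Imp \<phi> \<psi> = Neg (Conj \<phi> (Neg \<psi>))"
definition "Iff \<phi> \<psi> = Conj (Imp \<phi> \<psi>) (Imp \<psi> \<phi>)"
definition "Disj \<phi> \<psi> = Neg (Conj (Neg \<phi>) (Neg \<psi>))"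

lemma sat_Univ [simp]: "satisfies D le e (Univ n \<phi>) \<longleftrightarrow> (\<forall>a\<in>D. satisfies D le (e(n := a)) \<phi>)"
  and sat_Imp [simp]: "satisfies D le e (Imp \<phi> \<psi>) \<longleftrightarrow> (satisfies D le e \<phi> \<longrightarrow> satisfies D le e \<psi>)"
  and sat_Disj [simp]: "satisfies D le e (Disj \<phi> \<psi>) \<longleftrightarrow> (satisfies D le e \<phi> \<or> satisfies D le e \<psi>)"
  and sat_Iff [simp]: "satisfies D le e (Iff \<phi> \<psi>) \<longleftrightarrow> (satisfies D le e \<phi> \<longleftrightarrow> satisfies D le e \<psi>)"
  by (auto simp: Univ_def Imp_def Disj_def Iff_def)

primrec exs :: "nat \<Rightarrow> po_formula \<Rightarrow> po_formula" where
  "exs 0 \<phi> = \<phi>"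
| "exs (Suc N) \<phi> = exs N (Exi N \<phi>)"

lemma satisfies_exs:
  "satisfies D le e (exs N \<phi>) \<longleftrightarrow>
     (\<exists>e'. (\<forall>n<N. e' n \<in> D) \<and> (\<forall>n\<ge>N. e' n = e n) \<and> satisfies D le e' \<phi>)"
proof (induction N arbitrary: \<phi>)
  case 0
  have "(\<forall>n. e' n = e n) \<longleftrightarrow> e' = e" for e' by auto
  thus ?case by simp
next
  case (Suc N)
  show ?case unfolding exs.simps Suc satisfies.simps
  proof (intro iffI; elim exE conjE bexE)
    fix e' a assume *: "\<forall>n<N. e' n \<in> D" "\<forall>n\<ge>N. e' n = e n" "a \<in> D" "satisfies D le (e'(N := a)) \<phi>"
    hence "(\<forall>n<Suc N. (e'(N := a)) n \<in> D) \<and> (\<forall>n\<ge>Suc N. (e'(N := a)) n = e n)"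
      by (auto simp: less_Suc_eq)
    thus "\<exists>e'. (\<forall>n<Suc N. e' n \<in> D) \<and> (\<forall>n\<ge>Suc N. e' n = e n) \<and> satisfies D le e' \<phi>"
      using *(4) by blast
  next
    fix e' assume *: "\<forall>n<Suc N. e' n \<in> D" "\<forall>n\<ge>Suc N. e' n = e n" "satisfies D le e' \<phi>"
    have "(\<forall>n<N. (e'(N := e N)) n \<in> D) \<and> (\<forall>n\<ge>N. (e'(N := e N)) n = e n)"
    proof (intro conjI allI impI)
      fix n assume "N \<le> n"
      thus "(e'(N := e N)) n = e n" using *(2) by (cases "n = N") auto
    qed (use *(1) in auto)
    moreover have "satisfies D le ((e'(N := e N))(N := e' N)) \<phi>" using *(3) by simp
    ultimately show "\<exists>e'. (\<forall>n<N. e' n \<in> D) \<and> (\<forall>n\<ge>N. e' n = e n) \<and> (\<exists>a\<in>D. satisfies D le (e'(N := a)) \<phi>)"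
      using * by (intro exI[of _ "e'(N := e N)"] conjI bexI[of _ "e' N"]) auto
  qed
qed

lemma free_vars_exs: "free_vars (exs N \<phi>) = free_vars \<phi> - {..<N}"
  by (induction N arbitrary: \<phi>) (auto simp: less_Suc_eq)

lemma finite_free_vars: "finite (free_vars \<phi>)"
  by (induction \<phi>) auto

text \<open>Elementary equivalence speaks of sentences. Binding all free variables existentially
  transfers the existence of suitable parameters, though nothing about which elements they
  are.\<close>

lemma elementarily_equivalent_ex:
  assumes "elementarily_equivalent D le D' le'" "D \<noteq> {}" "D' \<noteq> {}"
    and e: "\<forall>n. e n \<in> D" "satisfies D le e \<phi>"
  shows "\<exists>e'. (\<forall>n. e' n \<in> D') \<and> satisfies D' le' e' \<phi>"
proof -
  obtain N where N: "free_vars \<phi> \<subseteq> {..<N}"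
    using finite_free_vars[of \<phi>] finite_nat_iff_bounded by blast
  have s: "sentence (exs N \<phi>)" using N by (auto simp: sentence_def free_vars_exs)
  have loc: "satisfies D le e1 \<psi> \<longleftrightarrow> satisfies D le e2 \<psi>"
    if "\<And>n. n \<in> free_vars \<psi> \<Longrightarrow> e1 n = e2 n" for \<psi> e1 e2
    using that
  proof (induction \<psi> arbitrary: e1 e2)
    case (Exi i \<psi>)
    have "satisfies D le (e1(i := a)) \<psi> \<longleftrightarrow> satisfies D le (e2(i := a)) \<psi>" for a
      by (rule Exi.IH) (use Exi.prems in auto)
    thus ?case by simp
  next
    case (Conj \<psi>1 \<psi>2)
    have "satisfies D le e1 \<psi>1 \<longleftrightarrow> satisfies D le e2 \<psi>1" by (rule Conj.IH(1)) (use Conj.prems in simp)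
    moreover have "satisfies D le e1 \<psi>2 \<longleftrightarrow> satisfies D le e2 \<psi>2" by (rule Conj.IH(2)) (use Conj.prems in simp)
    ultimately show ?case by simp
  next
    case (Neg \<psi>)
    have "satisfies D le e1 \<psi> \<longleftrightarrow> satisfies D le e2 \<psi>" by (rule Neg.IH) (use Neg.prems in simp)
    thus ?case by simp
  qed simp_all
  have "models D le (exs N \<phi>)" unfolding models_def
  proof (intro allI impI)
    fix e1 :: "nat \<Rightarrow> 'a"
    have "satisfies D le e (exs N \<phi>)" unfolding satisfies_exs
      by (rule exI[of _ e]) (use e in simp)
    moreover have "satisfies D le e (exs N \<phi>) \<longleftrightarrow> satisfies D le e1 (exs N \<phi>)"
      by (rule loc) (use s in \<open>simp add: sentence_def\<close>)
    ultimately show "satisfies D le e1 (exs N \<phi>)" by simp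
  qed
  hence m: "models D' le' (exs N \<phi>)" using assms(1) s unfolding elementarily_equivalent_def by blast
  obtain d where "d \<in> D'" using assms(3) by blast
  hence "satisfies D' le' (\<lambda>_. d) (exs N \<phi>)" using m by (simp add: models_def)
  from this[unfolded satisfies_exs] obtain e' where
    e': "\<forall>n<N. e' n \<in> D'" "\<forall>n\<ge>N. e' n = d" "satisfies D' le' e' \<phi>" by (elim exE conjE) simp
  have "e' n \<in> D'" for n using e' \<open>d \<in> D'\<close> by (cases "n < N") auto
  thus ?thesis using e'(3) by (intro exI[of _ e'] conjI allI)
qed

section \<open>The separating sentence, first as a property of structures\<close>

definition sing :: "'s set \<Rightarrow> ('s \<Rightarrow> 's \<Rightarrow> bool) \<Rightarrow> 's \<Rightarrow> 's \<Rightarrow> 's \<Rightarrow> bool" where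
  "sing D le d a p \<longleftrightarrow> le p d \<and> le p a \<and> (\<forall>q\<in>D. le q d \<and> le q a \<longrightarrow> q = p)"

text \<open>For three lines through a common point \<open>ct\<close> this means that
  \<open>p\<close>, \<open>q\<close>, \<open>s\<close> are collinear. The witness \<open>d\<close>
  may be any curve with one intersection point on each line; \<open>collinear\<close> shows that
  this suffices.\<close>

definition trans3 :: "'s set \<Rightarrow> ('s \<Rightarrow> 's \<Rightarrow> bool) \<Rightarrow> 's \<Rightarrow> 's \<Rightarrow> 's \<Rightarrow> 's \<Rightarrow> 's \<Rightarrow> 's \<Rightarrow> 's \<Rightarrow> bool" where
  "trans3 D le a0 a1 a2 ct p q s \<longleftrightarrow> p \<noteq> ct \<and> q \<noteq> ct \<and> s \<noteq> ct \<and>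
     (\<exists>d\<in>D. sing D le d a0 p \<and> sing D le d a1 q \<and> sing D le d a2 s)"

text \<open>Parallel transport in the chart where \<open>a0\<close>, \<open>a1\<close>,
  \<open>a2\<close> are x = 0, x = 1 and infinity. From the origin \<open>E\<close>, slope s leads
  to p' = (1, s); slope 0 carries it back to p = (0, s); slope t leads from there to p'' = (1, s +
  t), whose slope seen from \<open>E\<close> is s + t.\<close>

definition AD where
  "AD D le a0 a1 a2 ct z E x y w \<longleftrightarrow> (\<exists>p\<in>D. \<exists>p'\<in>D. \<exists>p''\<in>D.
     trans3 D le a0 a1 a2 ct E p' x \<and> trans3 D le a0 a1 a2 ct p p' z \<and>
     trans3 D le a0 a1 a2 ct p p'' y \<and> trans3 D le a0 a1 a2 ct E p'' w)"

text \<open>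
  The parameters \<open>e 0, \<dots>, e 8\<close> are, in this order: the line at infinity \<open>x\<^sub>3 = 0\<close>, the lines
  \<open>x\<^sub>1 = 0\<close>, \<open>x\<^sub>1 = x\<^sub>3\<close>, \<open>x\<^sub>2 = 0\<close>, \<open>x\<^sub>2 = x\<^sub>3\<close>, and the points \<open>[0:1:0]\<close>, \<open>[1:0:0]\<close>, \<open>[0:0:1]\<close>, \<open>[1:1:0]\<close>.
  The universe consists of the points \<open>[1:s:0]\<close>; \<open>Ad\<close> adds \<open>s\<close>, and \<open>Ha\<close> adds the reciprocals \<open>1 / s\<close>.
\<close>

definition Uni :: "'s set \<Rightarrow> ('s \<Rightarrow> 's \<Rightarrow> bool) \<Rightarrow> (nat \<Rightarrow> 's) \<Rightarrow> 's set" where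
  "Uni D le e = {u \<in> D. le u (e 0) \<and> u \<noteq> e 0 \<and> u \<noteq> e 5}"

definition Ad where "Ad D le (e :: nat \<Rightarrow> _) = AD D le (e 1) (e 2) (e 0) (e 5) (e 6) (e 7)"

definition Ha where "Ha D le (e :: nat \<Rightarrow> _) = AD D le (e 3) (e 4) (e 0) (e 6) (e 5) (e 7)"

text \<open>Here c = 1 - a and d = a (1 - a), so that b = a - d. For a = 0 or a = 1 one of a, c has
  slope 0, whose reciprocal is undefined; these two cases are listed separately.\<close>

definition Sq where
  "Sq D le (e :: nat \<Rightarrow> _) a b \<longleftrightarrow> a = e 6 \<and> b = e 6 \<or> a = e 8 \<and> b = e 8 \<or> a \<noteq> e 6 \<and> a \<noteq> e 8 \<and>
     (\<exists>c\<in>D. \<exists>d\<in>D. Ad D le e a c (e 8) \<and> Ha D le e a c d \<and> Ad D le e b d a)"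

text \<open>Multiplication is recovered from squares by \<open>(x + y)\<^sup>2 = x\<^sup>2 + y\<^sup>2 + 2 x y\<close>,
  and squares from \<open>1 / x + 1 / (1 - x) = 1 / (x - x\<^sup>2)\<close>.\<close>

definition Mu where
  "Mu D le (e :: nat \<Rightarrow> _) x y z \<longleftrightarrow> (\<exists>u\<in>D. \<exists>p\<in>D. \<exists>q\<in>D. \<exists>r\<in>D. \<exists>t\<in>D. \<exists>t'\<in>D.
     Ad D le e x y u \<and> Sq D le e x p \<and> Sq D le e y q \<and> Sq D le e u r \<and>
     Ad D le e p q t \<and> Ad D le e z z t' \<and> Ad D le e t t' r)"

text \<open>In an arbitrary structure \<open>Ad\<close> and \<open>Mu\<close> are mere ternary
  relations. The axioms make them the graphs of ring operations without zero divisors, which bounds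
  the number of solutions of an equation.\<close>

definition ring_rel :: "'s set \<Rightarrow> ('s \<Rightarrow> 's \<Rightarrow> 's \<Rightarrow> bool) \<Rightarrow> ('s \<Rightarrow> 's \<Rightarrow> 's \<Rightarrow> bool) \<Rightarrow> 's \<Rightarrow> bool" where
  "ring_rel U A M z \<longleftrightarrow> z \<in> U \<and>
     (\<forall>x\<in>U. \<forall>y\<in>U. \<exists>w\<in>U. A x y w) \<and>
     (\<forall>x\<in>U. \<forall>y\<in>U. \<forall>w\<in>U. \<forall>w'\<in>U. A x y w \<longrightarrow> A x y w' \<longrightarrow> w = w') \<and>
     (\<forall>x\<in>U. \<forall>y\<in>U. \<forall>w\<in>U. A x y w \<longrightarrow> A y x w) \<and>
     (\<forall>x\<in>U. \<forall>y\<in>U. \<forall>w\<in>U. \<forall>a\<in>U. \<forall>b\<in>U. \<forall>c\<in>U. A x y a \<longrightarrow> A a w b \<longrightarrow> A y w c \<longrightarrow> A x c b) \<and>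
     (\<forall>x\<in>U. A x z x) \<and>
     (\<forall>x\<in>U. \<forall>y\<in>U. \<exists>w\<in>U. A x w y) \<and>
     (\<forall>x\<in>U. \<forall>y\<in>U. \<exists>w\<in>U. M x y w) \<and>
     (\<forall>x\<in>U. \<forall>y\<in>U. \<forall>w\<in>U. \<forall>w'\<in>U. M x y w \<longrightarrow> M x y w' \<longrightarrow> w = w') \<and>
     (\<forall>x\<in>U. \<forall>y\<in>U. \<forall>w\<in>U. M x y w \<longrightarrow> M y x w) \<and>
     (\<forall>x\<in>U. \<forall>y\<in>U. \<forall>w\<in>U. \<forall>a\<in>U. \<forall>b\<in>U. \<forall>c\<in>U. M x y a \<longrightarrow> M a w b \<longrightarrow> M y w c \<longrightarrow> M x c b) \<and>
     (\<forall>x\<in>U. \<forall>y\<in>U. \<forall>w\<in>U. \<forall>a\<in>U. \<forall>b\<in>U. \<forall>c\<in>U. \<forall>d\<in>U.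
        M x y a \<longrightarrow> M x w b \<longrightarrow> A y w c \<longrightarrow> A a b d \<longrightarrow> M x c d) \<and>
     (\<forall>x\<in>U. \<forall>y\<in>U. M x y z \<longrightarrow> x = z \<or> y = z)"

text \<open>Singletons have codes, and adding one element to a coded set gives a coded set; by
  induction every finite nonempty set is coded. The condition on \<open>L\<close> excludes elements
  above the whole line, whose trace on it need not be finite.\<close>

definition fin_rel :: "'s set \<Rightarrow> ('s \<Rightarrow> 's \<Rightarrow> bool) \<Rightarrow> 's \<Rightarrow> 's set \<Rightarrow> bool" where
  "fin_rel D le L U \<longleftrightarrow>
     (\<forall>x\<in>U. \<exists>d\<in>D. \<not> le L d \<and> (\<forall>w\<in>U. le w d \<longleftrightarrow> w = x)) \<and>
     (\<forall>d\<in>D. \<not> le L d \<longrightarrow> (\<forall>x\<in>U. \<exists>d'\<in>D. \<not> le L d' \<and> (\<forall>w\<in>U. le w d' \<longleftrightarrow> le w d \<or> w = x)))"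

text \<open>
  Finite subsets of the universe are encoded by curves \<open>d\<close>. In a structure satisfying \<open>fin_rel\<close>,
  the quantifier over \<open>d'\<close> says that all elements of the finite set coded by \<open>d\<close> are obtained from \<open>T\<close>
  by steps \<open>w' \<mapsto> m + x w'\<close> with \<open>m\<close> in \<open>T\<close>, as in Horner's scheme.
\<close>

definition Hor where
  "Hor D le (e :: nat \<Rightarrow> _) T x z \<longleftrightarrow> z \<in> Uni D le e \<and> (\<exists>d\<in>D. \<not> le (e 0) d \<and> le z d \<and>
     (\<forall>d'\<in>D. (\<exists>w\<in>Uni D le e. le w d \<and> le w d') \<longrightarrow>
       (\<exists>w\<in>Uni D le e. le w d \<and> le w d' \<and> (T w \<or>
          (\<exists>m\<in>Uni D le e. \<exists>w'\<in>Uni D le e. \<exists>v\<in>Uni D le e. T m \<and> le w' d \<and> \<not> le w' d' \<and>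
             Mu D le e x w' v \<and> Ad D le e m v w)))))"

text \<open>A tower of rings: level 0 is {0, 1, -1}, the last clause being x + 1 = 0, and each level
  adjoins one parameter by polynomial expressions over the level before.\<close>

primrec Ts :: "'s set \<Rightarrow> ('s \<Rightarrow> 's \<Rightarrow> bool) \<Rightarrow> (nat \<Rightarrow> 's) \<Rightarrow> nat \<Rightarrow> 's \<Rightarrow> bool" where
  "Ts D le e 0 x \<longleftrightarrow> x = e 6 \<or> x = e 8 \<or> Ad D le e x (e 8) (e 6)"
| "Ts D le e (Suc i) x \<longleftrightarrow> Hor D le e (Ts D le e i) (e (9 + i)) x"

text \<open>An equation x h(x) = v with v nonzero: the constant term alone certifies that the
  equation is not trivial, and the coefficients of h stay hidden in \<open>Hor\<close>.\<close>

definition Alg where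
  "Alg D le (e :: nat \<Rightarrow> _) T x \<longleftrightarrow> x = e 6 \<or> (\<exists>z\<in>Uni D le e. \<exists>v\<in>Uni D le e. Hor D le e T x z \<and> Mu D le e x z v \<and> T v \<and> v \<noteq> e 6)"

text \<open>The axioms are part of the property, so that nothing about the position of the
  parameters has to be known in a structure that satisfies it.\<close>

definition Phi where
  "Phi D le (e :: nat \<Rightarrow> _) k \<longleftrightarrow> ring_rel (Uni D le e) (Ad D le e) (Mu D le e) (e 6) \<and>
     e 8 \<in> Uni D le e \<and> fin_rel D le (e 0) (Uni D le e) \<and> (\<forall>x\<in>Uni D le e. Alg D le e (Ts D le e k) x)"

text \<open>In all formula builders the argument \<open>n\<close> bounds the variables in use from
  above; bound variables are taken from \<open>n\<close> on.\<close>

definition "fSing n d a p = Conj (Le p d) (Conj (Le p a) (Univ n (Imp (Conj (Le n d) (Le n a)) (Eq n p))))"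

lemma sat_fSing [simp]:
  "d < n \<Longrightarrow> a < n \<Longrightarrow> p < n \<Longrightarrow> satisfies D le e (fSing n d a p) \<longleftrightarrow> sing D le (e d) (e a) (e p)"
  by (auto simp: fSing_def sing_def)

definition "fTrans n a0 a1 a2 ct p q s = Conj (Neg (Eq p ct)) (Conj (Neg (Eq q ct)) (Conj (Neg (Eq s ct))
   (Exi n (Conj (fSing (Suc n) n a0 p) (Conj (fSing (Suc n) n a1 q) (fSing (Suc n) n a2 s))))))"

lemma sat_fTrans [simp]:
  "a0 < n \<Longrightarrow> a1 < n \<Longrightarrow> a2 < n \<Longrightarrow> ct < n \<Longrightarrow> p < n \<Longrightarrow> q < n \<Longrightarrow> s < n \<Longrightarrow>
   satisfies D le e (fTrans n a0 a1 a2 ct p q s) \<longleftrightarrow> trans3 D le (e a0) (e a1) (e a2) (e ct) (e p) (e q) (e s)"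
  by (simp add: fTrans_def trans3_def)

definition "fAD n a0 a1 a2 ct z E x y w = Exi n (Exi (n + 1) (Exi (n + 2)
   (Conj (fTrans (n + 3) a0 a1 a2 ct E (n + 1) x) (Conj (fTrans (n + 3) a0 a1 a2 ct n (n + 1) z)
   (Conj (fTrans (n + 3) a0 a1 a2 ct n (n + 2) y) (fTrans (n + 3) a0 a1 a2 ct E (n + 2) w))))))"

lemma sat_fAD [simp]:
  "a0 < n \<Longrightarrow> a1 < n \<Longrightarrow> a2 < n \<Longrightarrow> ct < n \<Longrightarrow> z < n \<Longrightarrow> E < n \<Longrightarrow> x < n \<Longrightarrow> y < n \<Longrightarrow> w < n \<Longrightarrow>
   satisfies D le e (fAD n a0 a1 a2 ct z E x y w) \<longleftrightarrow>
   AD D le (e a0) (e a1) (e a2) (e ct) (e z) (e E) (e x) (e y) (e w)"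
  by (simp add: fAD_def AD_def)

text \<open>Only the parameters below 9 matter to these notions, so bound variables numbered from 9
  on do not disturb them.\<close>

lemma Uni_upd [simp]: "9 \<le> n \<Longrightarrow> Uni D le (e(n := v)) = Uni D le e"
  and Ad_upd [simp]: "9 \<le> n \<Longrightarrow> Ad D le (e(n := v)) = Ad D le e"
  and Ha_upd [simp]: "9 \<le> n \<Longrightarrow> Ha D le (e(n := v)) = Ha D le e"
  by (simp_all add: Uni_def Ad_def Ha_def)

lemma Sq_upd [simp]: "9 \<le> n \<Longrightarrow> Sq D le (e(n := v)) = Sq D le e"
  by (intro ext) (simp add: Sq_def)

lemma Mu_upd [simp]: "9 \<le> n \<Longrightarrow> Mu D le (e(n := v)) = Mu D le e"
  by (intro ext) (simp add: Mu_def)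

lemma Hor_upd [simp]: "9 \<le> n \<Longrightarrow> Hor D le (e(n := v)) = Hor D le e"
  by (intro ext) (simp add: Hor_def)

lemma Ts_upd [simp]: "9 + i \<le> n \<Longrightarrow> Ts D le (e(n := v)) i = Ts D le e i"
proof (induction i)
  case (Suc i)
  have 1: "Ts D le (e(n := v)) i = Ts D le e i" by (rule Suc.IH) (use Suc.prems in simp)
  show ?case
  proof (rule ext)
    fix x show "Ts D le (e(n := v)) (Suc i) x = Ts D le e (Suc i) x"
      unfolding Ts.simps 1 using Suc.prems by simp
  qed
qed (simp add: fun_eq_iff)

definition "fU x = Conj (Le x 0) (Conj (Neg (Eq x 0)) (Neg (Eq x 5)))"

definition "AllU n \<phi> = Univ n (Imp (fU n) \<phi>)"
definition "ExU n \<phi> = Exi n (Conj (fU n) \<phi>)"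

lemma sat_fU: "e x \<in> D \<Longrightarrow> satisfies D le e (fU x) \<longleftrightarrow> e x \<in> Uni D le e"
  by (simp add: fU_def Uni_def)

lemma sat_AllU [simp]: "9 \<le> n \<Longrightarrow> satisfies D le e (AllU n \<phi>) \<longleftrightarrow> (\<forall>u\<in>Uni D le e. satisfies D le (e(n := u)) \<phi>)"
  and sat_ExU [simp]: "9 \<le> n \<Longrightarrow> satisfies D le e (ExU n \<phi>) \<longleftrightarrow> (\<exists>u\<in>Uni D le e. satisfies D le (e(n := u)) \<phi>)"
  by (auto simp: AllU_def ExU_def fU_def Uni_def)

definition "fA n = fAD n 1 2 0 5 6 7"
definition "fH n = fAD n 3 4 0 6 5 7"

lemma sat_fA [simp]: "9 \<le> n \<Longrightarrow> x < n \<Longrightarrow> y < n \<Longrightarrow> w < n \<Longrightarrow>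
   satisfies D le e (fA n x y w) \<longleftrightarrow> Ad D le e (e x) (e y) (e w)"
  by (simp add: fA_def Ad_def)

lemma sat_fH [simp]: "9 \<le> n \<Longrightarrow> x < n \<Longrightarrow> y < n \<Longrightarrow> w < n \<Longrightarrow>
   satisfies D le e (fH n x y w) \<longleftrightarrow> Ha D le e (e x) (e y) (e w)"
  by (simp add: fH_def Ha_def)

definition "fSq n a b = Disj (Conj (Eq a 6) (Eq b 6)) (Disj (Conj (Eq a 8) (Eq b 8))
   (Conj (Neg (Eq a 6)) (Conj (Neg (Eq a 8)) (Exi n (Exi (n + 1)
     (Conj (fA (n + 2) a n 8) (Conj (fH (n + 2) a n (n + 1)) (fA (n + 2) b (n + 1) a))))))))"

lemma sat_fSq [simp]: "9 \<le> n \<Longrightarrow> a < n \<Longrightarrow> b < n \<Longrightarrow>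
   satisfies D le e (fSq n a b) \<longleftrightarrow> Sq D le e (e a) (e b)"
  by (simp add: fSq_def Sq_def)

definition "fM n x y z = Exi n (Exi (n + 1) (Exi (n + 2) (Exi (n + 3) (Exi (n + 4) (Exi (n + 5)
   (Conj (fA (n + 6) x y n) (Conj (fSq (n + 6) x (n + 1)) (Conj (fSq (n + 6) y (n + 2)) (Conj (fSq (n + 6) n (n + 3))
   (Conj (fA (n + 6) (n + 1) (n + 2) (n + 4)) (Conj (fA (n + 6) z z (n + 5)) (fA (n + 6) (n + 4) (n + 5) (n + 3)))))))))))))"

lemma sat_fM [simp]: "9 \<le> n \<Longrightarrow> x < n \<Longrightarrow> y < n \<Longrightarrow> z < n \<Longrightarrow>
   satisfies D le e (fM n x y z) \<longleftrightarrow> Mu D le e (e x) (e y) (e z)"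
  by (simp add: fM_def Mu_def)

primrec conjs :: "po_formula list \<Rightarrow> po_formula" where
  "conjs [] = Eq 0 0"
| "conjs (\<phi> # \<phi>s) = Conj \<phi> (conjs \<phi>s)"

lemma sat_conjs [simp]: "satisfies D le e (conjs \<phi>s) \<longleftrightarrow> (\<forall>\<phi>\<in>set \<phi>s. satisfies D le e \<phi>)"
  by (induction \<phi>s) auto

definition "fRing n = (let x = n; y = n + 1; w = n + 2; a = n + 3; b = n + 4; c = n + 5; d = n + 6;
    A = fA (n + 7); M = fM (n + 7) in conjs [
    AllU x (AllU y (ExU w (A x y w))),
    AllU x (AllU y (AllU w (AllU a (Imp (A x y w) (Imp (A x y a) (Eq w a)))))),
    AllU x (AllU y (AllU w (Imp (A x y w) (A y x w)))),
    AllU x (AllU y (AllU w (AllU a (AllU b (AllU c (Imp (A x y a) (Imp (A a w b) (Imp (A y w c) (A x c b))))))))),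
    AllU x (A x 6 x),
    AllU x (AllU y (ExU w (A x w y))),
    AllU x (AllU y (ExU w (M x y w))),
    AllU x (AllU y (AllU w (AllU a (Imp (M x y w) (Imp (M x y a) (Eq w a)))))),
    AllU x (AllU y (AllU w (Imp (M x y w) (M y x w)))),
    AllU x (AllU y (AllU w (AllU a (AllU b (AllU c (Imp (M x y a) (Imp (M a w b) (Imp (M y w c) (M x c b))))))))),
    AllU x (AllU y (AllU w (AllU a (AllU b (AllU c (AllU d
       (Imp (M x y a) (Imp (M x w b) (Imp (A y w c) (Imp (A a b d) (M x c d))))))))))),
    AllU x (AllU y (Imp (M x y 6) (Disj (Eq x 6) (Eq y 6))))])"

lemma sat_fRing:
  assumes "9 \<le> n" "e 6 \<in> Uni D le e"
  shows "satisfies D le e (fRing n) \<longleftrightarrow> ring_rel (Uni D le e) (Ad D le e) (Mu D le e) (e 6)"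
  unfolding fRing_def Let_def ring_rel_def using assms
  by simp

definition "fFin n = Conj
   (AllU n (Exi (n + 1) (Conj (Neg (Le 0 (n + 1))) (AllU (n + 2) (Iff (Le (n + 2) (n + 1)) (Eq (n + 2) n))))))
   (Univ n (Imp (Neg (Le 0 n)) (AllU (n + 1) (Exi (n + 2) (Conj (Neg (Le 0 (n + 2)))
      (AllU (n + 3) (Iff (Le (n + 3) (n + 2)) (Disj (Le (n + 3) n) (Eq (n + 3) (n + 1))))))))))"

text \<open>\<open>tf m v\<close> stands for a formula about variable \<open>v\<close> whose own
  bound variables start at \<open>m\<close>; the value n + 6 lies above all six variables bound
  here.\<close>

definition "fHor n tf x z = Conj (fU z) (Exi n (Conj (Neg (Le 0 n)) (Conj (Le z n)
   (Univ (n + 1) (Imp (ExU (n + 2) (Conj (Le (n + 2) n) (Le (n + 2) (n + 1))))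
      (ExU (n + 2) (Conj (Le (n + 2) n) (Conj (Le (n + 2) (n + 1)) (Disj (tf (n + 6) (n + 2))
         (ExU (n + 3) (ExU (n + 4) (ExU (n + 5) (Conj (tf (n + 6) (n + 3)) (Conj (Le (n + 4) n) (Conj (Neg (Le (n + 4) (n + 1)))
            (Conj (fM (n + 6) x (n + 4) (n + 5)) (fA (n + 6) (n + 3) (n + 5) (n + 2))))))))))))))))))"

lemma sat_fFin:
  assumes "9 \<le> n"
  shows "satisfies D le e (fFin n) \<longleftrightarrow> fin_rel D le (e 0) (Uni D le e)"
  unfolding fFin_def fin_rel_def using assms by simp

lemma sat_fHor:
  assumes "9 \<le> n" "x < n" "z < n" "e z \<in> D"
    and "\<And>m v e'. n \<le> m \<Longrightarrow> v < m \<Longrightarrow> (\<And>i. i < n \<Longrightarrow> e' i = e i) \<Longrightarrow> e' v \<in> D \<Longrightarrow>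
       satisfies D le e' (tf m v) \<longleftrightarrow> T (e' v)"
  shows "satisfies D le e (fHor n tf x z) \<longleftrightarrow> Hor D le e T (e x) (e z)"
proof -
  have U: "u \<in> D" if "u \<in> Uni D le e" for u using that by (simp add: Uni_def)
  show ?thesis unfolding fHor_def Hor_def using assms
    by (simp add: sat_fU U cong: bex_cong ball_cong conj_cong)
qed

primrec fT :: "nat \<Rightarrow> nat \<Rightarrow> nat \<Rightarrow> po_formula" where
  "fT 0 n x = Disj (Eq x 6) (Disj (Eq x 8) (fA n x 8 6))"
| "fT (Suc i) n x = fHor n (fT i) (9 + i) x"

lemma Ts_cong:
  assumes "\<And>j. j < 9 + i \<Longrightarrow> e' j = e j" shows "Ts D le e' i = Ts D le e i"
  using assms
proof (induction i)
  case 0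
  have "Ad D le e' = Ad D le e" using 0 by (simp add: Ad_def)
  thus ?case using 0 by (simp add: fun_eq_iff)
next
  case (Suc i)
  have *: "e' j = e j" if "j < 10 + i" for j using Suc.prems[of j] that by simp
  have "Ad D le e' = Ad D le e" "Uni D le e' = Uni D le e" "Ha D le e' = Ha D le e"
    by (simp_all add: Ad_def Uni_def Ha_def *)
  hence "Sq D le e' = Sq D le e" by (intro ext) (simp add: Sq_def *)
  hence "Mu D le e' = Mu D le e" using \<open>Ad D le e' = Ad D le e\<close> by (intro ext) (simp add: Mu_def)
  hence "Hor D le e' = Hor D le e"
    using \<open>Ad D le e' = Ad D le e\<close> \<open>Uni D le e' = Uni D le e\<close> by (intro ext) (simp add: Hor_def *)
  moreover have "Ts D le e' i = Ts D le e i" using Suc by simp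
  ultimately show ?case by (intro ext) (simp add: *)
qed

lemma sat_fT:
  "9 + i \<le> n \<Longrightarrow> x < n \<Longrightarrow> e x \<in> D \<Longrightarrow> satisfies D le e (fT i n x) \<longleftrightarrow> Ts D le e i (e x)"
proof (induction i arbitrary: n x e)
  case (Suc i)
  show ?case unfolding fT.simps Ts.simps
  proof (rule sat_fHor)
    fix m v e' assume *: "n \<le> m" "v < m" "\<And>i. i < n \<Longrightarrow> e' i = e i" "e' v \<in> D"
    have "Ts D le e' i = Ts D le e i" by (rule Ts_cong) (use Suc.prems *(3) in auto)
    thus "satisfies D le e' (fT i m v) \<longleftrightarrow> Ts D le e i (e' v)"
      using Suc.IH[of m v e'] Suc.prems * by simp
  qed (use Suc.prems in auto)
qed simp

definition "fPhi k = (let n = 9 + k in Conj (fU 6) (Conj (fRing n) (Conj (fU 8) (Conj (fFin n)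
   (AllU n (Disj (Eq n 6) (ExU (n + 1) (ExU (n + 2) (Conj (fHor (n + 3) (fT k) n (n + 1))
      (Conj (fM (n + 3) n (n + 1) (n + 2)) (Conj (fT k (n + 3) (n + 2)) (Neg (Eq (n + 2) 6)))))))))))))"

lemma sat_fPhi:
  assumes e: "\<forall>n. e n \<in> D"
  shows "satisfies D le e (fPhi k) \<longleftrightarrow> Phi D le e k"
\<comment> \<open>\<open>fRing\<close> omits the membership of the zero element, which the first
  conjunct of \<open>fPhi\<close> contributes; hence the case distinction.\<close>
proof (cases "e 6 \<in> Uni D le e")
  case True
  let ?n = "9 + k"
  have U: "u \<in> D" if "u \<in> Uni D le e" for u using that by (simp add: Uni_def)
  have H: "satisfies D le (e(?n := x, ?n + 1 := z, ?n + 2 := v)) (fHor (?n + 3) (fT k) ?n (?n + 1)) \<longleftrightarrow>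
      Hor D le e (Ts D le e k) x z" if "x \<in> D" "z \<in> D" "v \<in> D" for x z v
  proof -
    have "satisfies D le (e(?n := x, ?n + 1 := z, ?n + 2 := v)) (fHor (?n + 3) (fT k) ?n (?n + 1)) \<longleftrightarrow>
      Hor D le (e(?n := x, ?n + 1 := z, ?n + 2 := v)) (Ts D le e k)
        ((e(?n := x, ?n + 1 := z, ?n + 2 := v)) ?n) ((e(?n := x, ?n + 1 := z, ?n + 2 := v)) (?n + 1))"
    proof (rule sat_fHor)
      fix m v' e' assume *: "?n + 3 \<le> m" "v' < m" "e' v' \<in> D"
        "\<And>i. i < ?n + 3 \<Longrightarrow> e' i = (e(?n := x, ?n + 1 := z, ?n + 2 := v)) i"
      have "Ts D le e' k = Ts D le e k" by (rule Ts_cong) (simp add: *(4))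
      thus "satisfies D le e' (fT k m v') \<longleftrightarrow> Ts D le e k (e' v')" using sat_fT[of k m v' e' D le] * by simp
    qed (use that in auto)
    thus ?thesis by simp
  qed
  have T: "satisfies D le (e(?n := x, ?n + 1 := z, ?n + 2 := v)) (fT k (?n + 3) (?n + 2)) \<longleftrightarrow> Ts D le e k v"
    if "v \<in> D" for x z v
    using sat_fT[of k "?n + 3" "?n + 2" "e(?n := x, ?n + 1 := z, ?n + 2 := v)" D le] that by simp
  have "satisfies D le e (AllU ?n (Disj (Eq ?n 6) (ExU (?n + 1) (ExU (?n + 2) (Conj (fHor (?n + 3) (fT k) ?n (?n + 1))
      (Conj (fM (?n + 3) ?n (?n + 1) (?n + 2)) (Conj (fT k (?n + 3) (?n + 2)) (Neg (Eq (?n + 2) 6))))))))) \<longleftrightarrow>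
      (\<forall>x\<in>Uni D le e. Alg D le e (Ts D le e k) x)"
    unfolding Alg_def using H T U by (simp cong: bex_cong ball_cong)
  thus ?thesis unfolding fPhi_def Let_def Phi_def satisfies.simps(4)
    using True e by (simp add: sat_fU sat_fRing sat_fFin del: sat_AllU)
next
  case False
  thus ?thesis unfolding fPhi_def Let_def Phi_def ring_rel_def using e by (simp add: sat_fU)
qed

section \<open>The sentence fails over the complex numbers\<close>

text \<open>The carrier is a subset of an unknown structure, with operations that are meaningful
  only on it, so ring theory is redone relative to \<open>U\<close>.\<close>

locale rel_domain =
  fixes U :: "'s set" and add mul :: "'s \<Rightarrow> 's \<Rightarrow> 's" and z :: 's
  assumes zU: "z \<in> U"
    and add_closed: "x \<in> U \<Longrightarrow> y \<in> U \<Longrightarrow> add x y \<in> U"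
    and mul_closed: "x \<in> U \<Longrightarrow> y \<in> U \<Longrightarrow> mul x y \<in> U"
    and add_comm: "x \<in> U \<Longrightarrow> y \<in> U \<Longrightarrow> add x y = add y x"
    and mul_comm: "x \<in> U \<Longrightarrow> y \<in> U \<Longrightarrow> mul x y = mul y x"
    and add_assoc: "x \<in> U \<Longrightarrow> y \<in> U \<Longrightarrow> w \<in> U \<Longrightarrow> add (add x y) w = add x (add y w)"
    and mul_assoc: "x \<in> U \<Longrightarrow> y \<in> U \<Longrightarrow> w \<in> U \<Longrightarrow> mul (mul x y) w = mul x (mul y w)"
    and add_zero: "x \<in> U \<Longrightarrow> add x z = x"
    and subtract: "x \<in> U \<Longrightarrow> y \<in> U \<Longrightarrow> \<exists>w\<in>U. add x w = y"
    and distrib: "x \<in> U \<Longrightarrow> y \<in> U \<Longrightarrow> w \<in> U \<Longrightarrow> mul x (add y w) = add (mul x y) (mul x w)"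
    and no_zero_div: "x \<in> U \<Longrightarrow> y \<in> U \<Longrightarrow> mul x y = z \<Longrightarrow> x = z \<or> y = z"
begin

lemma add_cancel:
  assumes "a \<in> U" "x \<in> U" "y \<in> U" "add a x = add a y" shows "x = y"
proof -
  obtain b where b: "b \<in> U" "add a b = z" using subtract[OF assms(1) zU] by blast
  have *: "add b (add a x) = x" if "x \<in> U" for x
  proof -
    have "add b (add a x) = add (add b a) x" by (rule add_assoc[symmetric]) (use b assms that in auto)
    also have "add b a = z" using add_comm[OF b(1) assms(1)] b(2) by simp
    also have "add z x = add x z" by (rule add_comm[OF zU that])
    also have "add x z = x" by (rule add_zero[OF that])
    finally show ?thesis .
  qed
  have "x = add b (add a x)" by (rule *[OF assms(2), symmetric])
  also have "\<dots> = y" unfolding assms(4) by (rule *[OF assms(3)])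
  finally show ?thesis .
qed

lemma mul_zero: "x \<in> U \<Longrightarrow> mul x z = z"
proof -
  assume x: "x \<in> U"
  have "add (mul x z) (mul x z) = mul x (add z z)" using x zU by (simp add: distrib)
  also have "\<dots> = add (mul x z) z" using x zU by (simp add: add_zero mul_closed)
  finally show ?thesis by (rule add_cancel[rotated 3]) (use x zU in \<open>auto simp: mul_closed\<close>)
qed

primrec ev :: "'s \<Rightarrow> 's list \<Rightarrow> 's" where
  "ev x [] = z"
| "ev x (m # ms) = add m (mul x (ev x ms))"

lemma ev_closed: "x \<in> U \<Longrightarrow> ms \<in> lists U \<Longrightarrow> ev x ms \<in> U"
  by (induction ms) (auto simp: zU add_closed mul_closed)

text \<open>Division by x - r, with x written as r + d because there is no subtraction operation;
  \<open>cs\<close> is the list of coefficients of the quotient.\<close>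

lemma synthetic_division:
  assumes r: "r \<in> U"
  shows "ms \<in> lists U \<Longrightarrow> \<exists>cs\<in>lists U. length cs = length ms - 1 \<and>
     (\<forall>d\<in>U. ev (add r d) ms = add (ev r ms) (mul d (ev (add r d) cs)))"
proof (induction ms)
  case Nil
  show ?case by (intro bexI[of _ "[]"]) (auto simp: mul_zero add_zero zU)
next
  case (Cons m ms)
  hence ms: "m \<in> U" "ms \<in> lists U" by auto
  show ?case
  proof (cases "ms = []")
    case True
    thus ?thesis using ms r
      by (intro bexI[of _ "[]"]) (auto simp: mul_zero add_zero add_closed zU)
  next
    case False
    obtain cs where cs: "cs \<in> lists U" "length cs = length ms - 1"
      "\<And>d. d \<in> U \<Longrightarrow> ev (add r d) ms = add (ev r ms) (mul d (ev (add r d) cs))"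
      using Cons.IH ms by blast
    define E where "E = ev r ms"
    have E: "E \<in> U" unfolding E_def using r ms by (intro ev_closed)
    show ?thesis
    proof (intro bexI[of _ "E # cs"] conjI ballI)
      show "E # cs \<in> lists U" using E cs by simp
      show "length (E # cs) = length (m # ms) - 1" using cs(2) False by (cases ms) auto
      fix d assume d: "d \<in> U"
      define x where "x = add r d"
      define y where "y = ev x cs"
      have x: "x \<in> U" unfolding x_def using r d by (rule add_closed)
      have y: "y \<in> U" unfolding y_def using x cs by (intro ev_closed)
      note cl = add_closed mul_closed x y E d r ms
      have "ev x (m # ms) = add m (mul x (add E (mul d y)))"
        using cs(3)[OF d] by (simp add: x_def y_def E_def)
      also have "mul x (add E (mul d y)) = add (mul x E) (mul x (mul d y))"
        by (intro distrib cl)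
      also have "mul x (mul d y) = mul d (mul x y)"
        using mul_assoc[of x d y] mul_assoc[of d x y] mul_comm[of x d] by (simp add: cl)
      also have "mul x E = add (mul r E) (mul d E)"
        using distrib[of E r d] by (simp add: x_def[symmetric] mul_comm[of E] cl) 
      also have "add m (add (add (mul r E) (mul d E)) (mul d (mul x y))) =
          add (add m (mul r E)) (add (mul d E) (mul d (mul x y)))"
        by (simp add: add_assoc cl)
      also have "add (mul d E) (mul d (mul x y)) = mul d (add E (mul x y))"
        by (simp add: distrib cl)
      finally show "ev (add r d) (m # ms) = add (ev r (m # ms)) (mul d (ev (add r d) (E # cs)))"
        by (simp add: x_def y_def E_def)
    qed
  qed
qed

text \<open>Each solution splits off a linear factor and shortens the list. The element
  \<open>x0\<close> certifies that the polynomial is not constantly \<open>v\<close>, a hypothesis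
  that survives the division.\<close>

lemma finite_solutions:
  "ms \<in> lists U \<Longrightarrow> v \<in> U \<Longrightarrow> x0 \<in> U \<Longrightarrow> ev x0 ms \<noteq> v \<Longrightarrow> finite {x \<in> U. ev x ms = v}"
proof (induction "length ms" arbitrary: ms v rule: less_induct)
  case less
  show ?case
  proof (cases "ms = [] \<or> {x \<in> U. ev x ms = v} = {}")
    case True
    hence "{x \<in> U. ev x ms = v} = {}" using less.prems by auto
    thus ?thesis by (simp only: finite.emptyI)
  next
    case False
    then obtain r where r: "r \<in> U" "ev r ms = v" by blast
    obtain cs where cs: "cs \<in> lists U" "length cs = length ms - 1"
      "\<And>d. d \<in> U \<Longrightarrow> ev (add r d) ms = add v (mul d (ev (add r d) cs))"
      using synthetic_division[OF r(1) less.prems(1)] r(2) by auto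
    have sub: "x = r \<or> ev x cs = z" if x: "x \<in> U" "ev x ms = v" for x
    proof -
      obtain d where d: "d \<in> U" "add r d = x" using subtract[OF r(1) x(1)] by blast
      have e: "ev x cs \<in> U" using x cs by (intro ev_closed)
      have "add v (mul d (ev x cs)) = v" using cs(3)[OF d(1)] x(2) unfolding d(2) by simp
      also have "v = add v z" by (rule add_zero[OF less.prems(2), symmetric])
      finally have "mul d (ev x cs) = z"
        by (rule add_cancel[OF less.prems(2) mul_closed[OF d(1) e] zU])
      hence "d = z \<or> ev x cs = z" using d e by (intro no_zero_div)
      thus ?thesis using d r add_zero by auto
    qed
    obtain d where d: "d \<in> U" "add r d = x0" using subtract[OF r(1) less.prems(3)] by blast
    \<comment> \<open>The same \<open>x0\<close> serves for the quotient, with target zero.\<close>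
    have "ev x0 cs \<noteq> z"
    proof
      assume "ev x0 cs = z"
      hence "ev x0 ms = v" using cs(3)[OF d(1)] unfolding d(2)
        by (simp add: mul_zero[OF d(1)] add_zero[OF less.prems(2)])
      thus False using less.prems by simp
    qed
    moreover have "length cs < length ms" using cs(2) False by (cases ms) auto
    ultimately have "finite {x \<in> U. ev x cs = z}"
      using less.hyps[of cs z] cs(1) zU less.prems(3) by blast
    moreover have "{x \<in> U. ev x ms = v} \<subseteq> insert r {x \<in> U. ev x cs = z}" using sub by blast
    ultimately show ?thesis using finite_subset by blast
  qed
qed

end

lemma fin_rel_representable:
  assumes "fin_rel D le L U" "finite X" "X \<noteq> {}" "X \<subseteq> U"
  shows "\<exists>d\<in>D. \<not> le L d \<and> (\<forall>w\<in>U. le w d \<longleftrightarrow> w \<in> X)"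
  using assms(2-4)
proof (induction X rule: finite_ne_induct)
  case (singleton x)
  thus ?case using assms(1) unfolding fin_rel_def by auto
next
  case (insert x F)
  then obtain d where d: "d \<in> D" "\<not> le L d" "\<forall>w\<in>U. le w d \<longleftrightarrow> w \<in> F" by auto
  moreover have "x \<in> U" using insert by blast
  ultimately obtain d' where "d' \<in> D" "\<not> le L d'" "\<forall>w\<in>U. le w d' \<longleftrightarrow> le w d \<or> w = x"
    using assms(1) unfolding fin_rel_def by blast
  thus ?case using d(3) by (intro bexI[of _ d']) auto
qed

text \<open>Each level of the tower is countable, as its elements are Horner values of finite lists
  over the level before, and each element of \<open>U\<close> solves one of countably many equations
  with finitely many solutions. Finiteness of the coded sets is what excludes nonstandard Horner
  computations.\<close>

lemma Phi_countable:
  assumes Phi: "Phi D le e k"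
    and fin: "\<And>d. d \<in> D \<Longrightarrow> \<not> le (e 0) d \<Longrightarrow> finite {w \<in> Uni D le e. le w d}"
    and par: "\<And>i. i < k \<Longrightarrow> e (9 + i) \<in> Uni D le e"
  shows "countable (Uni D le e)"
proof -
  define U where "U = Uni D le e"
  define A where "A = Ad D le e"
  define M where "M = Mu D le e"
  define z where "z = e 6"
  have rr: "ring_rel U A M z" and eU: "e 8 \<in> U" and fr: "fin_rel D le (e 0) U"
    and alg: "\<And>x. x \<in> U \<Longrightarrow> Alg D le e (Ts D le e k) x"
    using Phi unfolding Phi_def U_def A_def M_def z_def by auto
  define add where "add x y = (THE w. w \<in> U \<and> A x y w)" for x y
  define mul where "mul x y = (THE w. w \<in> U \<and> M x y w)" for x y
  note R = rr[unfolded ring_rel_def]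
  have zU: "z \<in> U" using R by blast
  have A_iff: "w \<in> U \<and> A x y w \<longleftrightarrow> w = add x y" if "x \<in> U" "y \<in> U" for x y w
  proof -
    have "\<exists>!w. w \<in> U \<and> A x y w" using R that by metis
    from theI'[OF this] show ?thesis using \<open>\<exists>!w. w \<in> U \<and> A x y w\<close> unfolding add_def by blast
  qed
  have M_iff: "w \<in> U \<and> M x y w \<longleftrightarrow> w = mul x y" if "x \<in> U" "y \<in> U" for x y w
  proof -
    have "\<exists>!w. w \<in> U \<and> M x y w" using R that by metis
    from theI'[OF this] show ?thesis using \<open>\<exists>!w. w \<in> U \<and> M x y w\<close> unfolding mul_def by blast
  qed
  have a: "add x y \<in> U" "A x y (add x y)" if "x \<in> U" "y \<in> U" for x y using A_iff[OF that] by auto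
  have m: "mul x y \<in> U" "M x y (mul x y)" if "x \<in> U" "y \<in> U" for x y using M_iff[OF that] by auto
  have a_eq: "add x y = w" if "x \<in> U" "y \<in> U" "w \<in> U" "A x y w" for x y w using A_iff[of x y w] that by auto
  have m_eq: "mul x y = w" if "x \<in> U" "y \<in> U" "w \<in> U" "M x y w" for x y w using M_iff[of x y w] that by auto
  interpret rel_domain U add mul z
  proof
    show "z \<in> U" by (rule zU)
    fix x y assume x: "x \<in> U" and y: "y \<in> U"
    show "add x y \<in> U" "mul x y \<in> U" using a m x y by auto
    have "\<forall>x\<in>U. A x z x" using R by (elim conjE)
    thus "add x z = x" using a_eq[OF x zU x] x by blast
    show "\<exists>w\<in>U. add x w = y"
    proof -
      obtain w where "w \<in> U" "A x w y" using R x y by metis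
      thus ?thesis using a_eq x y by blast
    qed
    show "add x y = add y x" using a_eq[OF x y a(1)[OF y x]] a(2)[OF y x] a(1)[OF y x] R x y by metis
    show "mul x y = mul y x" using m_eq[OF x y m(1)[OF y x]] m(2)[OF y x] m(1)[OF y x] R x y by metis
    show "x = z \<or> y = z" if "mul x y = z" using m(2)[OF x y] that R x y by metis
    fix w assume w: "w \<in> U"
    have assA: "\<forall>x\<in>U. \<forall>y\<in>U. \<forall>w\<in>U. \<forall>a\<in>U. \<forall>b\<in>U. \<forall>c\<in>U. A x y a \<longrightarrow> A a w b \<longrightarrow> A y w c \<longrightarrow> A x c b"
      using R by (elim conjE)
    have assM: "\<forall>x\<in>U. \<forall>y\<in>U. \<forall>w\<in>U. \<forall>a\<in>U. \<forall>b\<in>U. \<forall>c\<in>U. M x y a \<longrightarrow> M a w b \<longrightarrow> M y w c \<longrightarrow> M x c b"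
      using R by (elim conjE)
    have dis: "\<forall>x\<in>U. \<forall>y\<in>U. \<forall>w\<in>U. \<forall>a\<in>U. \<forall>b\<in>U. \<forall>c\<in>U. \<forall>d\<in>U.
        M x y a \<longrightarrow> M x w b \<longrightarrow> A y w c \<longrightarrow> A a b d \<longrightarrow> M x c d"
      using R by (elim conjE)
    have "A x (add y w) (add (add x y) w)"
      using assA[rule_format, OF x y w _ _ _ a(2)[OF x y] a(2)[OF _ w] a(2)[OF y w]] a(1) x y w by auto
    thus "add (add x y) w = add x (add y w)" using a_eq[OF x] a(1) x y w by metis
    have "M x (mul y w) (mul (mul x y) w)"
      using assM[rule_format, OF x y w _ _ _ m(2)[OF x y] m(2)[OF _ w] m(2)[OF y w]] m(1) x y w by auto
    thus "mul (mul x y) w = mul x (mul y w)" using m_eq[OF x] m(1) x y w by metis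
    have "M x (add y w) (add (mul x y) (mul x w))"
      using dis[rule_format, OF x y w _ _ _ _ m(2)[OF x y] m(2)[OF x w] a(2)[OF y w] a(2)] m(1) a(1) x y w by auto
    thus "mul x (add y w) = add (mul x y) (mul x w)" using m_eq[OF x] a(1) m(1) x y w by metis
  qed
  \<comment> \<open>Every element satisfying the formula \<open>Hor\<close> is the value of an
    actual finite list.\<close>
  have Hor_ev: "\<exists>ms\<in>lists {t \<in> U. T t}. y = ev x ms"
    if H: "Hor D le e T x y" and x: "x \<in> U" for T x y
  proof -
    define H where "H = ev x ` lists {t \<in> U. T t}"
    obtain d where d: "d \<in> D" "\<not> le (e 0) d" "le y d"
      and wf: "\<And>d'. d' \<in> D \<Longrightarrow> \<exists>w\<in>U. le w d \<and> le w d' \<Longrightarrow>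
       (\<exists>w\<in>U. le w d \<and> le w d' \<and> (T w \<or>
          (\<exists>m\<in>U. \<exists>w'\<in>U. \<exists>v\<in>U. T m \<and> le w' d \<and> \<not> le w' d' \<and> M x w' v \<and> A m v w)))"
      using H unfolding Hor_def U_def A_def M_def by blast
    have y: "y \<in> U" using H unfolding Hor_def U_def by blast
    \<comment> \<open>The coded set contains finitely many bad elements. Being finite, they would be
      coded by some \<open>d'\<close>, and the condition for \<open>d'\<close> yields a bad element
      that comes from \<open>T\<close> or from an element that is not bad; either way it is a Horner
      value.\<close>
    define bad where "bad = {w \<in> U. le w d \<and> w \<notin> H}"
    have "bad = {}"
    proof (rule ccontr)
      assume ne: "bad \<noteq> {}"
      have "finite {w \<in> U. le w d}" using fin[OF d(1,2)] by (simp add: U_def)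
      hence "finite bad" by (rule rev_finite_subset) (auto simp: bad_def)
      then obtain d' where d': "d' \<in> D" "\<And>w. w \<in> U \<Longrightarrow> le w d' \<longleftrightarrow> w \<in> bad"
        using fin_rel_representable[OF fr _ ne] by (metis (no_types, lifting) bad_def mem_Collect_eq subsetI)
      have "\<exists>w\<in>U. le w d \<and> le w d'" using ne d'(2) unfolding bad_def by blast
      then obtain w where w: "w \<in> U" "w \<in> bad" and
        c: "T w \<or> (\<exists>m\<in>U. \<exists>w'\<in>U. \<exists>v\<in>U. T m \<and> le w' d \<and> \<not> le w' d' \<and> M x w' v \<and> A m v w)"
        using wf[OF d'(1)] d'(2) by blast
      have "w \<in> H" using c
      proof (elim disjE bexE conjE)
        assume "T w"
        hence "w = ev x [w]" "[w] \<in> lists {t \<in> U. T t}" using w x by (auto simp: mul_zero add_zero)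
        thus ?thesis unfolding H_def by blast
      next
        fix m w' v assume *: "m \<in> U" "w' \<in> U" "v \<in> U" "T m" "le w' d" "\<not> le w' d'" "M x w' v" "A m v w"
        hence "w' \<in> H" using d'(2)[OF *(2)] unfolding bad_def by blast
        then obtain ms where ms: "ms \<in> lists {t \<in> U. T t}" "w' = ev x ms" unfolding H_def by blast
        have "w = ev x (m # ms)" using a_eq[OF *(1,3) w(1) *(8)] m_eq[OF x *(2,3,7)] ms by simp
        moreover have "m # ms \<in> lists {t \<in> U. T t}" using * ms by simp
        ultimately show ?thesis unfolding H_def by blast
      qed
      thus False using w unfolding bad_def by blast
    qed
    hence "y \<in> H" using y d unfolding bad_def by blast
    thus ?thesis unfolding H_def by blast
  qed
  have count_T: "countable {t \<in> U. Ts D le e i t}" if "i \<le> k" for i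
    using that
  proof (induction i)
    case 0
    obtain w where w: "w \<in> U" "\<And>t. t \<in> U \<Longrightarrow> A t (e 8) z \<longleftrightarrow> t = w"
    proof -
      obtain w where w: "w \<in> U" "add (e 8) w = z" using subtract[OF eU zU] by blast
      have "A t (e 8) z \<longleftrightarrow> t = w" if t: "t \<in> U" for t
      proof -
        have "A t (e 8) z \<longleftrightarrow> add t (e 8) = z" using A_iff[OF t eU, of z] zU by auto
        also have "\<dots> \<longleftrightarrow> add (e 8) t = add (e 8) w" using w add_comm[OF t eU] by simp
        also have "\<dots> \<longleftrightarrow> t = w" using add_cancel[OF eU t w(1)] by blast
        finally show ?thesis .
      qed
      thus ?thesis using that w by blast
    qed
    have "{t \<in> U. Ts D le e 0 t} \<subseteq> {z, e 8, w}" using w by (auto simp: z_def A_def)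
    thus ?case by (meson countable_finite finite.emptyI finite_insert finite_subset)
  next
    case (Suc i)
    have "e (9 + i) \<in> U" using par[of i] Suc.prems by (simp add: U_def)
    hence "{t \<in> U. Ts D le e (Suc i) t} \<subseteq> ev (e (9 + i)) ` lists {t \<in> U. Ts D le e i t}"
      using Hor_ev[of "Ts D le e i" "e (9 + i)"] by auto
    moreover have "countable (lists {t \<in> U. Ts D le e i t})" using Suc by (intro countable_lists) auto
    ultimately show ?case by (meson countable_image countable_subset)
  qed
  let ?T = "{t \<in> U. Ts D le e k t}"
  \<comment> \<open>The zero in front of \<open>ms\<close> accounts for the factor x in x h(x) =
    v.\<close>
  have "U \<subseteq> insert z (\<Union>(ms, v)\<in>lists ?T \<times> (?T - {z}). {x \<in> U. ev x (z # ms) = v})"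
  proof
    fix x assume x: "x \<in> U"
    show "x \<in> insert z (\<Union>(ms, v)\<in>lists ?T \<times> (?T - {z}). {x \<in> U. ev x (z # ms) = v})"
    proof (cases "x = z")
      case False
      then obtain y v where *: "y \<in> U" "v \<in> U" "Hor D le e (Ts D le e k) x y" "M x y v" "Ts D le e k v" "v \<noteq> z"
        using alg[OF x] unfolding Alg_def U_def M_def z_def by blast
      then obtain ms where ms: "ms \<in> lists ?T" "y = ev x ms" using Hor_ev x by blast
      have "ev x (z # ms) = mul x y"
        using ms m(1)[OF x *(1)] by (simp add: add_comm[OF zU] add_zero)
      also have "\<dots> = v" using m_eq[OF x *(1,2,4)] .
      finally show ?thesis using * ms x by auto
    qed simp
  qed
  moreover have "finite {x \<in> U. ev x (z # ms) = v}" if "ms \<in> lists ?T" "v \<in> ?T - {z}" for ms v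
  proof (rule finite_solutions[of _ _ z])
    have ms: "ms \<in> lists U" using that by auto
    thus "z # ms \<in> lists U" using zU by simp
    have "mul z (ev z ms) = z" using ev_closed[OF zU ms] by (simp add: mul_comm[OF zU] mul_zero)
    thus "ev z (z # ms) \<noteq> v" using that by (auto simp: add_zero zU)
  qed (use that zU in auto)
  hence "countable (\<Union>(ms, v)\<in>lists ?T \<times> (?T - {z}). {x \<in> U. ev x (z # ms) = v})"
    using count_T[of k] by (intro countable_UN countable_SIGMA countable_lists) (auto intro: countable_finite)
  ultimately show ?thesis unfolding U_def by (meson countable_insert countable_subset)
qed

section \<open>Points and curves as seen by the order\<close>

lemma separating_form:
  assumes "finite S" "v \<noteq> 0" "cls v \<notin> S" "S \<subseteq> proj_plane"
  shows "\<exists>d G. is_form d G \<and> vanish G S \<and> G v \<noteq> 0"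
  using assms
proof (induction S rule: finite_induct)
  case empty
  have "is_form 0 (\<lambda>v::'a^3. 1)" using is_form_monom[of 1 2 3 0 0 0 1] by simp
  thus ?case by (intro exI[of _ 0] exI[of _ "\<lambda>_. 1"]) (simp add: vanish_def)
next
  case (insert P S)
  then obtain d G where G: "is_form d G" "vanish G S" "G v \<noteq> 0" by auto
  have "P \<in> proj_plane" using insert by blast
  then obtain w where w: "w \<noteq> 0" "P = cls w" by (rule planeE)
  have "zariski_closed {cls w}" using point_in_Var[OF w(1)] unfolding Var_iff by blast
  moreover have "cls v \<notin> {cls w}" using insert w by auto
  ultimately obtain e F where F: "is_form e F" "vanish F {cls w}" "F v \<noteq> 0"
    using closed_iff[THEN iffD1, THEN conjunct2, rule_format, of "{cls w}" v] insert(4) by blast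
  have "vanish (\<lambda>u. G u * F u) (insert P S)" using G F w unfolding vanish_def by auto
  thus ?case using is_form_mult[OF G(1) F(1)] G F by (intro exI[of _ "d + e"] exI[of _ "\<lambda>u. G u * F u"]) auto
qed

text \<open>Were there two points, one form through all points but the first and one through the
  first only would contradict primality.\<close>

lemma finite_Var:
  assumes W: "W \<in> Var" and fin: "finite W"
  obtains v where "v \<noteq> 0" "W = {cls v}"
proof -
  have WP: "W \<subseteq> proj_plane" and "W \<noteq> {}" using W unfolding Var_iff by (auto dest: closed_plane)
  then obtain P where P: "P \<in> W" by blast
  obtain v where v: "v \<noteq> 0" "P = cls v" using subsetD[OF WP P] by (rule planeE)
  have "Q = cls v" if Q: "Q \<in> W" for Q
  proof (rule ccontr)
    assume ne: "Q \<noteq> cls v"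
    obtain w where w: "w \<noteq> 0" "Q = cls w" using subsetD[OF WP Q] by (rule planeE)
    obtain d G where G: "is_form d G" "vanish G (W - {cls v})" "G v \<noteq> 0"
      using separating_form[of "W - {cls v}" v] fin v WP by blast
    obtain e H where H: "is_form e H" "vanish H {cls v}" "H w \<noteq> 0"
      using separating_form[of "{cls v}" w] v w ne cls_in_plane[OF v(1)] by auto
    have "vanish (\<lambda>u. G u * H u) W" using G H unfolding vanish_def by auto
    hence "vanish G W \<or> vanish H W" using W G H unfolding Var_iff by blast
    thus False using G H v w P Q unfolding vanish_def by blast
  qed
  thus ?thesis using that v P by blast
qed

text \<open>A subvariety strictly between a point and the plane is a curve: a form through
  \<open>W\<close> but not through \<open>V\<close> cuts \<open>V\<close> in finitely many points,
  so \<open>W\<close> is finite and hence a point.\<close>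

lemma proper_subvariety:
  fixes V :: "('a::{alg_closed_field, field_char_0} ^ 3) set set"
  assumes V: "V \<in> Var" and W: "W \<in> Var" "W \<subset> V"
  obtains v d F where "v \<noteq> 0" "W = {cls v}" "is_form d F" "V = zset F"
    "\<And>e G. is_form e G \<Longrightarrow> \<not> vanish G V \<Longrightarrow> finite (V \<inter> zset G)"
  using V
proof (cases rule: Var_cases)
  case (point v)
  thus ?thesis using W unfolding Var_iff by blast
next
  case (curve d F)
  have VP: "V \<subseteq> proj_plane" using V unfolding Var_iff by (auto dest: closed_plane)
  obtain P where P: "P \<in> V" "P \<notin> W" using W by blast
  obtain v where v: "v \<noteq> 0" "P = cls v" using subsetD[OF VP P(1)] by (rule planeE)
  have "zariski_closed W" using W unfolding Var_iff by blast
  then obtain e G where G: "is_form e G" "vanish G W" "G v \<noteq> 0"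
    using closed_iff[THEN iffD1, THEN conjunct2, rule_format, of W v] v P by blast
  have "\<not> vanish G V" using G v P unfolding vanish_def by blast
  hence "finite (V \<inter> zset G)" using curve G by blast
  moreover have "W \<subseteq> V \<inter> zset G" using vanish_iff[OF G(1)] G(2) W VP by blast
  ultimately have "finite W" using finite_subset by blast
  then obtain w where "w \<noteq> 0" "W = {cls w}" using finite_Var[OF W(1)] by blast
  thus ?thesis using that curve by blast
qed

lemma finite_Int_Var:
  fixes V :: "('a::{alg_closed_field, field_char_0} ^ 3) set set"
  assumes V: "V \<in> Var" and W: "W \<in> Var" "W \<subset> V" and D: "D \<in> Var" "\<not> V \<subseteq> D"
  shows "finite (V \<inter> D)"
proof -
  have VP: "V \<subseteq> proj_plane" and DP: "D \<subseteq> proj_plane" "zariski_closed D"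
    using V D unfolding Var_iff by (auto dest: closed_plane)
  obtain P where P: "P \<in> V" "P \<notin> D" using D by blast
  obtain v where v: "v \<noteq> 0" "P = cls v" using subsetD[OF VP P(1)] by (rule planeE)
  obtain e G where G: "is_form e G" "vanish G D" "G v \<noteq> 0"
    using closed_iff[THEN iffD1, THEN conjunct2, rule_format, OF DP(2) v(1)] v P by blast
  have "\<not> vanish G V" using G v P unfolding vanish_def by blast
  hence "finite (V \<inter> zset G)" using proper_subvariety[OF V W] G(1) by metis
  moreover have "V \<inter> D \<subseteq> V \<inter> zset G" using vanish_iff[OF G(1) DP(1)] G(2) by blast
  ultimately show ?thesis using finite_subset by blast
qed

text \<open>Projection from a point \<open>u\<close> off the curve: the lines through
  \<open>u\<close> and the points \<open>w t\<close> of a line missing \<open>u\<close> all meet the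
  curve, and they do so in different points.\<close>

lemma curve_inj:
  fixes F :: "'a::{alg_closed_field, field_char_0} ^ 3 \<Rightarrow> 'a"
  assumes F: "is_form d F" and V: "zset F \<in> Var"
  obtains p :: "'a \<Rightarrow> ('a ^ 3) set" where "inj p" "range p \<subseteq> zset F"
proof -
  obtain u where u: "u \<noteq> 0" "F u \<noteq> 0" using V cls_in_zset[OF F] unfolding Var_iff by blast
  have "zset F \<noteq> {}" using V unfolding Var_iff by blast
  then obtain u' where u': "F u' = 0" unfolding zset_def by blast
  have d: "d \<noteq> 0"
  proof
    assume "d = 0"
    hence *: "F 0 = F v" for v using form_scale[OF F, of 0 v] by simp
    show False using *[of u'] *[of u] u u' by simp
  qed
  obtain k where k: "u $ k \<noteq> 0" using u(1) by (metis vec_eq_iff zero_index)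
  obtain i j where "distinct3 k i j" using ex_distinct3 by blast
  hence D: "distinct3 i j k" by (auto simp: distinct3_def)
  define w where "w t = vec3 i j k 1 t (0::'a)" for t
  note nth = vec3_nth[OF D]
  have "\<exists>s. F (w t + s *s u) = 0" for t
  proof -
    obtain A where A: "\<And>s. F (w t + s *s u) = poly A s" using form_line[OF F, of "w t" u] by metis
    \<comment> \<open>Seen from \<open>u\<close>, a constant restriction becomes c s^d, which
      vanishes at s = 0; but the value there is \<open>F u\<close>.\<close>
    have "degree A > 0"
    proof (rule ccontr)
      assume "\<not> ?thesis"
      then obtain c where c: "A = [:c:]" by (auto elim: degree_eq_zeroE)
      obtain B where B: "\<And>s. F (u + s *s w t) = poly B s" using form_line[OF F, of u "w t"] by metis
      have "B = monom c d"
      proof (rule poly_eq_inf[of 0])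
        fix s :: 'a assume s: "s \<noteq> 0"
        have "u + s *s w t = s *s (w t + inverse s *s u)"
          using s by (simp add: vector_smult_assoc vector_add_ldistrib add.commute)
        hence "poly B s = s ^ d * poly A (inverse s)" by (simp add: B[symmetric] A[symmetric] form_scale[OF F])
        thus "poly B s = poly (monom c d) s" by (simp add: c poly_monom)
      qed
      hence "poly B 0 = 0" using d by (simp add: poly_monom)
      thus False using B[of 0] u(2) by simp
    qed
    thus ?thesis using alg_closed_imp_poly_has_root A by metis
  qed
  then obtain s where s: "\<And>t. F (w t + s t *s u) = 0" by metis
  define v where "v t = w t + s t *s u" for t
  have vk: "v t $ k = s t * u $ k" "v t $ i = 1 + s t * u $ i" "v t $ j = t + s t * u $ j" for t
    by (simp_all add: v_def w_def nth)
  have v0: "v t \<noteq> 0" for t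
  proof
    assume "v t = 0"
    hence "v t $ k = 0" "v t $ i = 0" by simp_all
    thus False using k vk by auto
  qed
  have "inj (\<lambda>t. cls (v t))"
  proof (rule injI)
    fix t t' assume "cls (v t) = cls (v t')"
    then obtain c where "v t' = c *s v t" using cls_eq_iff[OF v0 v0] by blast
    hence *: "v t' $ l = c * v t $ l" for l by simp
    have st: "s t' = c * s t" using *[of k] k unfolding vk by simp
    have "c = 1" using *[of i] unfolding vk st by (simp add: algebra_simps)
    thus "t = t'" using *[of j] unfolding vk st by simp
  qed
  moreover have "range (\<lambda>t. cls (v t)) \<subseteq> zset F" using s v0 by (auto simp: zset_def v_def)
  ultimately show ?thesis by (rule that)
qed

text \<open>That \<open>e 8\<close> lies properly below \<open>e 0\<close> already makes
  \<open>e 0\<close> a curve, which has uncountably many points. All of them but possibly one belong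
  to the universe.\<close>

theorem not_Phi_complex:
  assumes e: "\<forall>n. e n \<in> (Var :: (complex ^ 3) set set set)"
    and par: "\<And>i. i < k \<Longrightarrow> e (9 + i) \<in> Uni Var (\<subseteq>) e"
  shows "\<not> Phi Var (\<subseteq>) e k"
proof
  assume Phi: "Phi Var (\<subseteq>) e k"
  let ?U = "Uni Var (\<subseteq>) e"
  have L: "e 0 \<in> Var" using e by blast
  have "e 8 \<in> ?U" using Phi unfolding Phi_def by blast
  hence W: "e 8 \<in> Var" "e 8 \<subset> e 0" by (auto simp: Uni_def)
  obtain d F where F: "is_form d F" "e 0 = zset F" using proper_subvariety[OF L W] by metis
  have "zset F \<in> Var" using L F(2) by simp
  from curve_inj[OF F(1) this] obtain p :: "complex \<Rightarrow> (complex ^ 3) set"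
    where p: "inj p" "range p \<subseteq> zset F" .
  have pt: "{P} \<in> Var" if "P \<in> e 0" for P
  proof -
    have "P \<in> proj_plane" using that zset_plane F(2) by blast
    then obtain v where "v \<noteq> 0" "P = cls v" by (rule planeE)
    thus ?thesis using point_in_Var by blast
  qed
  have "(\<lambda>t. {p t}) ` UNIV \<subseteq> insert (e 5) ?U"
  proof (intro image_subsetI)
    fix t :: complex
    have "p t \<in> e 0" "p (t + 1) \<in> e 0" "p (t + 1) \<noteq> p t" using p F(2) by (auto simp: inj_eq)
    hence "{p t} \<noteq> e 0" by blast
    thus "{p t} \<in> insert (e 5) ?U" using pt[of "p t"] \<open>p t \<in> e 0\<close> by (auto simp: Uni_def)
  qed
  moreover have "finite {w \<in> ?U. w \<subseteq> d}" if d: "d \<in> Var" "\<not> e 0 \<subseteq> d" for d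
  proof -
    have "{w \<in> ?U. w \<subseteq> d} \<subseteq> (\<lambda>P. {P}) ` (e 0 \<inter> d)"
    proof
      fix w assume w: "w \<in> {w \<in> ?U. w \<subseteq> d}"
      hence "w \<in> Var" "w \<subset> e 0" by (auto simp: Uni_def)
      then obtain v where "w = {cls v}" using proper_subvariety[OF L] by metis
      thus "w \<in> (\<lambda>P. {P}) ` (e 0 \<inter> d)" using w by (auto simp: Uni_def)
    qed
    thus ?thesis using finite_Int_Var[OF L W d] by (meson finite_imageI finite_subset)
  qed
  hence "countable ?U" using Phi_countable[OF Phi _ par] by blast
  ultimately have "countable ((\<lambda>t. {p t}) ` UNIV)" by (meson countable_insert countable_subset)
  moreover have "inj (\<lambda>t. {p t})" using p(1) by (auto simp: inj_def)
  ultimately have "countable (UNIV :: complex set)" by (rule countable_image_inj_on)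
  thus False using uncountable_UNIV_complex by blast
qed

section \<open>Curves meeting concurrent lines in single points\<close>

text \<open>The missing point \<open>b\<close> of the line a + t b is reached by exchanging the
  roles of \<open>a\<close> and \<open>b\<close> and using homogeneity.\<close>

lemma form_on_line_inf:
  fixes G :: "'a::{alg_closed_field, field_char_0} ^ 3 \<Rightarrow> 'a"
  assumes G: "is_form d G" and 0: "\<And>t. G (a + t *s b) = 0"
  shows "G b = 0"
proof -
  obtain B where B: "\<And>s. G (b + s *s a) = poly B s" using form_line[OF G, of b a] by metis
  have "B = 0"
  proof (rule poly_eq_inf[of 0])
    fix s :: 'a assume s: "s \<noteq> 0"
    have "b + s *s a = s *s (a + inverse s *s b)"
      using s by (simp add: vector_smult_assoc vector_add_ldistrib add.commute)
    thus "poly B s = poly 0 s" using 0 by (simp add: B[symmetric] form_scale[OF G])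
  qed
  thus ?thesis using B[of 0] by simp
qed

text \<open>Forms pull back to polynomials in t, which have no zero divisors. The assumption
  \<open>dense\<close> takes care of curve points that the parametrisation misses.\<close>

lemma parametrised_in_Var:
  fixes F :: "'a::{alg_closed_field, field_char_0} ^ 3 \<Rightarrow> 'a"
  assumes F: "is_form d F"
    and p: "\<And>t. p t \<noteq> 0" "\<And>t. F (p t) = 0"
    and poly: "\<And>e G. is_form e G \<Longrightarrow> \<exists>A. \<forall>t. G (p t) = poly A t"
    and dense: "\<And>e G v. is_form e G \<Longrightarrow> (\<And>t. G (p t) = 0) \<Longrightarrow> v \<noteq> 0 \<Longrightarrow> F v = 0 \<Longrightarrow> G v = 0"
    and ne: "u \<noteq> 0" "F u \<noteq> 0"
  shows "zset F \<in> Var"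
  unfolding Var_iff
proof (intro conjI allI impI)
  show "zariski_closed (zset F)" by (rule zset_closed[OF F])
  show "zset F \<noteq> {}" using p[of 0] unfolding zset_def by blast
  show "\<exists>v. v \<noteq> 0 \<and> cls v \<notin> zset F" using ne cls_in_zset[OF F] by blast
next
  fix d1 d2 and G H :: "'a ^ 3 \<Rightarrow> 'a"
  assume G: "is_form d1 G" and H: "is_form d2 H" and GH: "vanish (\<lambda>v. G v * H v) (zset F)"
  obtain A where A: "\<And>t. G (p t) = poly A t" using poly[OF G] by blast
  obtain B where B: "\<And>t. H (p t) = poly B t" using poly[OF H] by blast
  have "A * B = 0"
  proof (rule poly_eq_inf[of 0])
    fix t
    have "cls (p t) \<in> zset F" using p cls_in_zset[OF F] by blast
    hence "G (p t) * H (p t) = 0" using GH p(1) unfolding vanish_def by blast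
    thus "poly (A * B) t = poly 0 t" by (simp add: A B)
  qed
  hence "A = 0 \<or> B = 0" by simp
  hence "(\<forall>t. G (p t) = 0) \<or> (\<forall>t. H (p t) = 0)" using A B by auto
  thus "vanish G (zset F) \<or> vanish H (zset F)"
    using dense[OF G] dense[OF H] cls_in_zset[OF F] unfolding vanish_def by blast
qed

text \<open>Homogenised equation of the line y = s x + p.\<close>

definition lin :: "3 \<Rightarrow> 3 \<Rightarrow> 3 \<Rightarrow> 'a::field \<Rightarrow> 'a \<Rightarrow> 'a ^ 3 \<Rightarrow> 'a" where
  "lin i j k s p v = v $ j - s * v $ i - p * v $ k"

lemma lin_form: "is_form 1 (lin i j k s p)"
  unfolding lin_def by (intro is_form_diff is_form_cmult is_form_coord)

lemma line_in_Var:
  fixes s p :: "'a::{alg_closed_field, field_char_0}"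
  assumes D: "distinct3 i j k"
  shows "zset (lin i j k s p) \<in> Var"
proof (rule parametrised_in_Var[OF lin_form])
  let ?a = "vec3 i j k 0 p 1" and ?b = "vec3 i j k 1 s 0"
  note nth = vec3_nth[OF D]
  show "?a + t *s ?b \<noteq> 0" for t
  proof
    assume "?a + t *s ?b = 0"
    hence "(?a + t *s ?b) $ k = 0" by simp
    thus False by (simp add: nth)
  qed
  show "lin i j k s p (?a + t *s ?b) = 0" for t by (simp add: lin_def nth)
  show "\<exists>A. \<forall>t. G (?a + t *s ?b) = poly A t" if "is_form e G" for e G
    using form_line[OF that, of ?a ?b] by metis
  show "vec3 i j k 0 1 0 \<noteq> (0::'a ^ 3)" by (simp add: vec3_eq_0_iff[OF D])
  show "lin i j k s p (vec3 i j k 0 1 0) \<noteq> 0" by (simp add: lin_def nth)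
  fix e G and v :: "'a ^ 3"
  assume G: "is_form e G" and 0: "\<And>t. G (?a + t *s ?b) = 0" and v: "lin i j k s p v = 0"
  have b: "G ?b = 0" by (rule form_on_line_inf[OF G 0])
  show "G v = 0"
  proof (cases "v $ k = 0")
    case True
    hence "v = v $ i *s ?b" using v by (simp add: vec3_eq_iff[OF D] nth lin_def)
    hence "G v = G (v $ i *s ?b)" by simp
    thus ?thesis using b by (simp add: form_scale[OF G])
  next
    case False
    hence "v = v $ k *s (?a + (v $ i / v $ k) *s ?b)"
      using v by (simp add: vec3_eq_iff[OF D] nth lin_def field_simps)
    hence "G v = G (v $ k *s (?a + (v $ i / v $ k) *s ?b))" by simp
    thus ?thesis using 0 by (simp add: form_scale[OF G])
  qed
qed

text \<open>In the expansion by powers of the middle coordinate, the coefficient of t^n is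
  homogeneous of degree 1 in the others. This linearity is the source of collinearity.\<close>

lemma form_top_coeffs:
  assumes D: "distinct3 i j k" and F: "is_form (Suc n) F"
  obtains \<gamma> \<alpha> \<beta> where "\<And>x z. \<exists>A. (\<forall>t. F (vec3 i j k x t z) = poly A t) \<and> degree A \<le> Suc n \<and>
     coeff A (Suc n) = \<gamma> \<and> coeff A n = \<alpha> * x + \<beta> * z"
proof -
  obtain c where c: "F = form3 i j k (Suc n) c" using is_formE[OF D F] .
  show ?thesis
  proof (rule that[of "c 0 (Suc n)" "c 1 n" "c 0 n"])
    fix x z
    let ?f = "\<lambda>a b. c a b * x ^ a * z ^ (Suc n - a - b)"
    define A where "A = (\<Sum>(a, b)\<in>tri (Suc n). monom (?f a b) b)"
    have cA: "coeff A m = (\<Sum>a\<le>Suc n - m. ?f a m)" if "m \<le> Suc n" for m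
    proof -
      have "coeff A m = (\<Sum>y\<in>tri (Suc n). if y \<in> (\<lambda>a. (a, m)) ` {..Suc n - m} then ?f (fst y) m else 0)"
        unfolding A_def coeff_sum using that by (intro sum.cong refl) auto
      also have "\<dots> = (\<Sum>y\<in>(\<lambda>a. (a, m)) ` {..Suc n - m}. ?f (fst y) m)"
      proof -
        have "tri (Suc n) \<inter> {y. y \<in> (\<lambda>a. (a, m)) ` {..Suc n - m}} = (\<lambda>a. (a, m)) ` {..Suc n - m}"
          using that by auto
        thus ?thesis by (simp add: sum.If_cases)
      qed
      also have "\<dots> = (\<Sum>a\<le>Suc n - m. ?f a m)" by (subst sum.reindex) (auto simp: inj_on_def)
      finally show ?thesis .
    qed
    show "\<exists>A. (\<forall>t. F (vec3 i j k x t z) = poly A t) \<and> degree A \<le> Suc n \<and>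
       coeff A (Suc n) = c 0 (Suc n) \<and> coeff A n = c 1 n * x + c 0 n * z"
    proof (intro exI[of _ A] conjI allI)
      fix t show "F (vec3 i j k x t z) = poly A t"
        unfolding c form3_def A_def poly_sum
        by (intro sum.cong refl) (auto simp: vec3_nth[OF D] poly_monom)
      show "degree A \<le> Suc n" unfolding A_def
      proof (intro degree_sum_le, simp, clarify)
        fix a b assume "(a, b) \<in> tri (Suc n)"
        thus "degree (monom (?f a b) b) \<le> Suc n" by (auto intro: order.trans[OF degree_monom_le])
      qed
      show "coeff A (Suc n) = c 0 (Suc n)" using cA[of "Suc n"] by simp
      have "{..Suc n - n} = {0, 1}" by auto
      thus "coeff A n = c 1 n * x + c 0 n * z" using cA[of n] by simp
    qed
  qed
qed

text \<open>Over an algebraically closed field a polynomial whose only root is \<open>p\<close> is a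
  constant times a power of t - p. The formula is the second coefficient of that power.\<close>

lemma single_root_coeff:
  fixes A :: "'a::{alg_closed_field, field_char_0} poly"
  shows "degree A \<le> Suc n \<Longrightarrow> coeff A (Suc n) \<noteq> 0 \<Longrightarrow> (\<And>t. poly A t = 0 \<Longrightarrow> t = p) \<Longrightarrow>
    coeff A n = - of_nat (Suc n) * p * coeff A (Suc n)"
proof (induction n arbitrary: A)
  case (0 A)
  hence "degree A = 1" using le_degree[of A 1] by simp
  then obtain t where t: "poly A t = 0" using alg_closed_imp_poly_has_root[of A] by auto
  hence "t = p" using 0 by blast
  moreover have "poly A t = coeff A 0 + coeff A 1 * t"
    using \<open>degree A = 1\<close> by (simp add: poly_altdef)
  ultimately have "coeff A 0 + coeff A 1 * p = 0" using t by simp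
  hence "coeff A 0 = - (coeff A 1 * p)" by (rule eq_neg_iff_add_eq_0[THEN iffD2])
  thus ?case by (simp add: mult.commute)
next
  case (Suc n A)
  have "degree A = Suc (Suc n)" using Suc.prems le_degree[of A "Suc (Suc n)"] by simp
  then obtain t where "poly A t = 0" using alg_closed_imp_poly_has_root[of A] by auto
  hence "poly A p = 0" using Suc.prems by blast
  then obtain B where B: "A = [:-p, 1:] * B" by (auto simp: poly_eq_0_iff_dvd elim: dvdE)
  have B0: "B \<noteq> 0" using Suc.prems(2) B by auto
  have degB: "degree B = Suc n"
    using \<open>degree A = Suc (Suc n)\<close> B0 unfolding B by (subst (asm) degree_mult_eq) auto
  have c: "coeff A (Suc m) = coeff B m - p * coeff B (Suc m)" for m unfolding B by simp
  have top: "coeff A (Suc (Suc n)) = coeff B (Suc n)"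
    using c[of "Suc n"] coeff_eq_0[of B "Suc (Suc n)"] degB by simp
  have "coeff B n = - of_nat (Suc n) * p * coeff B (Suc n)"
  proof (rule Suc.IH)
    show "degree B \<le> Suc n" using degB by simp
    show "coeff B (Suc n) \<noteq> 0" using Suc.prems(2) top by simp
    fix t assume "poly B t = 0"
    thus "t = p" by (intro Suc.prems(3)) (simp add: B)
  qed
  moreover have "coeff A (Suc n) = coeff B n - p * coeff B (Suc n)" by (rule c)
  ultimately have "coeff A (Suc n) = - of_nat (Suc n) * p * coeff B (Suc n) - p * coeff B (Suc n)" by simp
  also have "\<dots> = - of_nat (Suc (Suc n)) * p * coeff B (Suc n)" by (simp add: algebra_simps)
  finally show ?case unfolding top .
qed

text \<open>In the affine coordinates x = v_i / v_k and y = v_j / v_k, the lines \<open>a0\<close>,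
  \<open>a1\<close>, \<open>a2\<close> are x = 0, x = 1 and the line at infinity. They meet in the
  vertical direction \<open>ct\<close>, and \<open>pt 1 s 0\<close> is the direction of slope
  s.\<close>

locale concurrent =
  fixes i j k :: 3
  assumes D: "distinct3 i j k"
begin

definition a0 :: "('a::{alg_closed_field, field_char_0} ^ 3) set set" where "a0 = zset (lin j i k 0 0)"
definition a1 :: "('a::{alg_closed_field, field_char_0} ^ 3) set set" where "a1 = zset (lin j i k 0 1)"
definition a2 :: "('a::{alg_closed_field, field_char_0} ^ 3) set set" where "a2 = zset (lin i k j 0 0)"
definition ct :: "('a::{alg_closed_field, field_char_0} ^ 3) set set" where "ct = {cls (vec3 i j k 0 1 0)}"

definition pt :: "'a \<Rightarrow> 'a \<Rightarrow> 'a \<Rightarrow> ('a::{alg_closed_field, field_char_0} ^ 3) set set" where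
  "pt x y w = {cls (vec3 i j k x y w)}"

lemmas nth = vec3_nth[OF D]

lemma v_ne: "x \<noteq> 0 \<or> y \<noteq> 0 \<or> w \<noteq> 0 \<Longrightarrow> vec3 i j k x y w \<noteq> 0"
  by (simp add: vec3_eq_0_iff[OF D])

lemma pt_in_Var: "x \<noteq> 0 \<or> y \<noteq> 0 \<or> w \<noteq> 0 \<Longrightarrow> pt x y w \<in> Var"
  unfolding pt_def by (intro point_in_Var v_ne)

lemma cls_vec3_eq:
  assumes "x \<noteq> 0 \<or> y \<noteq> 0 \<or> w \<noteq> 0" "x' \<noteq> 0 \<or> y' \<noteq> 0 \<or> w' \<noteq> 0"
  shows "cls (vec3 i j k x y w) = cls (vec3 i j k x' y' w') \<longleftrightarrow>
    (\<exists>c. c \<noteq> 0 \<and> x' = c * x \<and> y' = c * y \<and> w' = c * w)"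
  using cls_eq_iff[OF v_ne[OF assms(1)] v_ne[OF assms(2)]]
  by (simp add: vec3_eq_iff[OF D] nth)

lemma line_mem:
  assumes "v \<noteq> 0"
  shows "cls v \<in> a0 \<longleftrightarrow> v $ i = 0" "cls v \<in> a1 \<longleftrightarrow> v $ i = v $ k" "cls v \<in> a2 \<longleftrightarrow> v $ k = 0"
  unfolding a0_def a1_def a2_def cls_in_zset[OF lin_form assms] by (simp_all add: lin_def)

lemma sing_line:
  assumes line: "a = a0 \<or> a = a1 \<or> a = a2" and P: "P \<in> Var" and s: "sing Var (\<subseteq>) d a P" and ne: "P \<noteq> ct"
  obtains v where "v \<noteq> 0" "P = {cls v}" "cls v \<in> d" "cls v \<in> a"
    "\<And>u. u \<noteq> 0 \<Longrightarrow> cls u \<in> d \<Longrightarrow> cls u \<in> a \<Longrightarrow> cls u = cls v"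
proof -
  have PP: "P \<subseteq> proj_plane" and "P \<noteq> {}" using P unfolding Var_iff by (auto dest: closed_plane)
  then obtain Q where Q: "Q \<in> P" by blast
  obtain v where v: "v \<noteq> 0" "Q = cls v" using subsetD[OF PP Q] by (rule planeE)
  have sub: "P \<subseteq> d" "P \<subseteq> a" and un: "\<And>W. W \<in> Var \<Longrightarrow> W \<subseteq> d \<Longrightarrow> W \<subseteq> a \<Longrightarrow> W = P"
    using s unfolding sing_def by blast+
  have Pv: "P = {cls v}" using un[OF point_in_Var[OF v(1)]] sub Q v by auto
  have "cls u = cls v" if "u \<noteq> 0" "cls u \<in> d" "cls u \<in> a" for u
    using un[OF point_in_Var[OF that(1)]] that Pv by auto
  thus ?thesis using that v Pv sub by blast
qed

lemma on_a0:
  assumes "v \<noteq> 0" "cls v \<in> a0" "{cls v} \<noteq> ct"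
  obtains p where "cls v = cls (vec3 i j k 0 p 1)"
proof -
  have vi: "v $ i = 0" using assms line_mem by blast
  have vk: "v $ k \<noteq> 0"
  proof
    assume "v $ k = 0"
    hence "v = v $ j *s vec3 i j k 0 1 0" using vi by (simp add: vec3_eq_iff[OF D] nth)
    moreover from this have "v $ j \<noteq> 0" using assms(1) by (metis vector_smult_lzero)
    ultimately have "cls (vec3 i j k 0 1 0) = cls v"
      using cls_eq_iff[OF v_ne[of 0 1 0] assms(1)] by auto
    thus False using assms(3) unfolding ct_def by simp
  qed
  have "v = v $ k *s vec3 i j k 0 (v $ j / v $ k) 1" using vi vk by (simp add: vec3_eq_iff[OF D] nth)
  hence "cls (vec3 i j k 0 (v $ j / v $ k) 1) = cls v"
    using cls_eq_iff[OF v_ne[of 0 "v $ j / v $ k" 1] assms(1)] vk by auto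
  thus ?thesis using that by metis
qed

lemma on_a1:
  assumes "v \<noteq> 0" "cls v \<in> a1" "{cls v} \<noteq> ct"
  obtains p where "cls v = cls (vec3 i j k 1 p 1)"
proof -
  have vi: "v $ i = v $ k" using assms line_mem by blast
  have vk: "v $ k \<noteq> 0"
  proof
    assume "v $ k = 0"
    hence "v = v $ j *s vec3 i j k 0 1 0" using vi by (simp add: vec3_eq_iff[OF D] nth)
    moreover from this have "v $ j \<noteq> 0" using assms(1) by (metis vector_smult_lzero)
    ultimately have "cls (vec3 i j k 0 1 0) = cls v"
      using cls_eq_iff[OF v_ne[of 0 1 0] assms(1)] by auto
    thus False using assms(3) unfolding ct_def by simp
  qed
  have "v = v $ k *s vec3 i j k 1 (v $ j / v $ k) 1" using vi vk by (simp add: vec3_eq_iff[OF D] nth)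
  hence "cls (vec3 i j k 1 (v $ j / v $ k) 1) = cls v"
    using cls_eq_iff[OF v_ne[of 1 "v $ j / v $ k" 1] assms(1)] vk by auto
  thus ?thesis using that by metis
qed

lemma on_a2:
  assumes "v \<noteq> 0" "cls v \<in> a2" "{cls v} \<noteq> ct"
  obtains p where "cls v = cls (vec3 i j k 1 p 0)"
proof -
  have vk: "v $ k = 0" using assms line_mem by blast
  have vi: "v $ i \<noteq> 0"
  proof
    assume "v $ i = 0"
    hence "v = v $ j *s vec3 i j k 0 1 0" using vk by (simp add: vec3_eq_iff[OF D] nth)
    moreover from this have "v $ j \<noteq> 0" using assms(1) by (metis vector_smult_lzero)
    ultimately have "cls (vec3 i j k 0 1 0) = cls v"
      using cls_eq_iff[OF v_ne[of 0 1 0] assms(1)] by auto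
    thus False using assms(3) unfolding ct_def by simp
  qed
  have "v = v $ i *s vec3 i j k 1 (v $ j / v $ i) 0" using vi vk by (simp add: vec3_eq_iff[OF D] nth)
  hence "cls (vec3 i j k 1 (v $ j / v $ i) 0) = cls v"
    using cls_eq_iff[OF v_ne[of 1 "v $ j / v $ i" 0] assms(1)] vi by auto
  thus ?thesis using that by metis
qed

lemma pt_eq_iff:
  "pt 0 p 1 = pt 0 p' 1 \<longleftrightarrow> p = p'" "pt 1 p 1 = pt 1 p' 1 \<longleftrightarrow> p = p'" "pt 1 p 0 = pt 1 p' 0 \<longleftrightarrow> p = p'"
  by (auto simp: pt_def cls_vec3_eq)

lemma pt_ne_ct: "pt 0 p 1 \<noteq> ct" "pt 1 p 1 \<noteq> ct" "pt 1 p 0 \<noteq> ct"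
  by (auto simp: pt_def ct_def cls_vec3_eq)

text \<open>The straight line y = s x + p is a witness for \<open>trans3\<close>.\<close>

lemma sing_lineI:
  fixes p s :: "'a::{alg_closed_field, field_char_0}"
  defines "d \<equiv> zset (lin i j k s p)"
  shows "sing Var (\<subseteq>) d a0 (pt 0 p 1)" "sing Var (\<subseteq>) d a1 (pt 1 (p + s) 1)" "sing Var (\<subseteq>) d a2 (pt 1 s 0)"
proof -
  have mem: "cls v \<in> d \<longleftrightarrow> v $ j = s * v $ i + p * v $ k" if "v \<noteq> 0" for v :: "'a ^ 3"
    unfolding d_def cls_in_zset[OF lin_form that] by (auto simp: lin_def algebra_simps)
  have *: "sing Var (\<subseteq>) d a (pt x y w)"
    if xyw: "x \<noteq> 0 \<or> y \<noteq> 0 \<or> w \<noteq> 0" and m: "cls (vec3 i j k x y w) \<in> d" "cls (vec3 i j k x y w) \<in> a"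
    and un: "\<And>v. v \<noteq> 0 \<Longrightarrow> cls v \<in> d \<Longrightarrow> cls v \<in> a \<Longrightarrow> \<exists>c. v = c *s vec3 i j k x y w"
    for a and x y w :: 'a
    unfolding sing_def
  proof (intro conjI ballI impI)
    show "pt x y w \<subseteq> d" "pt x y w \<subseteq> a" using m by (auto simp: pt_def)
    fix W assume W: "W \<in> Var" "W \<subseteq> d \<and> W \<subseteq> a"
    have WP: "W \<subseteq> proj_plane" and "W \<noteq> {}" using W unfolding Var_iff by (auto dest: closed_plane)
    moreover have "Q = cls (vec3 i j k x y w)" if Q: "Q \<in> W" for Q
    proof -
      obtain v where v: "v \<noteq> 0" "Q = cls v" using subsetD[OF WP Q] by (rule planeE)
      then obtain c where c: "v = c *s vec3 i j k x y w" using un[of v] W Q by blast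
      hence "c \<noteq> 0" using v by auto
      thus ?thesis using v c cls_eq_iff[OF v_ne[OF xyw] v(1)] by blast
    qed
    ultimately show "W = pt x y w" unfolding pt_def by blast
  qed
  show "sing Var (\<subseteq>) d a0 (pt 0 p 1)"
  proof (rule *)
    fix v :: "'a ^ 3" assume v: "v \<noteq> 0" "cls v \<in> d" "cls v \<in> a0"
    show "\<exists>c. v = c *s vec3 i j k 0 p 1"
      using mem[OF v(1)] line_mem(1)[OF v(1)] v(2,3)
      by (intro exI[of _ "v $ k"]) (simp add: vec3_eq_iff[OF D] nth)
  qed (use v_ne[of 0 p 1] in \<open>simp_all add: mem line_mem nth\<close>)
  show "sing Var (\<subseteq>) d a1 (pt 1 (p + s) 1)"
  proof (rule *)
    fix v :: "'a ^ 3" assume v: "v \<noteq> 0" "cls v \<in> d" "cls v \<in> a1"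
    show "\<exists>c. v = c *s vec3 i j k 1 (p + s) 1"
      using mem[OF v(1)] line_mem(2)[OF v(1)] v(2,3)
      by (intro exI[of _ "v $ k"]) (simp add: vec3_eq_iff[OF D] nth algebra_simps)
  qed (use v_ne[of 1 "p + s" 1] in \<open>simp_all add: mem line_mem nth\<close>)
  show "sing Var (\<subseteq>) d a2 (pt 1 s 0)"
  proof (rule *)
    fix v :: "'a ^ 3" assume v: "v \<noteq> 0" "cls v \<in> d" "cls v \<in> a2"
    show "\<exists>c. v = c *s vec3 i j k 1 s 0"
      using mem[OF v(1)] line_mem(3)[OF v(1)] v(2,3)
      by (intro exI[of _ "v $ i"]) (simp add: vec3_eq_iff[OF D] nth)
  qed (use v_ne[of 1 s 0] in \<open>simp_all add: mem line_mem nth\<close>)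
qed

text \<open>
  The heart of the interpretation: if a curve of degree \<open>n\<close> meets each of three concurrent lines in one
  point only, the three restrictions of its equation are \<open>n\<close>-th powers up to a constant, and comparing
  their second coefficients shows that the three points are collinear.
\<close>

lemma collinear:
  fixes p q s :: "'a::{alg_closed_field, field_char_0}"
  assumes d: "d \<in> Var" and "sing Var (\<subseteq>) d a0 (pt 0 p 1)" "sing Var (\<subseteq>) d a1 (pt 1 q 1)"
    "sing Var (\<subseteq>) d a2 (pt 1 s 0)"
  shows "q = p + s"
proof -
  have un: "\<And>u. u \<noteq> 0 \<Longrightarrow> cls u \<in> d \<Longrightarrow> cls u \<in> a0 \<Longrightarrow> {cls u} = pt 0 p 1"
    "\<And>u. u \<noteq> 0 \<Longrightarrow> cls u \<in> d \<Longrightarrow> cls u \<in> a1 \<Longrightarrow> {cls u} = pt 1 q 1"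
    "\<And>u. u \<noteq> 0 \<Longrightarrow> cls u \<in> d \<Longrightarrow> cls u \<in> a2 \<Longrightarrow> {cls u} = pt 1 s 0"
    using assms(2-4) point_in_Var unfolding sing_def by (metis empty_subsetI insert_subset)+
  have mem: "cls (vec3 i j k 0 p 1) \<in> d" "cls (vec3 i j k 1 q 1) \<in> d"
    using assms(2,3) unfolding sing_def pt_def by auto
  have ne: "cls (vec3 i j k 0 p 1) \<noteq> cls (vec3 i j k 1 q 1)" by (simp add: cls_vec3_eq)
  obtain m F where F: "is_form m F" "d = zset F"
    using d
  proof (cases rule: Var_cases)
    case (point v)
    thus ?thesis using mem ne by auto
  next
    case (curve m F)
    thus ?thesis using that by blast
  qed
  have Fmem: "cls v \<in> d \<longleftrightarrow> F v = 0" if "v \<noteq> 0" for v unfolding F(2) by (rule cls_in_zset[OF F(1) that])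
  have nz: "vec3 i j k 0 1 0 \<noteq> (0 :: 'a ^ 3)" by (rule v_ne) simp
  \<comment> \<open>The common point of the three lines would be a second intersection on
    \<open>a0\<close>.\<close>
  have Oct: "F (vec3 i j k 0 1 0) \<noteq> 0"
  proof
    assume "F (vec3 i j k 0 1 0) = 0"
    hence "{cls (vec3 i j k 0 1 0)} = pt 0 p 1"
      using un(1)[OF nz] Fmem[OF nz] line_mem(1)[OF nz] by (simp add: nth)
    thus False using pt_ne_ct(1)[of p] unfolding ct_def by simp
  qed
  have "m \<noteq> 0"
  proof
    assume "m = 0"
    hence *: "F 0 = F v" for v using form_scale[OF F(1), of 0 v] by simp
    have "F (vec3 i j k 0 p 1) = 0" using Fmem[OF v_ne[of 0 p 1]] mem by simp
    thus False using Oct *[of "vec3 i j k 0 p 1"] *[of "vec3 i j k 0 1 0"] by simp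
  qed
  then obtain n where n: "m = Suc n" by (cases m) auto
  obtain \<gamma> \<alpha> \<beta> where co: "\<And>x z. \<exists>A. (\<forall>t. F (vec3 i j k x t z) = poly A t) \<and> degree A \<le> Suc n \<and>
     coeff A (Suc n) = \<gamma> \<and> coeff A n = \<alpha> * x + \<beta> * z"
    using form_top_coeffs[OF D F(1)[unfolded n]] by blast
  \<comment> \<open>The leading coefficient is the value of \<open>F\<close> at the common point, as
    the restriction to x = z = 0 shows.\<close>
  have "\<gamma> \<noteq> 0"
  proof
    assume g: "\<gamma> = 0"
    obtain A where A: "\<And>t. F (vec3 i j k 0 t 0) = poly A t" "degree A \<le> Suc n" "coeff A (Suc n) = \<gamma>" "coeff A n = 0"
      using co[of 0 0] by auto
    have hom: "F (vec3 i j k 0 t 0) = t ^ Suc n * F (vec3 i j k 0 1 0)" for t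
    proof -
      have "vec3 i j k 0 t 0 = t *s vec3 i j k 0 1 0" by (simp add: vec3_eq_iff[OF D] nth)
      hence "F (vec3 i j k 0 t 0) = F (t *s vec3 i j k 0 1 0)" by (rule arg_cong)
      also have "\<dots> = t ^ Suc n * F (vec3 i j k 0 1 0)" unfolding n[symmetric] by (rule form_scale[OF F(1)])
      finally show ?thesis .
    qed
    have At: "poly A t = t ^ Suc n * F (vec3 i j k 0 1 0)" for t by (rule trans[OF A(1)[symmetric] hom])
    have "A = monom (F (vec3 i j k 0 1 0)) (Suc n)"
      by (rule poly_eq_inf[of 0]) (simp only: At poly_monom mult.commute)
    thus False using A(3) g Oct by simp
  qed
  have key: "\<alpha> * x + \<beta> * z = - of_nat (Suc n) * y * \<gamma>"
    if xz: "x \<noteq> 0 \<or> z \<noteq> 0" and r: "\<And>t. F (vec3 i j k x t z) = 0 \<Longrightarrow> t = y" for x y z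
  proof -
    obtain A where A: "\<And>t. F (vec3 i j k x t z) = poly A t" "degree A \<le> Suc n"
      "coeff A (Suc n) = \<gamma>" "coeff A n = \<alpha> * x + \<beta> * z" using co[of x z] by blast
    have "coeff A n = - of_nat (Suc n) * y * coeff A (Suc n)"
      by (rule single_root_coeff) (use A r \<open>\<gamma> \<noteq> 0\<close> in auto)
    thus ?thesis using A by simp
  qed
  have "t = p" if "F (vec3 i j k 0 t 1) = 0" for t
    using un(1)[OF v_ne[of 0 t 1]] Fmem[OF v_ne[of 0 t 1]] line_mem[OF v_ne[of 0 t 1]] that pt_eq_iff(1)[of t p]
    by (simp add: nth pt_def)
  hence 1: "\<alpha> * 0 + \<beta> * 1 = - of_nat (Suc n) * p * \<gamma>" by (intro key) auto
  have "t = q" if "F (vec3 i j k 1 t 1) = 0" for t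
    using un(2)[OF v_ne[of 1 t 1]] Fmem[OF v_ne[of 1 t 1]] line_mem[OF v_ne[of 1 t 1]] that pt_eq_iff(2)[of t q]
    by (simp add: nth pt_def)
  hence 2: "\<alpha> * 1 + \<beta> * 1 = - of_nat (Suc n) * q * \<gamma>" by (intro key) auto
  have "t = s" if "F (vec3 i j k 1 t 0) = 0" for t
    using un(3)[OF v_ne[of 1 t 0]] Fmem[OF v_ne[of 1 t 0]] line_mem[OF v_ne[of 1 t 0]] that pt_eq_iff(3)[of t s]
    by (simp add: nth pt_def)
  hence 3: "\<alpha> * 1 + \<beta> * 0 = - of_nat (Suc n) * s * \<gamma>" by (intro key) auto
  \<comment> \<open>The second coefficients at (0, 1) and (1, 0) add up to the one at (1, 1). In
    characteristic zero the degree can be cancelled.\<close>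
  have "of_nat (Suc n) * \<gamma> * q = of_nat (Suc n) * \<gamma> * (p + s)"
    using 1 2 3 by algebra
  thus ?thesis using \<open>\<gamma> \<noteq> 0\<close> by (subst (asm) mult_left_cancel) (auto simp del: of_nat_Suc)
qed

lemma trans3_iff:
  fixes P Q R :: "('a::{alg_closed_field, field_char_0} ^ 3) set set"
  assumes "P \<in> Var" "Q \<in> Var" "R \<in> Var"
  shows "trans3 Var (\<subseteq>) a0 a1 a2 ct P Q R \<longleftrightarrow> (\<exists>p s. P = pt 0 p 1 \<and> Q = pt 1 (p + s) 1 \<and> R = pt 1 s 0)"
proof
  assume "\<exists>p s. P = pt 0 p 1 \<and> Q = pt 1 (p + s) 1 \<and> R = pt 1 s 0"
  thus "trans3 Var (\<subseteq>) a0 a1 a2 ct P Q R"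
    unfolding trans3_def using sing_lineI line_in_Var[OF D] pt_ne_ct by blast
next
  assume "trans3 Var (\<subseteq>) a0 a1 a2 ct P Q R"
  then obtain d where ne: "P \<noteq> ct" "Q \<noteq> ct" "R \<noteq> ct" and d: "d \<in> Var"
    "sing Var (\<subseteq>) d a0 P" "sing Var (\<subseteq>) d a1 Q" "sing Var (\<subseteq>) d a2 R"
    unfolding trans3_def by blast
  obtain u where u: "u \<noteq> 0" "P = {cls u}" "cls u \<in> a0" using sing_line[OF _ assms(1) d(2) ne(1)] by metis
  obtain v where v: "v \<noteq> 0" "Q = {cls v}" "cls v \<in> a1" using sing_line[OF _ assms(2) d(3) ne(2)] by metis
  obtain w where w: "w \<noteq> 0" "R = {cls w}" "cls w \<in> a2" using sing_line[OF _ assms(3) d(4) ne(3)] by metis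
  obtain p where p: "P = pt 0 p 1" using on_a0[OF u(1,3)] ne u(2) unfolding pt_def by metis
  obtain q where q: "Q = pt 1 q 1" using on_a1[OF v(1,3)] ne v(2) unfolding pt_def by metis
  obtain s where s: "R = pt 1 s 0" using on_a2[OF w(1,3)] ne w(2) unfolding pt_def by metis
  have "q = p + s" using collinear[OF d(1)] d(2-4) unfolding p q s by blast
  thus "\<exists>p s. P = pt 0 p 1 \<and> Q = pt 1 (p + s) 1 \<and> R = pt 1 s 0" using p q s by blast
qed

lemma AD_iff:
  fixes X Y W :: "('a::{alg_closed_field, field_char_0} ^ 3) set set"
  assumes "X \<in> Var" "Y \<in> Var" "W \<in> Var"
  shows "AD Var (\<subseteq>) a0 a1 a2 ct (pt 1 0 0) (pt 0 0 1) X Y W \<longleftrightarrow>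
     (\<exists>s t. X = pt 1 s 0 \<and> Y = pt 1 t 0 \<and> W = pt 1 (s + t) 0)"
proof
  have v: "pt 1 s 0 \<in> Var" "pt 0 s 1 \<in> Var" "pt 1 s 1 \<in> Var" for s :: 'a by (simp_all add: pt_in_Var)
  {
    assume "AD Var (\<subseteq>) a0 a1 a2 ct (pt 1 0 0) (pt 0 0 1) X Y W"
    then obtain P P' P'' where P: "P \<in> Var" "P' \<in> Var" "P'' \<in> Var"
      and t: "trans3 Var (\<subseteq>) a0 a1 a2 ct (pt 0 0 1) P' X" "trans3 Var (\<subseteq>) a0 a1 a2 ct P P' (pt 1 0 0)"
       "trans3 Var (\<subseteq>) a0 a1 a2 ct P P'' Y" "trans3 Var (\<subseteq>) a0 a1 a2 ct (pt 0 0 1) P'' W"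
      unfolding AD_def by blast
    obtain s where s: "P' = pt 1 s 1" "X = pt 1 s 0"
      using trans3_iff[OF v(2) P(2) assms(1)] t(1) by (auto simp: pt_eq_iff)
    have p: "P = pt 0 s 1"
      using trans3_iff[OF P(1,2) v(1)] t(2) by (auto simp: pt_eq_iff s)
    obtain t' where t': "P'' = pt 1 (s + t') 1" "Y = pt 1 t' 0"
      using trans3_iff[OF P(1,3) assms(2)] t(3) by (auto simp: pt_eq_iff p)
    have "W = pt 1 (s + t') 0"
      using trans3_iff[OF v(2) P(3) assms(3)] t(4) by (auto simp: pt_eq_iff t')
    thus "\<exists>s t. X = pt 1 s 0 \<and> Y = pt 1 t 0 \<and> W = pt 1 (s + t) 0" using s t' by blast
  }
  assume "\<exists>s t. X = pt 1 s 0 \<and> Y = pt 1 t 0 \<and> W = pt 1 (s + t) 0"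
  then obtain s t where st: "X = pt 1 s 0" "Y = pt 1 t 0" "W = pt 1 (s + t) 0" by blast
  have t3: "trans3 Var (\<subseteq>) a0 a1 a2 ct (pt 0 p 1) (pt 1 q 1) (pt 1 r 0)" if "q = p + r" for p q r :: 'a
    unfolding trans3_iff[OF v(2) v(3) v(1)] using that by blast
  show "AD Var (\<subseteq>) a0 a1 a2 ct (pt 1 0 0) (pt 0 0 1) X Y W" unfolding AD_def
  proof (intro bexI conjI)
    show "trans3 Var (\<subseteq>) a0 a1 a2 ct (pt 0 0 1) (pt 1 s 1) X" unfolding st by (rule t3) simp
    show "trans3 Var (\<subseteq>) a0 a1 a2 ct (pt 0 s 1) (pt 1 s 1) (pt 1 0 0)" by (rule t3) simp
    show "trans3 Var (\<subseteq>) a0 a1 a2 ct (pt 0 s 1) (pt 1 (s + t) 1) Y" unfolding st by (rule t3) simp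
    show "trans3 Var (\<subseteq>) a0 a1 a2 ct (pt 0 0 1) (pt 1 (s + t) 1) W" unfolding st by (rule t3) simp
  qed (rule v)+
qed

end

text \<open>The closure of the graph v_3 = q(v_2) in the chart v_1 = 1, where q has exactly the
  roots \<open>R\<close>; it meets the line v_3 = 0 at these slopes and nowhere else.\<close>

lemma finite_set_curve:
  fixes R :: "'a::{alg_closed_field, field_char_0} set"
  assumes R: "finite R" "R \<noteq> {}"
  obtains d where "d \<in> Var"
    "\<And>v. v \<noteq> 0 \<Longrightarrow> v $ 3 = 0 \<Longrightarrow> cls v \<in> d \<longleftrightarrow> (\<exists>r\<in>R. v $ 2 = r * v $ 1) \<and> v $ 1 \<noteq> 0"
proof -
  \<comment> \<open>The roots are doubled to make the degree at least 2 even when \<open>R\<close>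
    is a singleton: then v_1^(N-1) vanishes for v_1 = 0, and the graph acquires the single extra
    point [0:0:1].\<close>
  define N where "N = 2 * card R"
  have N: "2 \<le> N" unfolding N_def using R by (simp add: Suc_le_eq card_gt_0_iff)
  note D = distinct3_123
  note nth = vec3_nth[OF D]
  define P where "P v = (\<Prod>r\<in>R. (v $ 2 - r * v $ 1) ^ 2)" for v :: "'a ^ 3"
  define F where "F v = P v - v $ 3 * v $ 1 ^ (N - 1)" for v :: "'a ^ 3"
  have "is_form (2 * card X) (\<lambda>v. \<Prod>r\<in>X. (v $ 2 - r * v $ 1) ^ 2)" if "finite X" for X :: "'a set"
    using that
  proof (induction X rule: finite_induct)
    case empty
    show ?case using is_form_monom[of 1 2 3 0 0 0 1] by simp
  next
    case (insert r X)
    have "is_form (2 * 1) (\<lambda>v. (v $ 2 - r * v $ 1) ^ 2)"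
      by (intro is_form_power is_form_diff is_form_cmult is_form_coord)
    from is_form_mult[OF this insert.IH] show ?case using insert by simp
  qed
  hence PF: "is_form N P" unfolding P_def N_def using R by blast
  have "is_form (1 + (N - 1) * 1) (\<lambda>v. v $ 3 * v $ 1 ^ (N - 1))"
    by (intro is_form_mult is_form_power is_form_coord)
  hence F: "is_form N F" unfolding F_def using is_form_diff[OF PF] N by simp
  define q where "q = (\<Prod>r\<in>R. [:-r, 1:] ^ 2)"
  have Pq: "P (vec3 1 2 3 1 t w) = poly q t" for t w
    by (simp add: P_def q_def nth poly_prod)
  have q0: "q \<noteq> 0" unfolding q_def by (simp add: R)
  have "degree q = (\<Sum>r\<in>R. degree ([:-r, 1:] ^ 2))" unfolding q_def by (rule degree_prod_eq_sum_degree) simp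
  also have "\<dots> = N" by (simp add: degree_power_eq N_def)
  finally have dq: "degree q = N" .
  obtain t0 where t0: "poly q t0 \<noteq> 0" using poly_eq_inf[of 0 q 0] q0 by auto
  have "zset F \<in> Var"
  proof (rule parametrised_in_Var[OF F, where p = "\<lambda>t. vec3 1 2 3 1 t (poly q t)" and u = "vec3 1 2 3 1 t0 0"])
    show "vec3 1 2 3 1 t (poly q t) \<noteq> (0 :: 'a ^ 3)" for t by (simp add: vec3_eq_0_iff[OF D])
    show "F (vec3 1 2 3 1 t (poly q t)) = 0" for t by (simp add: F_def Pq nth)
    show "vec3 1 2 3 1 t0 0 \<noteq> (0 :: 'a ^ 3)" "F (vec3 1 2 3 1 t0 0) \<noteq> 0"
      using t0 by (simp_all add: vec3_eq_0_iff[OF D] F_def Pq nth)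
  next
    fix e and G :: "'a ^ 3 \<Rightarrow> 'a" assume G: "is_form e G"
    obtain c where c: "G = form3 1 2 3 e c" using is_formE[OF D G] .
    define A where "A = (\<Sum>(a, b)\<in>tri e. smult (c a b) (monom 1 b * q ^ (e - a - b)))"
    have A: "G (vec3 1 2 3 1 t (poly q t)) = poly A t" for t
      unfolding c form3_def A_def poly_sum by (intro sum.cong refl) (auto simp: nth poly_monom)
    thus "\<exists>A. \<forall>t. G (vec3 1 2 3 1 t (poly q t)) = poly A t" by blast
    fix v assume 0: "\<And>t. G (vec3 1 2 3 1 t (poly q t)) = 0" and v: "v \<noteq> 0" "F v = 0"
    have "A = 0" by (rule poly_eq_inf[of 0]) (use A 0 in simp)
    \<comment> \<open>The monomial v_3^e alone reaches degree N e after the substitution. So a form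
      vanishing on the graph lacks this monomial, that is, it vanishes at [0:0:1].\<close>
    have "coeff A (N * e) = (\<Sum>z\<in>tri e. if z = (0, 0) then c 0 0 * lead_coeff q ^ e else 0)"
      unfolding A_def coeff_sum
    proof (intro sum.cong refl, clarify)
      fix a b assume ab: "(a, b) \<in> tri e"
      show "coeff (smult (c a b) (monom 1 b * q ^ (e - a - b))) (N * e) =
        (if (a, b) = (0, 0) then c 0 0 * lead_coeff q ^ e else 0)"
      proof (cases "(a, b) = (0, 0)")
        case True
        have "coeff (q ^ e) (N * e) = lead_coeff q ^ e"
          using lead_coeff_power[of q e] q0 by (simp add: degree_power_eq dq mult.commute)
        thus ?thesis using True by simp
      next
        case False
        have "degree (monom 1 b * q ^ (e - a - b)) \<le> b + (e - a - b) * N"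
          using q0 dq by (intro order.trans[OF degree_mult_le] add_mono degree_monom_le) (simp add: degree_power_eq)
        also have "\<dots> < (a + b) * N + (e - a - b) * N"
        proof -
          have "b < (a + b) * N"
          proof (cases "b = 0")
            case True
            thus ?thesis using False N by simp
          next
            case False
            hence "b < b * N" using N by simp
            also have "b * N \<le> (a + b) * N" by simp
            finally show ?thesis .
          qed
          thus ?thesis by simp
        qed
        also have "\<dots> = (a + b + (e - a - b)) * N" by (simp only: add_mult_distrib)
        also have "\<dots> = N * e" using ab by (simp add: mult.commute)
        finally have "coeff (monom 1 b * q ^ (e - a - b)) (N * e) = 0" by (rule coeff_eq_0)
        thus ?thesis using False by auto
      qed
    qed
    also have "\<dots> = c 0 0 * lead_coeff q ^ e" by (subst sum.delta) auto
    finally have c00: "c 0 0 = 0" using \<open>A = 0\<close> q0 by simp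
    have inf: "G (vec3 1 2 3 0 0 1) = 0"
      unfolding c form3_def
    proof (rule sum.neutral, clarify)
      fix a b assume "(a, b) \<in> tri e"
      show "c a b * (vec3 1 2 3 0 0 1 $ 1 ^ a * vec3 1 2 3 0 0 1 $ 2 ^ b * vec3 1 2 3 0 0 1 $ 3 ^ (e - a - b)) = 0"
        using c00 by (cases "a = 0"; cases "b = 0") (auto simp: nth)
    qed
    show "G v = 0"
    proof (cases "v $ 1 = 0")
      case True
      hence "P v = 0" using v(2) N by (simp add: F_def)
      hence "v $ 2 = 0" using True R by (auto simp: P_def)
      hence "v = v $ 3 *s vec3 1 2 3 0 0 1" using True by (simp add: vec3_eq_iff[OF D] nth)
      hence "G v = G (v $ 3 *s vec3 1 2 3 0 0 1)" by (rule arg_cong)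
      thus ?thesis using inf by (simp add: form_scale[OF G])
    next
      case False
      define w where "w = vec3 1 2 3 1 (v $ 2 / v $ 1) (v $ 3 / v $ 1)"
      have vw: "v = v $ 1 *s w" using False by (simp add: w_def vec3_eq_iff[OF D] nth)
      have "F v = F (v $ 1 *s w)" using vw by (rule arg_cong)
      hence "F w = 0" using v(2) False by (simp add: form_scale[OF F])
      hence "v $ 3 / v $ 1 = poly q (v $ 2 / v $ 1)" unfolding w_def F_def Pq by (simp add: nth)
      hence "G w = 0" using 0[of "v $ 2 / v $ 1"] unfolding w_def by simp
      moreover have "G v = G (v $ 1 *s w)" using vw by (rule arg_cong)
      ultimately show ?thesis by (simp add: form_scale[OF G])
    qed
  qed
  moreover have "cls v \<in> zset F \<longleftrightarrow> (\<exists>r\<in>R. v $ 2 = r * v $ 1) \<and> v $ 1 \<noteq> 0" if "v \<noteq> 0" "v $ 3 = 0" for v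
  proof -
    have "cls v \<in> zset F \<longleftrightarrow> (\<exists>r\<in>R. v $ 2 = r * v $ 1)"
      unfolding cls_in_zset[OF F that(1)] using R that by (simp add: F_def P_def)
    moreover have "v $ 1 \<noteq> 0" if "v $ 2 = r * v $ 1" for r
      using that \<open>v \<noteq> 0\<close> \<open>v $ 3 = 0\<close> vec3_eq_iff[OF D, of v 0] by auto
    ultimately show ?thesis by blast
  qed
  ultimately show ?thesis using that by blast
qed

text \<open>Exchanging the first two coordinates turns slopes into reciprocals, so the same addition
  serves \<open>Ad\<close> in the first chart and \<open>Ha\<close> in the second.\<close>

interpretation X: concurrent 1 2 3 by unfold_locales simp
interpretation Y: concurrent 2 1 3 by unfold_locales (simp add: distinct3_def)

section \<open>Arithmetic on the line at infinity\<close>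

definition slope :: "'a \<Rightarrow> ('a::{alg_closed_field, field_char_0} ^ 3) set set" where
  "slope s = X.pt 1 s 0"

lemma slope_eq_iff [simp]: "slope s = slope t \<longleftrightarrow> s = t"
  by (simp add: slope_def X.pt_eq_iff)

lemma slope_in_Var [simp]: "slope s \<in> Var"
  by (simp add: slope_def X.pt_in_Var)

lemma vec3_swap: "vec3 2 1 3 y x w = vec3 1 2 3 x y w"
  by (auto simp: vec3_eq_iff[OF distinct3_123] vec3_def)

lemma Y_pt: "Y.pt y x w = X.pt x y w"
  by (simp add: Y.pt_def X.pt_def vec3_swap)

lemma Y_ct: "Y.ct = slope 0"
  by (simp add: Y.ct_def slope_def X.pt_def vec3_swap)

lemma Y_a2: "Y.a2 = (X.a2 :: ('a::{alg_closed_field, field_char_0} ^ 3) set set)"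
proof -
  have "lin 2 3 1 0 0 = (lin 1 3 2 0 0 :: 'a ^ 3 \<Rightarrow> 'a)" by (simp add: lin_def fun_eq_iff)
  thus ?thesis by (simp add: Y.a2_def X.a2_def)
qed

lemma X_ct: "X.ct = Y.pt 1 0 0"
  by (simp add: X.ct_def Y_pt X.pt_def)

lemma Y_slope: "t \<noteq> 0 \<Longrightarrow> Y.pt 1 t 0 = slope (1 / t)"
proof -
  assume t: "t \<noteq> 0"
  have "cls (vec3 1 2 3 t 1 0) = cls (vec3 1 2 3 1 (1 / t) 0)"
    using t by (subst X.cls_vec3_eq) (auto intro!: exI[of _ "1 / t"])
  thus ?thesis by (simp add: Y_pt X.pt_def slope_def)
qed

lemma slope_Y: "a \<noteq> 0 \<Longrightarrow> slope a = Y.pt 1 (1 / a) 0"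
  using Y_slope[of "1 / a"] by simp

text \<open>All intermediate values of Horner's scheme, since the coded set in \<open>Hor\<close>
  has to contain each of them; the final value is the head.\<close>

primrec hvals :: "'a::comm_ring_1 \<Rightarrow> 'a list \<Rightarrow> 'a list" where
  "hvals x [] = []"
| "hvals x (m # ms) = (m + x * (if ms = [] then 0 else hd (hvals x ms))) # hvals x ms"

lemma hvals_Nil_iff [simp]: "hvals x ms = [] \<longleftrightarrow> ms = []"
  by (cases ms) auto

text \<open>The values arise from right to left. The first of them with property \<open>Q\<close>
  has no predecessor, and then lies in \<open>T\<close>, or has a predecessor without
  \<open>Q\<close>.\<close>

lemma hvals_step:
  "set ms \<subseteq> T \<Longrightarrow> w \<in> set (hvals x ms) \<Longrightarrow> Q w \<Longrightarrow>
   \<exists>w\<in>set (hvals x ms). Q w \<and> (w \<in> T \<or> (\<exists>m\<in>T. \<exists>w'\<in>set (hvals x ms). \<not> Q w' \<and> w = m + x * w'))"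
proof (induction ms arbitrary: w)
  case (Cons m ms)
  show ?case
  proof (cases "\<exists>w\<in>set (hvals x ms). Q w")
    case True
    then obtain w0 where "w0 \<in> set (hvals x ms)" "Q w0" by blast
    from Cons.IH[OF _ this] Cons.prems(1) obtain w where w: "w \<in> set (hvals x ms)" "Q w"
      "w \<in> T \<or> (\<exists>m\<in>T. \<exists>w'\<in>set (hvals x ms). \<not> Q w' \<and> w = m + x * w')" by auto
    show ?thesis
    proof (intro bexI[of _ w] conjI)
      show "w \<in> T \<or> (\<exists>m'\<in>T. \<exists>w'\<in>set (hvals x (m # ms)). \<not> Q w' \<and> w = m' + x * w')" using w(3) by auto
    qed (use w in auto)
  next
    case False
    hence w: "w = m + x * (if ms = [] then 0 else hd (hvals x ms))" using Cons.prems by auto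
    show ?thesis
    proof (cases "ms = []")
      case True
      thus ?thesis using w Cons.prems by (intro bexI[of _ w]) auto
    next
      case ne: False
      hence h: "hd (hvals x ms) \<in> set (hvals x ms)" by (intro hd_in_set) simp
      have "w = m + x * hd (hvals x ms)" using w ne by simp
      moreover have "m \<in> T" using Cons.prems by simp
      moreover have "\<not> Q (hd (hvals x ms))" using False h by blast
      moreover have "hd (hvals x ms) \<in> set (hvals x (m # ms))" using h by simp
      ultimately show ?thesis using Cons.prems(2,3) by blast
    qed
  qed
qed simp

lemma poly_hvals:
  assumes "0 \<in> R" shows "pover R p \<Longrightarrow> \<exists>ms. ms \<noteq> [] \<and> set ms \<subseteq> R \<and> hd (hvals x ms) = poly p x"
proof (induction p)
  case 0
  show ?case using assms by (intro exI[of _ "[0]"]) simp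
next
  case (pCons a p)
  then obtain ms where "ms \<noteq> []" "set ms \<subseteq> R" "hd (hvals x ms) = poly p x" by (auto simp: pover_pCons_iff)
  thus ?case using pCons by (intro exI[of _ "a # ms"]) (auto simp: pover_pCons_iff)
qed

locale standard_env =
  fixes e :: "nat \<Rightarrow> ('a::{alg_closed_field, field_char_0} ^ 3) set set"
  assumes e_Var: "e n \<in> Var"
    and e: "e 0 = X.a2" "e 1 = X.a0" "e 2 = X.a1" "e 3 = Y.a0" "e 4 = Y.a1" "e 5 = X.ct" "e 6 = slope 0"
      "e 7 = X.pt 0 0 1" "e 8 = slope 1"
begin

abbreviation "Unv \<equiv> Uni Var (\<subseteq>) e"

lemma Ad_iff:
  assumes "x \<in> Var" "y \<in> Var" "w \<in> Var"
  shows "Ad Var (\<subseteq>) e x y w \<longleftrightarrow> (\<exists>s t. x = slope s \<and> y = slope t \<and> w = slope (s + t))"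
  unfolding Ad_def e using X.AD_iff[OF assms] by (simp add: slope_def)

lemma Ha_iff:
  assumes "x \<in> Var" "y \<in> Var" "w \<in> Var"
  shows "Ha Var (\<subseteq>) e x y w \<longleftrightarrow> (\<exists>s t. x = Y.pt 1 s 0 \<and> y = Y.pt 1 t 0 \<and> w = Y.pt 1 (s + t) 0)"
  unfolding Ha_def e using Y.AD_iff[OF assms] by (simp add: Y_ct Y_a2 X_ct Y_pt[of 0 0 1])

lemma Ad_slope: "Ad Var (\<subseteq>) e (slope a) (slope b) (slope c) \<longleftrightarrow> c = a + b"
  by (subst Ad_iff) auto

lemma Ad_slope1: "w \<in> Var \<Longrightarrow> Ad Var (\<subseteq>) e (slope a) (slope b) w \<longleftrightarrow> w = slope (a + b)"
  by (subst Ad_iff) auto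

lemma Ad_slope2: "w \<in> Var \<Longrightarrow> Ad Var (\<subseteq>) e (slope a) w (slope c) \<longleftrightarrow> w = slope (c - a)"
  by (subst Ad_iff) (auto simp: algebra_simps intro!: exI[of _ "c - a"])

lemma Ad_slope3: "w \<in> Var \<Longrightarrow> Ad Var (\<subseteq>) e w (slope b) (slope c) \<longleftrightarrow> w = slope (c - b)"
  by (subst Ad_iff) (auto simp: algebra_simps intro!: exI[of _ "c - b"])

text \<open>If a + b were 0, the reciprocals would add up to 0, which is the direction
  \<open>X.ct\<close> outside the universe.\<close>

lemma Ha_slope:
  assumes "a \<noteq> 0" "b \<noteq> 0" "a + b \<noteq> 0" "w \<in> Var"
  shows "Ha Var (\<subseteq>) e (slope a) (slope b) w \<longleftrightarrow> w = slope (a * b / (a + b))"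
proof -
  have "1 / a + 1 / b = (a + b) / (a * b)" using assms by (simp add: field_simps)
  moreover from this have "1 / a + 1 / b \<noteq> 0" using assms by simp
  ultimately have w: "Y.pt 1 (1 / a + 1 / b) 0 = slope (a * b / (a + b))" by (subst Y_slope) auto
  have "Ha Var (\<subseteq>) e (slope a) (slope b) w \<longleftrightarrow>
      (\<exists>s t. Y.pt 1 (1 / a) 0 = Y.pt 1 s 0 \<and> Y.pt 1 (1 / b) 0 = Y.pt 1 t 0 \<and> w = Y.pt 1 (s + t) 0)"
    using assms by (subst Ha_iff) (auto simp: slope_Y Y.pt_in_Var)
  also have "\<dots> \<longleftrightarrow> w = Y.pt 1 (1 / a + 1 / b) 0" unfolding Y.pt_eq_iff by auto
  finally show ?thesis using w by simp
qed

lemma Sq_slope: "y \<in> Var \<Longrightarrow> Sq Var (\<subseteq>) e (slope a) y \<longleftrightarrow> y = slope (a ^ 2)"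
proof -
  assume y: "y \<in> Var"
  consider "a = 0" | "a = 1" | "a \<noteq> 0" "a \<noteq> 1" by blast
  thus ?thesis
  proof cases
    case 3
    have "Sq Var (\<subseteq>) e (slope a) y \<longleftrightarrow> (\<exists>c\<in>Var. \<exists>d\<in>Var. c = slope (1 - a) \<and>
        Ha Var (\<subseteq>) e (slope a) c d \<and> Ad Var (\<subseteq>) e y d (slope a))"
      unfolding Sq_def e using 3 by (simp add: Ad_slope2 cong: bex_cong)
    also have "\<dots> \<longleftrightarrow> (\<exists>d\<in>Var. Ha Var (\<subseteq>) e (slope a) (slope (1 - a)) d \<and> Ad Var (\<subseteq>) e y d (slope a))"
      by auto
    also have "\<dots> \<longleftrightarrow> (\<exists>d\<in>Var. d = slope (a * (1 - a)) \<and> Ad Var (\<subseteq>) e y d (slope a))"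
      using 3 by (simp add: Ha_slope cong: bex_cong)
    also have "\<dots> \<longleftrightarrow> Ad Var (\<subseteq>) e y (slope (a * (1 - a))) (slope a)" by auto
    also have "\<dots> \<longleftrightarrow> y = slope (a ^ 2)"
      using y by (simp add: Ad_slope3 power2_eq_square algebra_simps)
    finally show ?thesis .
  qed (auto simp: Sq_def e)
qed

lemma Mu_slope: "Mu Var (\<subseteq>) e (slope a) (slope b) (slope c) \<longleftrightarrow> c = a * b"
proof -
  have "Mu Var (\<subseteq>) e (slope a) (slope b) (slope c) \<longleftrightarrow>
      (\<exists>u\<in>Var. u = slope (a + b) \<and> (\<exists>p\<in>Var. p = slope (a ^ 2) \<and> (\<exists>q\<in>Var. q = slope (b ^ 2) \<and> (\<exists>r\<in>Var.
        Sq Var (\<subseteq>) e u r \<and> (\<exists>t\<in>Var. Ad Var (\<subseteq>) e p q t \<and> (\<exists>t'\<in>Var. t' = slope (c + c) \<and> Ad Var (\<subseteq>) e t t' r))))))"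
    unfolding Mu_def by (simp add: Ad_slope1 Sq_slope cong: bex_cong conj_cong)
  also have "\<dots> \<longleftrightarrow> (a + b) ^ 2 = a ^ 2 + b ^ 2 + (c + c)"
    by (simp add: Ad_slope1 Sq_slope Ad_slope cong: bex_cong conj_cong) 
  \<comment> \<open>The factor 2 cancels in characteristic zero.\<close>
  also have "\<dots> \<longleftrightarrow> 2 * (a * b) = 2 * c" by (simp add: power2_eq_square algebra_simps mult_2)
  finally show ?thesis by auto
qed

lemma Unv_eq: "Unv = range slope"
proof
  show "range slope \<subseteq> Unv"
  proof
    fix x :: "('a ^ 3) set set" assume "x \<in> range slope"
    then obtain s where x: "x = slope s" by blast
    have "slope s \<subseteq> X.a2" using X.line_mem(3)[of "vec3 1 2 3 1 s 0"] X.v_ne[of 1 s 0]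
      by (simp add: slope_def X.pt_def X.nth)
    moreover have "slope (s + 1) \<subseteq> X.a2" using X.line_mem(3)[of "vec3 1 2 3 1 (s + 1) 0"] X.v_ne[of 1 "s + 1" 0]
      by (simp add: slope_def X.pt_def X.nth)
    moreover have "\<not> slope (s + 1) \<subseteq> slope s"
    proof
      assume "slope (s + 1) \<subseteq> slope s"
      hence "slope (s + 1) = slope s" by (simp add: slope_def X.pt_def)
      thus False by simp
    qed
    ultimately have "slope s \<noteq> X.a2" by blast
    moreover have "slope s \<noteq> X.ct" by (simp add: slope_def X.pt_ne_ct)
    ultimately show "x \<in> Unv" using \<open>slope s \<subseteq> X.a2\<close> x by (simp add: Uni_def e)
  qed
  show "Unv \<subseteq> range slope"
  proof
    fix x assume "x \<in> Unv"
    hence x: "x \<in> Var" "x \<subset> X.a2" "x \<noteq> X.ct" by (auto simp: Uni_def e)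
    have "(X.a2 :: ('a ^ 3) set set) \<in> Var" using e_Var[of 0] unfolding e .
    then obtain v where v: "v \<noteq> 0" "x = {cls v}" using proper_subvariety[OF _ x(1,2)] by metis
    then obtain p where "cls v = cls (vec3 1 2 3 1 p 0)" using X.on_a2[of v] x by blast
    thus "x \<in> range slope" using v by (auto simp: slope_def X.pt_def)
  qed
qed

lemma ring_rel_slope: "ring_rel Unv (Ad Var (\<subseteq>) e) (Mu Var (\<subseteq>) e) (e 6)"
proof -
  have "\<exists>w. y = x + w" for x y :: 'a by (rule exI[of _ "y - x"]) simp
  thus ?thesis unfolding ring_rel_def Unv_eq e
    by (simp add: Ad_slope Mu_slope add.assoc add.commute mult.assoc mult.commute distrib_left)
qed

lemma representable:
  assumes "finite R" "R \<noteq> {}"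
  shows "\<exists>d\<in>Var. \<not> e 0 \<subseteq> d \<and> (\<forall>w\<in>Unv. w \<subseteq> d \<longleftrightarrow> w \<in> slope ` R)"
proof -
  obtain d where d: "d \<in> Var"
    "\<And>v. v \<noteq> 0 \<Longrightarrow> v $ 3 = 0 \<Longrightarrow> cls v \<in> d \<longleftrightarrow> (\<exists>r\<in>R. v $ 2 = r * v $ 1) \<and> v $ 1 \<noteq> 0"
    using finite_set_curve[OF assms] by blast
  have s: "slope s \<subseteq> d \<longleftrightarrow> s \<in> R" for s
    using d(2)[OF X.v_ne[of 1 s 0]] by (simp add: slope_def X.pt_def X.nth)
  have "\<not> X.a2 \<subseteq> d"
  proof
    assume "X.a2 \<subseteq> d"
    moreover have "cls (vec3 1 2 3 0 1 0) \<in> (X.a2 :: ('a ^ 3) set set)"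
      by (subst X.line_mem(3)) (simp_all add: X.nth X.v_ne)
    ultimately have "cls (vec3 1 2 3 0 1 0) \<in> d" by (rule subsetD)
    thus False using d(2)[OF X.v_ne[of 0 "1 :: 'a" 0]] by (simp add: X.nth)
  qed
  moreover have "\<forall>w\<in>Unv. w \<subseteq> d \<longleftrightarrow> w \<in> slope ` R" unfolding Unv_eq using s by auto
  ultimately show ?thesis using d(1) unfolding e by blast
qed

text \<open>A curve not containing the line at infinity meets it in finitely many points. Such a
  trace with one more slope is again finite, so \<open>representable\<close> provides the new
  curve.\<close>

lemma fin_rel_slope: "fin_rel Var (\<subseteq>) (e 0) Unv"
  unfolding fin_rel_def
proof (intro conjI ballI impI)
  fix x assume "x \<in> Unv"
  then obtain s where "x = slope s" unfolding Unv_eq by blast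
  thus "\<exists>d\<in>Var. \<not> e 0 \<subseteq> d \<and> (\<forall>w\<in>Unv. w \<subseteq> d \<longleftrightarrow> w = x)" using representable[of "{s}"] by auto
  fix d assume d: "d \<in> Var" "\<not> e 0 \<subseteq> d"
  define R where "R = {r. slope r \<subseteq> d}"
  have sU: "slope r \<in> Var" "slope r \<subset> e 0" for r
  proof -
    have "slope r \<in> Unv" unfolding Unv_eq by blast
    thus "slope r \<in> Var" "slope r \<subset> e 0" unfolding Uni_def by blast+
  qed
  have "slope ` R \<subseteq> (\<lambda>P. {P}) ` (e 0 \<inter> d)"
  proof (rule image_subsetI)
    fix r assume "r \<in> R"
    thus "slope r \<in> (\<lambda>P. {P}) ` (e 0 \<inter> d)" using sU[of r] by (auto simp: R_def slope_def X.pt_def)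
  qed
  moreover have "finite (e 0 \<inter> d)" by (rule finite_Int_Var[OF e_Var sU d])
  ultimately have "finite (slope ` R)" by (meson finite_imageI finite_subset)
  hence "finite R" by (rule finite_imageD) (simp add: inj_on_def)
  hence fin: "finite (insert s R)" by simp
  have "w \<in> slope ` insert s R \<longleftrightarrow> w \<subseteq> d \<or> w = x" if w: "w \<in> Unv" for w
  proof -
    obtain r where "w = slope r" using w unfolding Unv_eq by blast
    thus ?thesis using \<open>x = slope s\<close> by (auto simp: R_def)
  qed
  thus "\<exists>d'\<in>Var. \<not> e 0 \<subseteq> d' \<and> (\<forall>w\<in>Unv. w \<subseteq> d' \<longleftrightarrow> w \<subseteq> d \<or> w = x)"
    using representable[OF fin] by simp
qed

text \<open>The witness for \<open>d\<close> is a curve through the slopes of all intermediate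
  Horner values; \<open>hvals_step\<close> answers every challenge \<open>d'\<close>.\<close>

lemma Hor_poly:
  assumes R: "0 \<in> R" "\<And>r. r \<in> R \<Longrightarrow> T (slope r)" and p: "pover R p"
  shows "Hor Var (\<subseteq>) e T (slope a) (slope (poly p a))"
proof -
  obtain ms where ms: "ms \<noteq> []" "set ms \<subseteq> R" "hd (hvals a ms) = poly p a" using poly_hvals[OF R(1) p] by blast
  let ?H = "set (hvals a ms)"
  have H: "finite ?H" "?H \<noteq> {}" using ms by auto
  obtain d where d: "d \<in> Var" "\<not> e 0 \<subseteq> d" "\<forall>w\<in>Unv. w \<subseteq> d \<longleftrightarrow> w \<in> slope ` ?H"
    using representable[OF H] by (elim bexE conjE)
  have sU: "slope r \<in> Unv" for r by (simp add: Unv_eq)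
  have sd: "slope r \<subseteq> d \<longleftrightarrow> r \<in> ?H" for r using bspec[OF d(3) sU[of r]] by auto
  show ?thesis unfolding Hor_def
  proof (rule conjI[OF sU], rule bexI[OF _ d(1)], intro conjI ballI impI d(2))
    have "hd (hvals a ms) \<in> ?H" using ms by (intro hd_in_set) simp
    thus "slope (poly p a) \<subseteq> d" using ms(3) sd by simp
    fix d' assume "\<exists>w\<in>Unv. w \<subseteq> d \<and> w \<subseteq> d'"
    then obtain w0 where w0: "w0 \<in> ?H" "slope w0 \<subseteq> d'" unfolding Unv_eq using sd by auto
    obtain w where w: "w \<in> ?H" "slope w \<subseteq> d'"
      "w \<in> R \<or> (\<exists>m\<in>R. \<exists>w'\<in>?H. \<not> slope w' \<subseteq> d' \<and> w = m + a * w')"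
      using hvals_step[OF ms(2) w0(1), of "\<lambda>w. slope w \<subseteq> d'"] w0(2) by blast
    have tw: "T (slope w) \<or> (\<exists>m\<in>Unv. \<exists>w'\<in>Unv. \<exists>v\<in>Unv. T m \<and> w' \<subseteq> d \<and> \<not> w' \<subseteq> d' \<and>
             Mu Var (\<subseteq>) e (slope a) w' v \<and> Ad Var (\<subseteq>) e m v (slope w))"
      using w(3)
    proof (elim disjE bexE conjE)
      fix m w' assume *: "m \<in> R" "w' \<in> ?H" "\<not> slope w' \<subseteq> d'" "w = m + a * w'"
      hence "T (slope m) \<and> slope w' \<subseteq> d \<and> \<not> slope w' \<subseteq> d' \<and>
         Mu Var (\<subseteq>) e (slope a) (slope w') (slope (a * w')) \<and> Ad Var (\<subseteq>) e (slope m) (slope (a * w')) (slope w)"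
        using R sd by (simp add: Mu_slope Ad_slope)
      thus ?thesis using sU by blast
    qed (use R in blast)
    show "\<exists>w\<in>Unv. w \<subseteq> d \<and> w \<subseteq> d' \<and> (T w \<or> (\<exists>m\<in>Unv. \<exists>w'\<in>Unv. \<exists>v\<in>Unv. T m \<and> w' \<subseteq> d \<and> \<not> w' \<subseteq> d' \<and>
             Mu Var (\<subseteq>) e (slope a) w' v \<and> Ad Var (\<subseteq>) e m v w))"
      by (rule bexI[OF _ sU[of w]], intro conjI, simp add: sd w(1), rule w(2), rule tw)
  qed
qed

end

section \<open>Fields of finite transcendence degree\<close>

definition pring :: "'a::comm_ring_1 set \<Rightarrow> 'a \<Rightarrow> 'a set" where
  "pring R a = {poly p a | p. pover R p}"

lemma pringI: "pover R p \<Longrightarrow> poly p a = x \<Longrightarrow> x \<in> pring R a"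
  unfolding pring_def by blast

lemma subrg_pring:
  assumes R: "subrg R" shows "subrg (pring R a)" "R \<subseteq> pring R a" "a \<in> pring R a"
proof -
  note r = subrgD[OF R]
  show "R \<subseteq> pring R a"
  proof
    fix c assume "c \<in> R"
    hence "pover R [:c:]" "poly [:c:] a = c" using r by (auto simp: pover_pCons_iff pover_0)
    thus "c \<in> pring R a" by (rule pringI)
  qed
  have "pover R [:0, 1:]" "poly [:0, 1:] a = a" using r by (auto simp: pover_pCons_iff pover_0)
  thus "a \<in> pring R a" by (rule pringI)
  show "subrg (pring R a)" unfolding subrg_def
  proof (intro conjI ballI)
    show "0 \<in> pring R a" "1 \<in> pring R a" using r \<open>R \<subseteq> pring R a\<close> by auto
    fix x assume "x \<in> pring R a"
    then obtain p where p: "pover R p" "x = poly p a" unfolding pring_def by blast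
    have "pover R (- p)" using p r by (auto simp: pover_def)
    moreover have "poly (- p) a = - x" using p by simp
    ultimately show "- x \<in> pring R a" by (rule pringI)
    fix y assume "y \<in> pring R a"
    then obtain q where q: "pover R q" "y = poly q a" unfolding pring_def by blast
    have "pover R (p + q)" using p q r by (auto simp: pover_def)
    moreover have "poly (p + q) a = x + y" using p q by simp
    ultimately show "x + y \<in> pring R a" by (rule pringI)
    have "pover R (p * q)" using p q r unfolding pover_def coeff_mult by (intro allI subrg_sum[OF R]) auto
    moreover have "poly (p * q) a = x * y" using p q by simp
    ultimately show "x * y \<in> pring R a" by (rule pringI)
  qed
qed

text \<open>Level 0 of the tower is not a ring. Adjoining the parameter 2 repairs this: binary
  digits give the natural numbers, and the digit -1 the negatives.\<close>

lemma binary_expansion: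
  "\<exists>p. pover {0, 1, -1} p \<and> poly p 2 = (of_nat n :: 'a::comm_ring_1)"
proof (induction n rule: less_induct)
  case (less n)
  show ?case
  proof (cases "n = 0")
    case True
    thus ?thesis by (intro exI[of _ 0]) (simp add: pover_0)
  next
    case False
    then obtain p where p: "pover {0, 1, -1} p" "poly p 2 = (of_nat (n div 2) :: 'a)"
      using less[of "n div 2"] by auto
    have "n = n mod 2 + 2 * (n div 2)" by simp
    hence "(of_nat n :: 'a) = of_nat (n mod 2) + 2 * of_nat (n div 2)"
      by (metis of_nat_add of_nat_mult of_nat_numeral)
    moreover have "n mod 2 = 0 \<or> n mod 2 = 1" by auto
    hence "(of_nat (n mod 2) :: 'a) \<in> {0, 1, -1}" by auto
    ultimately show ?thesis using p
      by (intro exI[of _ "pCons (of_nat (n mod 2)) p"]) (auto simp: pover_pCons_iff)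
  qed
qed

lemma pring_signs: "pring {0, 1, -1} (2 :: 'a::comm_ring_1) = \<int>"
proof
  show "pring {0, 1, -1} (2 :: 'a) \<subseteq> \<int>"
  proof -
    have "poly p (2 :: 'a) \<in> \<int>" if "pover {0, 1, -1} p" for p
      using that by (induction p) (auto simp: pover_pCons_iff)
    thus ?thesis unfolding pring_def by blast
  qed
  show "\<int> \<subseteq> pring {0, 1, -1} (2 :: 'a)"
  proof
    fix x :: 'a assume "x \<in> \<int>"
    then obtain z where x: "x = of_int z" by (rule Ints_cases)
    obtain p where p: "pover {0, 1, -1} p" "poly p 2 = (of_nat (nat \<bar>z\<bar>) :: 'a)"
      using binary_expansion by blast
    have "pover {0, 1, -1} (- p)" using p(1) by (auto simp: pover_def)
    moreover have "x = poly p 2 \<or> x = poly (- p) 2" unfolding x poly_minus p(2)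
      by (cases "0 \<le> z") auto
    ultimately show "x \<in> pring {0, 1, -1} 2" using p(1) unfolding pring_def by blast
  qed
qed

text \<open>The intended meaning of \<open>Ts\<close> over \<open>K\<close>:
  \<open>Rs \<alpha> 1\<close> is the ring of integers if the first parameter is 2.\<close>

primrec Rs :: "(nat \<Rightarrow> 'a::comm_ring_1) \<Rightarrow> nat \<Rightarrow> 'a set" where
  "Rs \<alpha> 0 = {0, 1, -1}"
| "Rs \<alpha> (Suc i) = pring (Rs \<alpha> i) (\<alpha> i)"

lemma zero_in_Rs: "0 \<in> Rs \<alpha> i"
proof (cases i)
  case (Suc j)
  have "0 \<in> Rs \<alpha> j \<Longrightarrow> 0 \<in> pring (Rs \<alpha> j) (\<alpha> j)" for j
    unfolding pring_def using pover_0[of "Rs \<alpha> j"] by force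
  hence "0 \<in> Rs \<alpha> j" for j by (induction j) auto
  thus ?thesis by blast
qed simp

text \<open>The shift of indices is due to \<alpha> 0 = 2, which turns level 1 into the integers;
  proper generators start with \<alpha> 1.\<close>

lemma subrg_Rs: "\<alpha> 0 = 2 \<Longrightarrow> subrg (Rs \<alpha> (Suc i)) \<and> (\<forall>j<i. \<alpha> (Suc j) \<in> Rs \<alpha> (Suc i))"
proof (induction i)
  case 0
  have "subrg (\<int> :: 'a set)" by (auto simp: subrg_def)
  thus ?case using 0 by (simp add: pring_signs)
next
  case (Suc i)
  hence IH: "subrg (Rs \<alpha> (Suc i))" "\<And>j. j < i \<Longrightarrow> \<alpha> (Suc j) \<in> Rs \<alpha> (Suc i)" by auto
  show ?case unfolding Rs.simps(2)[of \<alpha> "Suc i"]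
    using subrg_pring[OF IH(1), of "\<alpha> (Suc i)"] IH(2) by (auto simp: less_Suc_eq simp del: Rs.simps)
qed

text \<open>As \<open>x\<close> is nonzero, powers of \<open>x\<close> can be divided out until the
  constant term is nonzero; this is the shape demanded by \<open>Alg\<close>.\<close>

lemma relation_constant_term:
  fixes x :: "'a::idom"
  shows "pover R q \<Longrightarrow> q \<noteq> 0 \<Longrightarrow> poly q x = 0 \<Longrightarrow> x \<noteq> 0 \<Longrightarrow>
    \<exists>c h. c \<in> R \<and> c \<noteq> 0 \<and> pover R h \<and> c + x * poly h x = 0"
proof (induction q)
  case (pCons a q)
  show ?case
  proof (cases "a = 0")
    case True
    thus ?thesis using pCons by (auto simp: pover_pCons_iff)
  next
    case False
    thus ?thesis using pCons by (intro exI[of _ a] exI[of _ q]) (auto simp: pover_pCons_iff)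
  qed
qed simp

text \<open>Maximality of \<open>B\<close> makes \<open>x\<close> algebraic over the rational
  polynomials in \<open>B\<close>. A common denominator brings the coefficients down from the
  fraction field to the ring itself.\<close>

lemma algebraic_over_basis:
  fixes B :: "'a::field_char_0 set"
  assumes B: "transcendence_basis B" and R: "subrg R" "B \<subseteq> R"
  shows "\<exists>q. pover R q \<and> q \<noteq> 0 \<and> poly q x = 0"
proof (cases "x \<in> B")
  case True
  hence "pover R [:-x, 1:]" using R subrgD[OF R(1)] by (auto simp: pover_pCons_iff pover_0)
  thus ?thesis by (intro exI[of _ "[:-x, 1:]"]) simp
next
  case False
  hence "\<not> alg_independent (insert x B)" using B unfolding transcendence_basis_def by blast
  then obtain q where q: "pover (QB B) q" "q \<noteq> 0" "poly q x = 0"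
    using dependent_insert[OF _ False] B unfolding transcendence_basis_def by blast
  have k: "subfld (fracs R)" by (rule subfld_fracs[OF R(1)])
  have "QB B \<subseteq> fracs R"
  proof
    fix y assume "y \<in> QB B"
    then obtain p where p: "qpoly B p" "y = self_eval p" unfolding QB_def by blast
    have "Poly_Mapping.lookup p m \<in> fracs R" for m
      using p(1) Rats_le_subfld[OF k] unfolding qpoly_def by blast
    moreover have "mon_eval m (\<lambda>b. b) \<in> fracs R" if "m \<in> Poly_Mapping.keys p" for m
      unfolding mon_eval_def using that p(1) R(2) fracs_superset[OF R(1)] unfolding qpoly_def
      by (intro subfld_prod[OF k] subfldD(9)[OF k]) blast
    ultimately show "y \<in> fracs R"
      unfolding p(2) mpoly_eval_superset[OF finite_keys order.refl]
      by (intro subfld_sum[OF k] subfldD(4)[OF k]) auto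
  qed
  then obtain C where "C \<noteq> 0" "pover R (smult C q)"
    using common_denominator[OF R(1) pover_mono[OF q(1)]] by blast
  thus ?thesis using q by (intro exI[of _ "smult C q"]) simp
qed

context standard_env
begin

lemma Ts_Rs:
  assumes "\<And>i. i < k \<Longrightarrow> e (9 + i) = slope (\<alpha> i)"
  shows "i \<le> k \<Longrightarrow> r \<in> Rs \<alpha> i \<Longrightarrow> Ts Var (\<subseteq>) e i (slope r)"
proof (induction i arbitrary: r)
  case 0
  thus ?case by (auto simp: e Ad_slope)
next
  case (Suc i)
  then obtain p where p: "pover (Rs \<alpha> i) p" "r = poly p (\<alpha> i)" by (auto simp: pring_def)
  have "Hor Var (\<subseteq>) e (Ts Var (\<subseteq>) e i) (slope (\<alpha> i)) (slope (poly p (\<alpha> i)))"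
    by (rule Hor_poly[OF zero_in_Rs _ p(1)]) (use Suc in auto)
  thus ?case using assms[of i] Suc.prems p(2) by simp
qed

text \<open>With the figure in standard position and the basis as parameters, the last level of the
  tower is a ring containing \<open>B\<close>, over which every element is algebraic.\<close>

lemma Phi_basis:
  fixes B :: "'a set"
  assumes B: "transcendence_basis B" "B = (\<lambda>i. \<alpha> (Suc i)) ` {..<n}" and \<alpha>: "\<alpha> 0 = 2"
    and e9: "\<And>i. i < Suc n \<Longrightarrow> e (9 + i) = slope (\<alpha> i)"
  shows "Phi Var (\<subseteq>) e (Suc n)"
  unfolding Phi_def
proof (intro conjI ballI)
  show "ring_rel Unv (Ad Var (\<subseteq>) e) (Mu Var (\<subseteq>) e) (e 6)" by (rule ring_rel_slope)
  show "e 8 \<in> Unv" unfolding Unv_eq e by blast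
  show "fin_rel Var (\<subseteq>) (e 0) Unv" by (rule fin_rel_slope)
  fix X assume "X \<in> Unv"
  then obtain x where x: "X = slope x" unfolding Unv_eq by blast
  show "Alg Var (\<subseteq>) e (Ts Var (\<subseteq>) e (Suc n)) X"
  proof (cases "x = 0")
    case True
    thus ?thesis by (simp add: Alg_def e x)
  next
    case False
    let ?R = "Rs \<alpha> (Suc n)"
    have R: "subrg ?R" "B \<subseteq> ?R" using subrg_Rs[of \<alpha> n, OF \<alpha>] B(2) by auto
    obtain q where "pover ?R q" "q \<noteq> 0" "poly q x = 0" using algebraic_over_basis[OF B(1) R] by blast
    from relation_constant_term[OF this False] obtain c h
      where c: "c \<in> ?R" "c \<noteq> 0" "pover ?R h" "c + x * poly h x = 0" by blast
    have T: "Ts Var (\<subseteq>) e (Suc n) (slope r)" if "r \<in> ?R" for r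
      by (rule Ts_Rs[OF e9]) (use that in auto)
    have "Hor Var (\<subseteq>) e (Ts Var (\<subseteq>) e (Suc n)) (slope x) (slope (poly h x))"
      by (rule Hor_poly[OF zero_in_Rs _ c(3)]) (rule T)
    moreover have "- c = x * poly h x" using c(4) by (simp add: add_eq_0_iff2 minus_equation_iff)
    hence "Mu Var (\<subseteq>) e (slope x) (slope (poly h x)) (slope (- c))" by (simp add: Mu_slope)
    moreover have "Ts Var (\<subseteq>) e (Suc n) (slope (- c))" using T subrgD(5)[OF R(1) c(1)] by blast
    moreover have "slope (- c) \<noteq> e 6" using c(2) by (simp add: e)
    moreover have "slope r \<in> Unv" for r unfolding Unv_eq by blast
    ultimately show ?thesis unfolding Alg_def x by blast
  qed
qed

end

theorem finite_basis_not_equivalent: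
  fixes B :: "'k::{alg_closed_field, field_char_0} set"
  assumes B: "transcendence_basis B" "finite B"
  shows "\<not> elementarily_equivalent (Var :: ('k ^ 3) set set set) (\<subseteq>) (Var :: (complex ^ 3) set set set) (\<subseteq>)"
proof
  assume eq: "elementarily_equivalent (Var :: ('k ^ 3) set set set) (\<subseteq>) (Var :: (complex ^ 3) set set set) (\<subseteq>)"
  obtain bs where bs: "set bs = B" using finite_list[OF B(2)] by blast
  define n where "n = length bs"
  \<comment> \<open>The number 2 for the integers, followed by the transcendence basis.\<close>
  define \<alpha> where "\<alpha> i = (case i of 0 \<Rightarrow> 2 | Suc j \<Rightarrow> bs ! j)" for i
  define ps where "ps = [X.a2, X.a0, X.a1, Y.a0, Y.a1, X.ct, slope 0, X.pt 0 0 1, slope (1::'k)]"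
  define e where "e m = (if m < 9 then ps ! m else slope (\<alpha> (m - 9)))" for m
  have ps: "set ps \<subseteq> Var" unfolding ps_def
    using line_in_Var[of 2 1 3] line_in_Var[of 1 3 2] line_in_Var[of 1 2 3]
    by (auto simp: X.a2_def X.a0_def X.a1_def Y.a0_def Y.a1_def X_ct Y.pt_in_Var X.pt_in_Var distinct3_def
        intro!: line_in_Var)
  have eV: "e m \<in> Var" for m
  proof (cases "m < 9")
    case True
    hence "ps ! m \<in> set ps" by (intro nth_mem) (simp add: ps_def)
    thus ?thesis using True ps by (auto simp: e_def)
  qed (simp add: e_def)
  interpret standard_env e
    by unfold_locales (use eV in \<open>auto simp: e_def ps_def\<close>)
  have BB: "B = (\<lambda>i. \<alpha> (Suc i)) ` {..<n}"
    unfolding bs[symmetric] n_def by (auto simp: \<alpha>_def set_conv_nth)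
  have e9: "e (9 + i) = slope (\<alpha> i)" for i by (simp add: e_def)
  have Phi: "Phi Var (\<subseteq>) e (Suc n)" by (rule Phi_basis[OF B(1) BB _ e9]) (simp add: \<alpha>_def)
  \<comment> \<open>The added conjuncts place the parameters in the universe, as
    \<open>not_Phi_complex\<close> requires of whatever replaces them over the complex
    numbers.\<close>
  define \<phi> where "\<phi> = Conj (fPhi (Suc n)) (conjs (map (\<lambda>i. fU (9 + i)) [0..<Suc n]))"
  have sat: "satisfies D le e \<phi> \<longleftrightarrow> Phi D le e (Suc n) \<and> (\<forall>i<Suc n. e (9 + i) \<in> Uni D le e)"
    if "\<forall>n. e n \<in> D" for D :: "'s set" and le and e
    unfolding \<phi>_def satisfies.simps sat_fPhi[OF that] sat_conjs using that
    by (auto simp: sat_fU simp del: upt_Suc)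
  have "e (9 + i) \<in> Unv" for i unfolding e9 Unv_eq by blast
  hence "satisfies Var (\<subseteq>) e \<phi>" using sat[of e Var "(\<subseteq>)"] eV Phi by simp
  moreover have "(Var :: (complex ^ 3) set set set) \<noteq> {}" using slope_in_Var[of "0 :: complex"] by blast
  moreover have "(Var :: ('k ^ 3) set set set) \<noteq> {}" using eV by blast
  ultimately obtain e' where e': "\<forall>n. e' n \<in> (Var :: (complex ^ 3) set set set)" "satisfies Var (\<subseteq>) e' \<phi>"
    using elementarily_equivalent_ex[OF eq] eV by blast
  hence "Phi Var (\<subseteq>) e' (Suc n)" "\<And>i. i < Suc n \<Longrightarrow> e' (9 + i) \<in> Uni Var (\<subseteq>) e'"
    using sat[of e' Var "(\<subseteq>)"] by auto
  thus False using not_Phi_complex[OF e'(1)] by blast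
qed

theorem corollary13p7:
  shows "elementarily_equivalent
           (Var :: ('k::{alg_closed_field, field_char_0} ^ 3) set set set) (\<subseteq>)
           (Var :: (complex ^ 3) set set set) (\<subseteq>)
         \<longleftrightarrow> BNF_Cardinal_Arithmetic.cinfinite (transcendence_degree :: 'k rel)"
proof -
  define B where "B = (SOME B :: 'k set. transcendence_basis B)"
  have B: "transcendence_basis B" unfolding B_def by (rule someI_ex[OF ex_transcendence_basis])
  have "BNF_Cardinal_Arithmetic.cinfinite (transcendence_degree :: 'k rel) \<longleftrightarrow> infinite B"
    unfolding BNF_Cardinal_Arithmetic.cinfinite_def transcendence_degree_def B_def Field_card_of ..
  moreover have "inf_tr TYPE('k)" if "infinite B"
    using infinite_independent_inf_tr B that unfolding transcendence_basis_def by blast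
  ultimately show ?thesis
    using inf_tr_elementarily_equivalent[OF _ inf_tr_complex] finite_basis_not_equivalent[OF B] by blast
qed

end
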